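(* Let $k$ be an algebraically closed field of characteristic $2$, $n\geq 2$, and let $\mathcal O$ be the conjugacy class of a mixed element $g$ of $Sp_{2n}(k)$. Then $\mathcal O$ is not spherical.
   Context: A conjugacy class $\mathcal O$ of an algebraic group $G$ is called spherical if a Borel subgroup of $G$, acting by conjugation, has a dense orbit on $\mathcal O$. An element $g\in G$ with Jordan decomposition $g=su$ ($s$ semisimple, $u$ unipotent, $su=us$) is called mixed if $s\notin Z(G)$ and $u\neq 1$. *)

theory Defs
  imports
    "Jordan_Normal_Form.Determinant"
    "HOL-Analysis.Abstract_Topology"
    "HOL-Algebra.Solvable_Groups"
    "HOL-Algebra.Group_Action"
begin

section \<open>The Zariski topology on square matrices\<close>

inductive_set poly_functions :: "nat \<Rightarrow> ('a::comm_ring_1 mat \<Rightarrow> 'a) set" for m :: nat where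
  const: "(\<lambda>_. c) \<in> poly_functions m"
| coord: "i < m \<Longrightarrow> j < m \<Longrightarrow> (\<lambda>A. A $$ (i, j)) \<in> poly_functions m"
| add: "p \<in> poly_functions m \<Longrightarrow> q \<in> poly_functions m \<Longrightarrow> (\<lambda>A. p A + q A) \<in> poly_functions m"
| mult: "p \<in> poly_functions m \<Longrightarrow> q \<in> poly_functions m \<Longrightarrow> (\<lambda>A. p A * q A) \<in> poly_functions m"

definition zero_locus :: "nat \<Rightarrow> ('a::comm_ring_1 mat \<Rightarrow> 'a) set \<Rightarrow> 'a mat set" where
  "zero_locus m P = {A \<in> carrier_mat m m. \<forall>p\<in>P. p A = 0}"

definition zariski :: "nat \<Rightarrow> 'a::idom mat topology" where
  "zariski m = topology (\<lambda>U. \<exists>P \<subseteq> poly_functions m. U = carrier_mat m m - zero_locus m P)"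

lemma istopology_zariski:
  "istopology (\<lambda>U :: 'a::idom mat set.
     \<exists>P \<subseteq> poly_functions m. U = carrier_mat m m - zero_locus m P)"
  (is "istopology ?L")
  unfolding istopology_def
proof (intro conjI allI impI)
  fix S T :: "'a mat set" assume "?L S" "?L T"
  then obtain P Q where P: "P \<subseteq> poly_functions m" "S = carrier_mat m m - zero_locus m P"
    and Q: "Q \<subseteq> poly_functions m" "T = carrier_mat m m - zero_locus m Q" by blast
  let ?R = "{\<lambda>A. p A * q A | p q. p \<in> P \<and> q \<in> Q}"
  have "?R \<subseteq> poly_functions m" using P(1) Q(1) by (auto intro: poly_functions.mult)
  moreover have "S \<inter> T = carrier_mat m m - zero_locus m ?R"
  proof -
    have "(\<forall>r\<in>?R. r A = 0) \<longleftrightarrow> (\<forall>p\<in>P. p A = 0) \<or> (\<forall>q\<in>Q. q A = 0)" for A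
    proof
      assume r: "\<forall>r\<in>?R. r A = 0"
      have "p A * q A = 0" if "p \<in> P" "q \<in> Q" for p q
        using bspec[OF r, of "\<lambda>A. p A * q A"] that by blast
      then show "(\<forall>p\<in>P. p A = 0) \<or> (\<forall>q\<in>Q. q A = 0)" by (meson mult_eq_0_iff)
    qed auto
    then have "zero_locus m ?R = zero_locus m P \<union> zero_locus m Q"
      unfolding zero_locus_def by (simp add: set_eq_iff conj_disj_distribL)
    then show ?thesis unfolding P(2) Q(2) by blast
  qed
  ultimately show "?L (S \<inter> T)" by blast
next
  fix K :: "'a mat set set" assume "\<forall>U\<in>K. ?L U"
  then obtain F where F: "\<And>U. U \<in> K \<Longrightarrow> F U \<subseteq> poly_functions m"
    "\<And>U. U \<in> K \<Longrightarrow> U = carrier_mat m m - zero_locus m (F U)" by metis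
  have "\<Union>K = (\<Union>U\<in>K. carrier_mat m m - zero_locus m (F U))" using F(2) by auto
  also have "\<dots> = carrier_mat m m - zero_locus m (\<Union>U\<in>K. F U)"
    by (auto simp: zero_locus_def)
  finally show "?L (\<Union>K)" using F(1) by (intro exI[of _ "\<Union>U\<in>K. F U"]) auto
qed

lemma openin_zariski:
  "openin (zariski m) U \<longleftrightarrow> (\<exists>P \<subseteq> poly_functions m. U = carrier_mat m m - zero_locus m P)"
  unfolding zariski_def topology_inverse'[OF istopology_zariski] ..

lemma topspace_zariski [simp]: "topspace (zariski m) = (carrier_mat m m :: 'a::idom mat set)"
proof
  have "carrier_mat m m = (carrier_mat m m :: 'a mat set) - zero_locus m {\<lambda>_. 1}"
    by (auto simp: zero_locus_def)
  moreover have "{\<lambda>_. 1} \<subseteq> (poly_functions m :: ('a mat \<Rightarrow> 'a) set)"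
    by (auto intro: poly_functions.const)
  ultimately have "openin (zariski m) (carrier_mat m m :: 'a mat set)"
    unfolding openin_zariski by blast
  then show "carrier_mat m m \<subseteq> topspace (zariski m :: 'a mat topology)"
    by (rule openin_subset)
  show "topspace (zariski m) \<subseteq> (carrier_mat m m :: 'a mat set)"
    by (auto simp: topspace_def openin_zariski)
qed

lemma closedin_zariski:
  fixes C :: "'a::idom mat set"
  shows "closedin (zariski m) C \<longleftrightarrow> (\<exists>P \<subseteq> poly_functions m. C = zero_locus m P)"
proof -
  have sub: "zero_locus m P \<subseteq> carrier_mat m m" for P :: "('a mat \<Rightarrow> 'a) set"
    by (auto simp: zero_locus_def)
  have eq: "C \<subseteq> carrier_mat m m \<and> carrier_mat m m - C = carrier_mat m m - zero_locus m P
      \<longleftrightarrow> C = zero_locus m P" for P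
    using sub[of P] by blast
  show ?thesis
    unfolding closedin_def openin_zariski topspace_zariski using eq by blast
qed

section \<open>Borel subgroups and spherical conjugacy classes\<close>

text \<open>
  In this section \<open>G\<close> is a linear algebraic group, given as a group of matrices, and \<open>T\<close> is the
  Zariski topology of the ambient matrix space.
\<close>

definition closed_connected_solvable ::
    "'g topology \<Rightarrow> 'g monoid \<Rightarrow> 'g set \<Rightarrow> bool" where
  "closed_connected_solvable T G B \<longleftrightarrow>
     subgroup B G \<and> closedin (subtopology T (carrier G)) B \<and> connectedin T B \<and>
     solvable (G\<lparr>carrier := B\<rparr>)"

definition borel_subgroup :: "'g topology \<Rightarrow> 'g monoid \<Rightarrow> 'g set \<Rightarrow> bool" where
  "borel_subgroup T G B \<longleftrightarrow>
     closed_connected_solvable T G B \<and>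
     (\<forall>B'. closed_connected_solvable T G B' \<longrightarrow> B \<subseteq> B' \<longrightarrow> B' = B)"

definition conj_action :: "'g monoid \<Rightarrow> 'g \<Rightarrow> 'g \<Rightarrow> 'g" where
  "conj_action G h x = h \<otimes>\<^bsub>G\<^esub> x \<otimes>\<^bsub>G\<^esub> inv\<^bsub>G\<^esub> h"

definition conjugacy_class :: "'g monoid \<Rightarrow> 'g \<Rightarrow> 'g set" where
  "conjugacy_class G g = orbit G (conj_action G) g"

text \<open>
  Borel subgroups are conjugate, so it does not matter whether one or every Borel subgroup is
  required to have a dense orbit.
\<close>

definition spherical :: "'g topology \<Rightarrow> 'g monoid \<Rightarrow> 'g set \<Rightarrow> bool" where
  "spherical T G C \<longleftrightarrow>
     (\<exists>B. borel_subgroup T G B \<and>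
       (\<exists>x\<in>C. (subtopology T C) closure_of (orbit (G\<lparr>carrier := B\<rparr>) (conj_action G) x) = C))"

section \<open>Jordan decomposition and mixed elements\<close>

text \<open>Diagonalizability is semisimplicity only over an algebraically closed field.\<close>

definition semisimple_mat :: "'a::alg_closed_field mat \<Rightarrow> bool" where
  "semisimple_mat s \<longleftrightarrow> (\<exists>D. similar_mat s D \<and> diagonal_mat D)"

definition unipotent_mat :: "'a::comm_ring_1 mat \<Rightarrow> bool" where
  "unipotent_mat u \<longleftrightarrow>
     square_mat u \<and> (\<exists>k. (u - 1\<^sub>m (dim_row u)) ^\<^sub>m k = 0\<^sub>m (dim_row u) (dim_row u))"

definition jordan_decomposition ::
    "'a::alg_closed_field mat monoid \<Rightarrow> 'a mat \<Rightarrow> 'a mat \<Rightarrow> 'a mat \<Rightarrow> bool" where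
  "jordan_decomposition G g s u \<longleftrightarrow>
     s \<in> carrier G \<and> u \<in> carrier G \<and> semisimple_mat s \<and> unipotent_mat u \<and>
     g = s \<otimes>\<^bsub>G\<^esub> u \<and> s \<otimes>\<^bsub>G\<^esub> u = u \<otimes>\<^bsub>G\<^esub> s"

definition group_center :: "'g monoid \<Rightarrow> 'g set" where
  "group_center G = {z \<in> carrier G. \<forall>x\<in>carrier G. z \<otimes>\<^bsub>G\<^esub> x = x \<otimes>\<^bsub>G\<^esub> z}"

definition mixed :: "'a::alg_closed_field mat monoid \<Rightarrow> 'a mat \<Rightarrow> bool" where
  "mixed G g \<longleftrightarrow>
     (\<exists>s u. jordan_decomposition G g s u \<and> s \<notin> group_center G \<and> u \<noteq> \<one>\<^bsub>G\<^esub>)"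

section \<open>The symplectic group\<close>

text \<open>The form given by this matrix is alternating in every characteristic, including 2.\<close>

definition symplectic_form :: "nat \<Rightarrow> 'a::comm_ring_1 mat" where
  "symplectic_form n = four_block_mat (0\<^sub>m n n) (1\<^sub>m n) (- 1\<^sub>m n) (0\<^sub>m n n)"

definition Sp :: "nat \<Rightarrow> 'a::comm_ring_1 mat monoid" where
  "Sp n = \<lparr>
     carrier = {A \<in> carrier_mat (2 * n) (2 * n).
       transpose_mat A * symplectic_form n * A = symplectic_form n},
     mult = (*),
     one = 1\<^sub>m (2 * n)\<rparr>"

lemma symplectic_form_carrier [simp]: "symplectic_form n \<in> carrier_mat (2 * n) (2 * n)"
  unfolding symplectic_form_def by (simp add: mult_2)

lemma symplectic_form_square:
  "symplectic_form n * symplectic_form n = (- 1\<^sub>m (2 * n) :: 'a::comm_ring_1 mat)"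
proof -
  have "four_block_mat (0\<^sub>m n n) (1\<^sub>m n) (- 1\<^sub>m n) (0\<^sub>m n n)
      * four_block_mat (0\<^sub>m n n) (1\<^sub>m n) (- 1\<^sub>m n) (0\<^sub>m n n)
      = four_block_mat (- 1\<^sub>m n) (0\<^sub>m n n) (0\<^sub>m n n) (- 1\<^sub>m n :: 'a mat)"
    by (subst mult_four_block_mat[of _ n n _ n _ n _ _ n _ n]) auto
  also have "\<dots> = - 1\<^sub>m (2 * n)" by (rule eq_matI) auto
  finally show ?thesis unfolding symplectic_form_def .
qed

lemma congruence_mult:
  fixes A B J :: "'a::comm_ring_1 mat"
  assumes A: "A \<in> carrier_mat m m" and B: "B \<in> carrier_mat m m" and J: "J \<in> carrier_mat m m"
  shows "(A * B)\<^sup>T * J * (A * B) = B\<^sup>T * (A\<^sup>T * J * A) * B"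
proof -
  have AT: "A\<^sup>T \<in> carrier_mat m m" and BT: "B\<^sup>T \<in> carrier_mat m m" using A B by auto
  have AJ: "A\<^sup>T * J \<in> carrier_mat m m" using AT J by (rule mult_carrier_mat)
  have "(A * B)\<^sup>T * J * (A * B) = B\<^sup>T * (A\<^sup>T * J) * (A * B)"
    unfolding transpose_mult[OF A B] assoc_mult_mat[OF BT AT J] ..
  also have "\<dots> = B\<^sup>T * (A\<^sup>T * J) * A * B"
    by (rule assoc_mult_mat[symmetric, OF mult_carrier_mat[OF BT AJ] A B])
  also have "B\<^sup>T * (A\<^sup>T * J) * A = B\<^sup>T * (A\<^sup>T * J * A)"
    by (rule assoc_mult_mat[OF BT AJ A])
  finally show ?thesis .
qed

lemma group_Sp: "group (Sp n :: 'a::field mat monoid)"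
proof (rule groupI)
  let ?m = "2 * n" and ?J = "symplectic_form n :: 'a mat"
  note J = symplectic_form_carrier[of n, where 'a = 'a]
  have mult: "A * B \<in> carrier (Sp n)"
    if "A \<in> carrier (Sp n)" "B \<in> carrier (Sp n)" for A B :: "'a mat"
  proof -
    from that have A: "A \<in> carrier_mat ?m ?m" "A\<^sup>T * ?J * A = ?J"
      and B: "B \<in> carrier_mat ?m ?m" "B\<^sup>T * ?J * B = ?J" by (auto simp: Sp_def)
    have "(A * B)\<^sup>T * ?J * (A * B) = B\<^sup>T * (A\<^sup>T * ?J * A) * B"
      by (rule congruence_mult[OF A(1) B(1) J])
    then show ?thesis using A B by (simp add: Sp_def)
  qed
  show "A \<otimes>\<^bsub>Sp n\<^esub> B \<in> carrier (Sp n)"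
    if "A \<in> carrier (Sp n)" "B \<in> carrier (Sp n)" for A B :: "'a mat"
    using mult[OF that] by (simp add: Sp_def)
  show "\<one>\<^bsub>Sp n\<^esub> \<in> carrier (Sp n :: 'a mat monoid)"
    by (simp add: Sp_def left_mult_one_mat[OF J] right_mult_one_mat[OF J])
  show "A \<otimes>\<^bsub>Sp n\<^esub> B \<otimes>\<^bsub>Sp n\<^esub> C = A \<otimes>\<^bsub>Sp n\<^esub> (B \<otimes>\<^bsub>Sp n\<^esub> C)"
    if "A \<in> carrier (Sp n)" "B \<in> carrier (Sp n)" "C \<in> carrier (Sp n)" for A B C :: "'a mat"
    using that by (simp add: Sp_def assoc_mult_mat[of _ ?m ?m _ ?m _ ?m])
  show "\<one>\<^bsub>Sp n\<^esub> \<otimes>\<^bsub>Sp n\<^esub> A = A" if "A \<in> carrier (Sp n)" for A :: "'a mat"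
    using that by (auto simp: Sp_def)
  show "\<exists>B\<in>carrier (Sp n). B \<otimes>\<^bsub>Sp n\<^esub> A = \<one>\<^bsub>Sp n\<^esub>" if "A \<in> carrier (Sp n)" for A :: "'a mat"
  proof -
    from that have A: "A \<in> carrier_mat ?m ?m" "A\<^sup>T * ?J * A = ?J" by (auto simp: Sp_def)
    define B where "B = (- ?J) * (A\<^sup>T * ?J)"
    have AJ: "A\<^sup>T * ?J \<in> carrier_mat ?m ?m"
      by (rule mult_carrier_mat[OF _ J]) (use A(1) in auto)
    have J': "- ?J \<in> carrier_mat ?m ?m" using J by simp
    have B: "B \<in> carrier_mat ?m ?m" unfolding B_def by (rule mult_carrier_mat[OF J' AJ])
    have "B * A = (- ?J) * ?J"
      unfolding B_def assoc_mult_mat[OF J' AJ A(1)] A(2) ..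
    also have "\<dots> = - (?J * ?J)"
      by (rule uminus_mult_left_mat) (simp add: carrier_matD[OF J])
    also have "\<dots> = 1\<^sub>m ?m" unfolding symplectic_form_square by simp
    finally have BA: "B * A = 1\<^sub>m ?m" .
    then have AB: "A * B = 1\<^sub>m ?m" using mat_mult_left_right_inverse[OF B A(1)] by simp
    have "B\<^sup>T * ?J * B = B\<^sup>T * (A\<^sup>T * ?J * A) * B" using A(2) by simp
    also have "\<dots> = (A * B)\<^sup>T * ?J * (A * B)"
      by (rule congruence_mult[OF A(1) B J, symmetric])
    also have "\<dots> = ?J" by (simp add: AB left_mult_one_mat[OF J] right_mult_one_mat[OF J])
    finally have "B \<in> carrier (Sp n)" using B by (simp add: Sp_def)
    then show ?thesis using BA by (auto simp: Sp_def)
  qed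
qed

end

theory Submission
  imports Defs "Jordan_Normal_Form.Char_Poly"
begin

text \<open>
  By Lie--Kolchin a Borel subgroup \<open>B\<close> fixes a line \<open>\<langle>v\<^sub>1\<rangle>\<close> and an isotropic plane \<open>\<langle>v\<^sub>1, v\<^sub>2\<rangle>\<close>.
  With \<open>\<beta>\<^sub>i\<^sub>j(x) = \<omega>(v\<^sub>i, x v\<^sub>j)\<close>, the functions \<open>\<beta>\<^sub>1\<^sub>1\<close> and \<open>\<omega>(v\<^sub>1, x\<^sup>2 v\<^sub>1)\<close> on the class are \<open>B\<close>-semi-invariant
  with the same character, and so are \<open>\<beta>\<^sub>1\<^sub>1 \<beta>\<^sub>2\<^sub>2 - \<beta>\<^sub>1\<^sub>2 \<beta>\<^sub>2\<^sub>1\<close> and \<open>(\<beta>\<^sub>1\<^sub>2 - \<beta>\<^sub>2\<^sub>1)\<^sup>2\<close>; a dense \<open>B\<close>-orbit makes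
  both ratios constant. Since \<open>Sp\<^sub>2\<^sub>n\<close> is transitive on nonzero vectors and on independent isotropic pairs,
  these are identities in \<open>v\<^sub>1, v\<^sub>2\<close> for the fixed element \<open>g\<close>. In characteristic 2, polarising the first
  one forces every Jordan block of size at least 2 of \<open>g\<close> to have eigenvalue 1. If
  \<open>g p = \<lambda> p\<close> with \<open>\<lambda> \<noteq> 1\<close> and \<open>g z = z + y\<close>, \<open>g y = y\<close>, the pairs \<open>(p + z, w)\<close> with varying \<open>\<omega>(y, w)\<close>
  then violate the second one.
\<close>

section \<open>Regular functions and the Zariski topology\<close>

text \<open>The adjoint of g for the form is g^-1. Put h = g + g^-1. In characteristic 2, polarising
  omega(w, g w) and omega(w, g^2 w) gives omega(v, h w) and omega(v, h^2 w), because g^2 + g^-2 =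
  h^2. So a constant first ratio k means h^2 = k h. On an eigenvector of g with eigenvalue l
  different from 1, h acts by l + 1/l, which is nonzero; hence k is nonzero and h is diagonalisable.
  The derivative of x + 1/x vanishes only at 1, so a Jordan block of g of size at least 2 at any
  other eigenvalue would survive in h. At eigenvalue 1 a block of size 2 has h = 0 and escapes this
  test; that is why a second pair of semi-invariants, seeing two vectors at once, is needed.\<close>

definition regular_fun :: "nat \<Rightarrow> ('a::comm_ring_1 mat \<Rightarrow> 'a) \<Rightarrow> bool" where
  "regular_fun m f \<longleftrightarrow> (\<exists>p\<in>poly_functions m. \<forall>A\<in>carrier_mat m m. f A = p A)"

definition regular_map :: "nat \<Rightarrow> nat \<Rightarrow> ('a::comm_ring_1 mat \<Rightarrow> 'a mat) \<Rightarrow> bool" where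
  "regular_map m d F \<longleftrightarrow> (\<forall>A\<in>carrier_mat m m. F A \<in> carrier_mat d d) \<and>
     (\<forall>i<d. \<forall>j<d. regular_fun m (\<lambda>A. F A $$ (i, j)))"

lemma regular_fun_const: "regular_fun m (\<lambda>_. c)"
  unfolding regular_fun_def by (rule bexI[OF _ poly_functions.const[of c]]) simp

lemma regular_fun_coord: "i < m \<Longrightarrow> j < m \<Longrightarrow> regular_fun m (\<lambda>A. A $$ (i, j))"
  unfolding regular_fun_def by (rule bexI[OF _ poly_functions.coord[of i m j]]) auto

lemma regular_fun_add:
  assumes "regular_fun m f" "regular_fun m g"
  shows "regular_fun m (\<lambda>A. f A + g A)"
proof -
  obtain p q where "p \<in> poly_functions m" "q \<in> poly_functions m"
    "\<forall>A\<in>carrier_mat m m. f A = p A" "\<forall>A\<in>carrier_mat m m. g A = q A"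
    using assms unfolding regular_fun_def by auto
  then show ?thesis
    unfolding regular_fun_def by (intro bexI[of _ "\<lambda>A. p A + q A"] poly_functions.add) auto
qed

lemma regular_fun_mult:
  assumes "regular_fun m f" "regular_fun m g"
  shows "regular_fun m (\<lambda>A. f A * g A)"
proof -
  obtain p q where "p \<in> poly_functions m" "q \<in> poly_functions m"
    "\<forall>A\<in>carrier_mat m m. f A = p A" "\<forall>A\<in>carrier_mat m m. g A = q A"
    using assms unfolding regular_fun_def by auto
  then show ?thesis
    unfolding regular_fun_def by (intro bexI[of _ "\<lambda>A. p A * q A"] poly_functions.mult) auto
qed

lemma regular_fun_diff:
  fixes f g :: "'a::comm_ring_1 mat \<Rightarrow> 'a"
  assumes "regular_fun m f" "regular_fun m g"
  shows "regular_fun m (\<lambda>A. f A - g A)"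
  using regular_fun_add[OF assms(1) regular_fun_mult[OF regular_fun_const[of m "-1"] assms(2)]]
  by simp

lemma regular_fun_sum:
  fixes f :: "'i \<Rightarrow> 'a::comm_ring_1 mat \<Rightarrow> 'a"
  assumes "\<And>i. i \<in> S \<Longrightarrow> regular_fun m (f i)"
  shows "regular_fun m (\<lambda>A. \<Sum>i\<in>S. f i A)"
  using assms
  by (induction S rule: infinite_finite_induct) (auto intro: regular_fun_const regular_fun_add)

text \<open>Entries of products and transposes have their polynomial formula only for matrices of
  the right dimensions, so regularity is transferred along equalities valid on the carrier
  alone.\<close>

lemma regular_fun_cong:
  "(\<And>A. A \<in> carrier_mat m m \<Longrightarrow> f A = g A) \<Longrightarrow> regular_fun m g \<Longrightarrow> regular_fun m f"
  unfolding regular_fun_def by (elim bexE, rule bexI) auto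

section \<open>Matrix-valued regular maps\<close>

lemma regular_map_closed: "regular_map m d F \<Longrightarrow> A \<in> carrier_mat m m \<Longrightarrow> F A \<in> carrier_mat d d"
  by (simp add: regular_map_def)

lemma regular_map_entry:
  "regular_map m d F \<Longrightarrow> i < d \<Longrightarrow> j < d \<Longrightarrow> regular_fun m (\<lambda>A. F A $$ (i, j))"
  by (simp add: regular_map_def)

lemma regular_map_id: "regular_map m m (\<lambda>A. A)"
  by (simp add: regular_map_def regular_fun_coord)

lemma regular_map_const: "C \<in> carrier_mat d d \<Longrightarrow> regular_map m d (\<lambda>_. C)"
  by (simp add: regular_map_def regular_fun_const)

lemma regular_map_mult:
  assumes F: "regular_map m d F" and G: "regular_map m d G"
  shows "regular_map m d (\<lambda>A. F A * G A)"
  unfolding regular_map_def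
proof (intro conjI allI impI ballI)
  show "F A * G A \<in> carrier_mat d d" if "A \<in> carrier_mat m m" for A
    using that regular_map_closed[OF F] regular_map_closed[OF G] by (metis mult_carrier_mat)
next
  fix i j assume ij: "i < d" "j < d"
  show "regular_fun m (\<lambda>A. (F A * G A) $$ (i, j))"
  proof (rule regular_fun_cong)
    show "(F A * G A) $$ (i, j) = (\<Sum>k\<in>{0..<d}. F A $$ (i, k) * G A $$ (k, j))"
      if "A \<in> carrier_mat m m" for A
      using regular_map_closed[OF F that] regular_map_closed[OF G that] ij
      by (auto simp: scalar_prod_def intro!: sum.cong)
    show "regular_fun m (\<lambda>A. \<Sum>k\<in>{0..<d}. F A $$ (i, k) * G A $$ (k, j))"
      using ij by (intro regular_fun_sum regular_fun_mult regular_map_entry[OF F] regular_map_entry[OF G]) auto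
  qed
qed

lemma regular_map_transpose:
  assumes F: "regular_map m d F"
  shows "regular_map m d (\<lambda>A. (F A)\<^sup>T)"
  unfolding regular_map_def
proof (intro conjI allI impI ballI)
  show "(F A)\<^sup>T \<in> carrier_mat d d" if "A \<in> carrier_mat m m" for A
    using regular_map_closed[OF F that] by simp
  fix i j assume ij: "i < d" "j < d"
  show "regular_fun m (\<lambda>A. (F A)\<^sup>T $$ (i, j))"
  proof (rule regular_fun_cong[OF _ regular_map_entry[OF F ij(2,1)]])
    show "(F A)\<^sup>T $$ (i, j) = F A $$ (j, i)" if "A \<in> carrier_mat m m" for A
      using regular_map_closed[OF F that] ij by auto
  qed
qed

lemma regular_fun_comp:
  assumes F: "regular_map m d F" and p: "p \<in> poly_functions d"
  shows "regular_fun m (\<lambda>A. p (F A))"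
  using p
proof induction
  case (const c)
  show ?case by (rule regular_fun_const)
next
  case (coord i j)
  then show ?case by (rule regular_map_entry[OF F])
next
  case (add p q)
  then show ?case by (intro regular_fun_add)
next
  case (mult p q)
  then show ?case by (intro regular_fun_mult)
qed

section \<open>Closed sets, continuity and connectedness\<close>

lemma closedin_regular:
  fixes Fs :: "('a::idom mat \<Rightarrow> 'a) set"
  assumes "\<And>f. f \<in> Fs \<Longrightarrow> regular_fun m f"
  shows "closedin (zariski m) {A \<in> carrier_mat m m. \<forall>f\<in>Fs. f A = 0}"
proof -
  have "\<forall>f\<in>Fs. \<exists>p\<in>poly_functions m. \<forall>A\<in>carrier_mat m m. f A = p A"
    using assms unfolding regular_fun_def by blast
  then obtain P where P: "\<And>f. f \<in> Fs \<Longrightarrow> P f \<in> poly_functions m"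
    "\<And>f A. f \<in> Fs \<Longrightarrow> A \<in> carrier_mat m m \<Longrightarrow> f A = P f A" by metis
  have "{A \<in> carrier_mat m m. \<forall>f\<in>Fs. f A = 0} = zero_locus m (P ` Fs)"
    unfolding zero_locus_def using P(2) by auto
  then show ?thesis unfolding closedin_zariski using P(1) by (intro exI[of _ "P ` Fs"]) auto
qed

lemma continuous_map_regular:
  fixes F :: "'a::idom mat \<Rightarrow> 'a mat"
  assumes F: "regular_map m d F"
  shows "continuous_map (zariski m) (zariski d) F"
  unfolding continuous_map_closedin
proof (intro conjI allI impI)
  show "F \<in> topspace (zariski m) \<rightarrow> topspace (zariski d)"
    using regular_map_closed[OF F] by auto
  fix C :: "'a mat set" assume "closedin (zariski d) C"
  then obtain P where P: "P \<subseteq> poly_functions d" "C = zero_locus d P"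
    unfolding closedin_zariski by blast
  have "{A \<in> topspace (zariski m). F A \<in> C} =
      {A \<in> carrier_mat m m. \<forall>f\<in>(\<lambda>p A. p (F A)) ` P. f A = 0}"
    using regular_map_closed[OF F] unfolding P(2) zero_locus_def by auto
  then show "closedin (zariski m) {A \<in> topspace (zariski m). F A \<in> C}"
    using closedin_regular[of "(\<lambda>p A. p (F A)) ` P" m] regular_fun_comp[OF F] P(1) by auto
qed

lemma regular_fun_mult_mat_vec:
  assumes F: "regular_map m d F" and w: "w \<in> carrier_vec d" and i: "i < d"
  shows "regular_fun m (\<lambda>A. (F A *\<^sub>v w) $ i)"
proof (rule regular_fun_cong)
  show "(F A *\<^sub>v w) $ i = (\<Sum>k\<in>{0..<d}. F A $$ (i, k) * w $ k)" if "A \<in> carrier_mat m m" for A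
    using regular_map_closed[OF F that] w i by (auto simp: scalar_prod_def intro!: sum.cong)
  show "regular_fun m (\<lambda>A. \<Sum>k\<in>{0..<d}. F A $$ (i, k) * w $ k)"
    using i by (intro regular_fun_sum regular_fun_mult regular_map_entry[OF F] regular_fun_const) auto
qed

text \<open>The fibre through \<open>x\<close> and the finite union of the other fibres would
  separate \<open>S\<close>. The assumption \<open>closed\<close> speaks of fibres because
  \<open>f\<close> will be an eigenvalue chosen pointwise, with no formula of its own.\<close>

lemma connected_finite_values:
  assumes con: "connectedin T S" and fin: "finite (f ` S)"
    and closed: "\<And>c. \<exists>C. closedin T C \<and> (\<forall>x\<in>S. x \<in> C \<longleftrightarrow> f x = c)"
    and xy: "x \<in> S" "y \<in> S"
  shows "f x = f y"
proof (rule ccontr)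
  assume neq: "f x \<noteq> f y"
  obtain C where C: "\<And>c. closedin T (C c)" "\<And>c x. x \<in> S \<Longrightarrow> x \<in> C c \<longleftrightarrow> f x = c"
    using closed by metis
  let ?E1 = "C (f x)" and ?E2 = "\<Union>c\<in>f ` S - {f x}. C c"
  have "closedin T ?E2" using fin C(1) by (intro closedin_Union) auto
  moreover have "S \<subseteq> ?E1 \<union> ?E2" using C(2) by auto
  moreover have "?E1 \<inter> ?E2 \<inter> S = {}" using C(2) by auto
  moreover have "x \<in> ?E1 \<inter> S" "y \<in> ?E2 \<inter> S" using C(2) xy neq by auto
  ultimately show False
    using con C(1)[of "f x"] unfolding connectedin_closedin by (metis empty_iff)
qed

section \<open>Stable subspaces and eigenvectors\<close>

definition vec_subspace :: "nat \<Rightarrow> 'a::field vec set \<Rightarrow> bool" where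
  "vec_subspace d W \<longleftrightarrow> W \<subseteq> carrier_vec d \<and> 0\<^sub>v d \<in> W \<and>
     (\<forall>v\<in>W. \<forall>w\<in>W. v + w \<in> W) \<and> (\<forall>c. \<forall>v\<in>W. c \<cdot>\<^sub>v v \<in> W)"

definition stable_under :: "'a::field mat set \<Rightarrow> 'a vec set \<Rightarrow> bool" where
  "stable_under S W \<longleftrightarrow> (\<forall>M\<in>S. \<forall>w\<in>W. M *\<^sub>v w \<in> W)"

lemma vec_subspaceD:
  assumes "vec_subspace d W"
  shows "W \<subseteq> carrier_vec d" "0\<^sub>v d \<in> W" "v \<in> W \<Longrightarrow> w \<in> W \<Longrightarrow> v + w \<in> W" "v \<in> W \<Longrightarrow> c \<cdot>\<^sub>v v \<in> W"
  using assms by (auto simp: vec_subspace_def)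

text \<open>The positions of the leading entries, as in an echelon form. Their number is the
  dimension of \<open>W\<close> and serves as the measure in the search for a minimal stable
  subspace.\<close>

definition pivots :: "nat \<Rightarrow> 'a::field vec set \<Rightarrow> nat set" where
  "pivots d W = {i. i < d \<and> (\<exists>w\<in>W. w $ i \<noteq> 0 \<and> (\<forall>j<i. w $ j = 0))}"

lemma card_pivots_strict_mono:
  assumes U: "vec_subspace d U" and W: "vec_subspace d W" and UW: "U \<subset> W"
  shows "card (pivots d U) < card (pivots d W)"
proof (rule psubset_card_mono)
  show "finite (pivots d W)" unfolding pivots_def by simp
  have sub: "pivots d U \<subseteq> pivots d W" using UW unfolding pivots_def by auto
  have "pivots d U \<noteq> pivots d W"
  proof
    assume eq: "pivots d U = pivots d W"
    \<comment> \<open>Gaussian elimination: \<open>k\<close> counts the last positions where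
      \<open>w\<close> may be nonzero, and a vector of \<open>U\<close> with the same pivot clears
      the first of them.\<close>
    have "k \<le> d \<Longrightarrow> w \<in> W \<Longrightarrow> (\<And>j. j < d - k \<Longrightarrow> w $ j = 0) \<Longrightarrow> w \<in> U" for k w
    proof (induction k arbitrary: w)
      case 0
      then have "w = 0\<^sub>v d" using vec_subspaceD(1)[OF W] by (intro eq_vecI) auto
      then show ?case using vec_subspaceD(2)[OF U] by simp
    next
      case (Suc k)
      define i where "i = d - Suc k"
      have i: "i < d" "d - k = Suc i" using Suc.prems(1) by (auto simp: i_def)
      show ?case
      proof (cases "w $ i = 0")
        case True
        then show ?thesis using Suc i by (intro Suc.IH) (auto simp: less_Suc_eq i_def)
      next
        case False
        then have "i \<in> pivots d U"
          unfolding eq unfolding pivots_def using Suc.prems i by (auto simp: i_def)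
        then obtain u where u: "u \<in> U" "u $ i \<noteq> 0" "\<And>j. j < i \<Longrightarrow> u $ j = 0"
          unfolding pivots_def by auto
        have car: "u \<in> carrier_vec d" "w \<in> carrier_vec d"
          using u Suc.prems vec_subspaceD(1)[OF W] UW by auto
        let ?c = "w $ i / u $ i"
        have "w + (- ?c) \<cdot>\<^sub>v u \<in> U"
        proof (rule Suc.IH)
          show "w + (- ?c) \<cdot>\<^sub>v u \<in> W"
            using u(1) UW Suc.prems(2) by (auto intro!: vec_subspaceD[OF W])
          show "(w + (- ?c) \<cdot>\<^sub>v u) $ j = 0" if "j < d - k" for j
            using that i u car Suc.prems(3) by (auto simp: less_Suc_eq i_def)
        qed (use Suc.prems in simp)
        then have "(w + (- ?c) \<cdot>\<^sub>v u) + ?c \<cdot>\<^sub>v u \<in> U"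
          using u(1) by (auto intro!: vec_subspaceD[OF U])
        also have "(w + (- ?c) \<cdot>\<^sub>v u) + ?c \<cdot>\<^sub>v u = w" using car by (intro eq_vecI) auto
        finally show ?thesis .
      qed
    qed
    from this[of d] have "W \<subseteq> U" by auto
    then show False using UW by auto
  qed
  then show "pivots d U \<subset> pivots d W" using sub by auto
qed

lemma minimal_stable_subspace:
  assumes "vec_subspace d W" "W \<noteq> {0\<^sub>v d}" "stable_under S W"
  obtains U where "U \<subseteq> W" "vec_subspace d U" "U \<noteq> {0\<^sub>v d}" "stable_under S U"
    "\<And>U'. U' \<subseteq> U \<Longrightarrow> vec_subspace d U' \<Longrightarrow> U' \<noteq> {0\<^sub>v d} \<Longrightarrow> stable_under S U' \<Longrightarrow> U' = U"
proof -
  let ?P = "\<lambda>U. U \<subseteq> W \<and> vec_subspace d U \<and> U \<noteq> {0\<^sub>v d} \<and> stable_under S U"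
  have "?P W" using assms by simp
  then obtain U where U: "?P U" "\<forall>U'. ?P U' \<longrightarrow> card (pivots d U) \<le> card (pivots d U')"
    using ex_has_least_nat[of ?P W "\<lambda>U. card (pivots d U)"] by auto
  show ?thesis
  proof (rule that)
    fix U' assume U': "U' \<subseteq> U" "vec_subspace d U'" "U' \<noteq> {0\<^sub>v d}" "stable_under S U'"
    then have "card (pivots d U) \<le> card (pivots d U')" using U by blast
    then show "U' = U" using card_pivots_strict_mono[of d U' U] U' U(1) by fastforce
  qed (use U(1) in auto)
qed

text \<open>The vector p(A) w, evaluated by Horner's scheme.\<close>

definition poly_act :: "'a::field mat \<Rightarrow> 'a poly \<Rightarrow> 'a vec \<Rightarrow> 'a vec" where
  "poly_act A p w = fold_coeffs (\<lambda>c v. c \<cdot>\<^sub>v w + A *\<^sub>v v) p (0\<^sub>v (dim_vec w))"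

context
  fixes A :: "'a::field mat" and w :: "'a vec" and d :: nat
  assumes A: "A \<in> carrier_mat d d" and w: "w \<in> carrier_vec d"
begin

lemma poly_act_0: "poly_act A 0 w = 0\<^sub>v d"
  using w by (simp add: poly_act_def)

lemma poly_act_pCons: "poly_act A (pCons c p) w = c \<cdot>\<^sub>v w + A *\<^sub>v poly_act A p w"
\<comment> \<open>\<open>pCons 0 0\<close> is the zero polynomial, so \<open>fold_coeffs\<close>
  does not unfold in that case.\<close>
proof (cases "c = 0 \<and> p = 0")
  case True
  have "0 \<cdot>\<^sub>v w + A *\<^sub>v 0\<^sub>v d = 0\<^sub>v d" using A w by (intro eq_vecI) auto
  then show ?thesis using True by (simp add: poly_act_0)
next
  case False
  then show ?thesis
    by (cases "p = 0") (simp_all add: poly_act_def)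
qed

lemma poly_act_in:
  assumes W: "vec_subspace d W" "stable_under {A} W" "w \<in> W"
  shows "poly_act A p w \<in> W"
  by (induction p) (use W in \<open>auto simp: poly_act_0 poly_act_pCons stable_under_def intro!: vec_subspaceD[OF W(1)]\<close>)

lemma poly_act_carrier: "poly_act A p w \<in> carrier_vec d"
  by (rule poly_act_in) (use A w in \<open>auto simp: vec_subspace_def stable_under_def\<close>)

lemma poly_act_add: "poly_act A (p + q) w = poly_act A p w + poly_act A q w"
proof (induction p q rule: poly_induct2)
  case 0
  then show ?case by (simp add: poly_act_0)
next
  case (pCons a p b q)
  have car: "A *\<^sub>v poly_act A p w \<in> carrier_vec d" "A *\<^sub>v poly_act A q w \<in> carrier_vec d"
    by (rule mult_mat_vec_carrier[OF A poly_act_carrier])+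
  have "A *\<^sub>v (poly_act A p w + poly_act A q w) = A *\<^sub>v poly_act A p w + A *\<^sub>v poly_act A q w"
    by (rule mult_add_distrib_mat_vec[OF A poly_act_carrier poly_act_carrier])
  moreover have "(a + b) \<cdot>\<^sub>v w + (x + y) = (a \<cdot>\<^sub>v w + x) + (b \<cdot>\<^sub>v w + y)"
    if "x \<in> carrier_vec d" "y \<in> carrier_vec d" for x y
    using that w by (intro eq_vecI) (auto simp: algebra_simps)
  ultimately show ?case using car by (simp add: poly_act_pCons pCons)
qed

lemma poly_act_smult: "poly_act A (smult c p) w = c \<cdot>\<^sub>v poly_act A p w"
proof (induction p)
  case 0
  then show ?case by (auto simp: poly_act_0)
next
  case (pCons a p)
  have "A *\<^sub>v poly_act A p w \<in> carrier_vec d"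
    by (rule mult_mat_vec_carrier[OF A poly_act_carrier])
  then have "(c * a) \<cdot>\<^sub>v w + c \<cdot>\<^sub>v (A *\<^sub>v poly_act A p w) = c \<cdot>\<^sub>v (a \<cdot>\<^sub>v w + A *\<^sub>v poly_act A p w)"
    using w by (simp add: smult_add_distrib_vec[of _ d] smult_smult_assoc)
  then show ?case
    using pCons mult_mat_vec[OF A poly_act_carrier] by (simp add: poly_act_pCons)
qed

lemma poly_act_linear_factor:
  "poly_act A ([:- a, 1:] * q) w = A *\<^sub>v poly_act A q w + (- a) \<cdot>\<^sub>v poly_act A q w"
proof -
  have eq: "[:- a, 1:] * q = pCons 0 q + smult (- a) q" by simp
  have "0 \<cdot>\<^sub>v w + A *\<^sub>v poly_act A q w = A *\<^sub>v poly_act A q w" using A w by (intro eq_vecI) auto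
  then show ?thesis unfolding eq poly_act_add poly_act_smult poly_act_pCons by simp
qed

lemma poly_act_monom: "poly_act A (monom c j) w = c \<cdot>\<^sub>v (((*\<^sub>v) A ^^ j) w)"
proof (induction j)
  case 0
  then show ?case using A w by (simp add: monom_0 poly_act_pCons poly_act_0) (intro eq_vecI, auto)
next
  case (Suc j)
  have car: "((*\<^sub>v) A ^^ j) w \<in> carrier_vec d" by (induction j) (use A w in auto)
  have "0 \<cdot>\<^sub>v w + c \<cdot>\<^sub>v (A *\<^sub>v (((*\<^sub>v) A ^^ j) w)) = c \<cdot>\<^sub>v (A *\<^sub>v (((*\<^sub>v) A ^^ j) w))"
    using A w by (intro eq_vecI) auto
  then show ?case using Suc mult_mat_vec[OF A car] by (simp add: monom_Suc poly_act_pCons)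
qed

lemma poly_act_sum_monom:
  "i < d \<Longrightarrow> poly_act A (\<Sum>j<N. monom (c j) j) w $ i = (\<Sum>j<N. c j * (((*\<^sub>v) A ^^ j) w) $ i)"
proof (induction N)
  case 0
  then show ?case by (simp add: poly_act_0)
next
  case (Suc N)
  have car: "((*\<^sub>v) A ^^ j) w \<in> carrier_vec d" for j by (induction j) (use A w in auto)
  show ?case using Suc car[of N] poly_act_carrier by (simp add: poly_act_add poly_act_monom)
qed

text \<open>In dimension \<open>d\<close> the \<open>d + 1\<close> vectors w, A w, ..., A^d w are
  dependent. They form the columns of \<open>M\<close>, where a zero last row makes the matrix
  square and singular; a kernel vector of \<open>M\<close> supplies the coefficients.\<close>

lemma annihilating_poly: "\<exists>p. p \<noteq> 0 \<and> poly_act A p w = 0\<^sub>v d"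
proof -
  define M where "M = mat (Suc d) (Suc d) (\<lambda>(i, j). if i < d then (((*\<^sub>v) A ^^ j) w) $ i else 0)"
  have M: "M \<in> carrier_mat (Suc d) (Suc d)" by (simp add: M_def)
  have "M\<^sup>T *\<^sub>v unit_vec (Suc d) d = 0\<^sub>v (Suc d)"
    by (intro eq_vecI) (auto simp: M_def)
  moreover have "unit_vec (Suc d) d \<noteq> (0\<^sub>v (Suc d) :: 'a vec)" by simp
  ultimately have "det M\<^sup>T = 0"
    using det_0_iff_vec_prod_zero[of "M\<^sup>T" "Suc d"] M unit_vec_carrier[of "Suc d" d] by fastforce
  then have "det M = 0" using det_transpose[OF M] by simp
  then obtain v where v: "v \<in> carrier_vec (Suc d)" "v \<noteq> 0\<^sub>v (Suc d)" "M *\<^sub>v v = 0\<^sub>v (Suc d)"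
    using det_0_iff_vec_prod_zero[OF M] by auto
  define p where "p = (\<Sum>j<Suc d. monom (v $ j) j)"
  have "coeff p j = v $ j" if "j < Suc d" for j
    using that unfolding p_def by (simp add: coeff_sum coeff_monom sum.delta del: sum.lessThan_Suc)
  moreover have "\<exists>j<Suc d. v $ j \<noteq> 0"
  proof (rule ccontr)
    assume "\<not> (\<exists>j<Suc d. v $ j \<noteq> 0)"
    then have "v = 0\<^sub>v (Suc d)" using v(1) by (intro eq_vecI) auto
    then show False using v(2) by simp
  qed
  ultimately have "p \<noteq> 0" by auto
  moreover have "poly_act A p w = 0\<^sub>v d"
  proof (rule eq_vecI)
    show "dim_vec (poly_act A p w) = dim_vec (0\<^sub>v d)" using poly_act_carrier by simp
    fix i assume "i < dim_vec (0\<^sub>v d :: 'a vec)"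
    then have i: "i < d" by simp
    have "0 = (M *\<^sub>v v) $ i" using v(3) i by simp
    also have "\<dots> = (\<Sum>j<Suc d. M $$ (i, j) * v $ j)"
      using i M v(1) by (simp add: scalar_prod_def lessThan_atLeast0 del: sum.lessThan_Suc)
    also have "\<dots> = (\<Sum>j<Suc d. v $ j * (((*\<^sub>v) A ^^ j) w) $ i)"
      using i by (intro sum.cong) (auto simp: M_def)
    also have "\<dots> = poly_act A p w $ i"
      using poly_act_sum_monom[OF i, of "\<lambda>j. v $ j" "Suc d"] unfolding p_def by simp
    finally show "poly_act A p w $ i = 0\<^sub>v d $ i" using i by simp
  qed
  ultimately show ?thesis by blast
qed

end

text \<open>Take a polynomial killing a nonzero \<open>w\<close> of \<open>W\<close> and split off a
  root \<open>a\<close>, leaving \<open>q\<close>. Either q(A) w is an eigenvector for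
  \<open>a\<close>, inside \<open>W\<close> by stability, or \<open>q\<close> kills \<open>w\<close>
  too and has smaller degree.\<close>

lemma eigenvector_in_stable_subspace:
  fixes A :: "'a::alg_closed_field mat"
  assumes A: "A \<in> carrier_mat d d" and W: "vec_subspace d W" "W \<noteq> {0\<^sub>v d}" "stable_under {A} W"
  obtains u a where "u \<in> W" "u \<noteq> 0\<^sub>v d" "A *\<^sub>v u = a \<cdot>\<^sub>v u"
proof -
  obtain w where w: "w \<in> W" "w \<noteq> 0\<^sub>v d" using W vec_subspaceD(2)[OF W(1)] by auto
  have wc: "w \<in> carrier_vec d" using w vec_subspaceD(1)[OF W(1)] by auto
  note car = poly_act_carrier[OF A wc]
  have "p \<noteq> 0 \<Longrightarrow> poly_act A p w = 0\<^sub>v d \<Longrightarrow> \<exists>u\<in>W. u \<noteq> 0\<^sub>v d \<and> (\<exists>a. A *\<^sub>v u = a \<cdot>\<^sub>v u)" for p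
  proof (induction "degree p" arbitrary: p rule: less_induct)
    case less
    have "degree p \<noteq> 0"
    proof
      assume "degree p = 0"
      then obtain c where c: "p = [:c:]" using degree_eq_zeroE by blast
      have "c \<cdot>\<^sub>v w + A *\<^sub>v 0\<^sub>v d = 0\<^sub>v d"
        using less.prems(2) unfolding c poly_act_pCons[OF A wc] poly_act_0[OF A wc] .
      then have "\<forall>i<d. (c \<cdot>\<^sub>v w + A *\<^sub>v 0\<^sub>v d) $ i = 0" by simp
      then have "\<forall>i<d. c * w $ i = 0" using A wc by simp
      moreover have "c \<noteq> 0" using less.prems(1) c by simp
      ultimately have "w = 0\<^sub>v d" using wc by (intro eq_vecI) auto
      then show False using w by simp
    qed
    then obtain a where "poly p a = 0" using alg_closed_imp_poly_has_root[of p] by auto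
    then obtain q where q: "p = [:- a, 1:] * q" unfolding poly_eq_0_iff_dvd by (elim dvdE)
    let ?u = "poly_act A q w"
    have q0: "q \<noteq> 0" using less.prems(1) q by auto
    have "A *\<^sub>v ?u + (- a) \<cdot>\<^sub>v ?u = 0\<^sub>v d"
      using less.prems(2) unfolding q poly_act_linear_factor[OF A wc] .
    then have e: "\<forall>i<d. (A *\<^sub>v ?u + (- a) \<cdot>\<^sub>v ?u) $ i = 0" by simp
    have Au: "A *\<^sub>v ?u \<in> carrier_vec d" by (rule mult_mat_vec_carrier[OF A car])
    have "A *\<^sub>v ?u = a \<cdot>\<^sub>v ?u"
      by (rule eq_vecI) (use e Au A car[of q] in \<open>auto simp del: index_mult_mat_vec\<close>)
    moreover have "?u \<in> W" by (rule poly_act_in[OF A wc W(1,3) w(1)])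
    moreover have "\<exists>u\<in>W. u \<noteq> 0\<^sub>v d \<and> (\<exists>a. A *\<^sub>v u = a \<cdot>\<^sub>v u)" if "?u = 0\<^sub>v d"
    proof (rule less.hyps[OF _ q0 that])
      have "degree p = degree [:- a, 1:] + degree q"
        unfolding q by (rule degree_mult_eq) (use q0 in auto)
      then show "degree q < degree p" by simp
    qed
    ultimately show ?case by blast
  qed
  then show ?thesis using annihilating_poly[OF A wc] that by blast
qed

section \<open>The Lie-Kolchin theorem\<close>

lemma mult_mat_zero_vec: "M \<in> carrier_mat d d \<Longrightarrow> M *\<^sub>v 0\<^sub>v d = 0\<^sub>v d"
  by (intro eq_vecI) auto

lemma smult_vec_right_cancel:
  fixes v :: "'a::field vec"
  assumes v: "v \<in> carrier_vec d" "v \<noteq> 0\<^sub>v d" and eq: "a \<cdot>\<^sub>v v = b \<cdot>\<^sub>v v"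
  shows "a = b"
proof -
  obtain i where i: "i < d" "v $ i \<noteq> 0"
    using v by (metis eq_vecI carrier_vecD index_zero_vec)
  have "(a \<cdot>\<^sub>v v) $ i = (b \<cdot>\<^sub>v v) $ i" using eq by simp
  then show ?thesis using v i by simp
qed

text \<open>The index set covers two uses in \<open>lie_kolchin\<close>: the weight space of the
  derived subgroup and, with \<open>{()}\<close>, the eigenspace of a single matrix.\<close>

lemma vec_subspace_eigenspaces:
  assumes U: "vec_subspace d U" and M: "\<And>i. i \<in> I \<Longrightarrow> M i \<in> carrier_mat d d"
  shows "vec_subspace d {u \<in> U. \<forall>i\<in>I. M i *\<^sub>v u = c i \<cdot>\<^sub>v u}"
  unfolding vec_subspace_def
proof (intro conjI ballI allI)
  note UD = vec_subspaceD[OF U]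
  show "{u \<in> U. \<forall>i\<in>I. M i *\<^sub>v u = c i \<cdot>\<^sub>v u} \<subseteq> carrier_vec d" using UD(1) by auto
  have "M i *\<^sub>v 0\<^sub>v d = c i \<cdot>\<^sub>v 0\<^sub>v d" if "i \<in> I" for i
    using mult_mat_zero_vec[OF M[OF that]] by auto
  then show "0\<^sub>v d \<in> {u \<in> U. \<forall>i\<in>I. M i *\<^sub>v u = c i \<cdot>\<^sub>v u}" using UD(2) by auto
next
  note UD = vec_subspaceD[OF U]
  fix v w assume "v \<in> {u \<in> U. \<forall>i\<in>I. M i *\<^sub>v u = c i \<cdot>\<^sub>v u}" "w \<in> {u \<in> U. \<forall>i\<in>I. M i *\<^sub>v u = c i \<cdot>\<^sub>v u}"
  then have vw: "v \<in> U" "w \<in> U" "v \<in> carrier_vec d" "w \<in> carrier_vec d"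
    "\<And>i. i \<in> I \<Longrightarrow> M i *\<^sub>v v = c i \<cdot>\<^sub>v v" "\<And>i. i \<in> I \<Longrightarrow> M i *\<^sub>v w = c i \<cdot>\<^sub>v w" using UD(1) by auto
  then have "M i *\<^sub>v (v + w) = c i \<cdot>\<^sub>v (v + w)" if "i \<in> I" for i
    using mult_add_distrib_mat_vec[OF M[OF that]] that smult_add_distrib_vec[OF vw(3,4)] by simp
  then show "v + w \<in> {u \<in> U. \<forall>i\<in>I. M i *\<^sub>v u = c i \<cdot>\<^sub>v u}" using UD(3) vw by auto
next
  note UD = vec_subspaceD[OF U]
  fix a v assume "v \<in> {u \<in> U. \<forall>i\<in>I. M i *\<^sub>v u = c i \<cdot>\<^sub>v u}"
  then have v: "v \<in> U" "v \<in> carrier_vec d" "\<And>i. i \<in> I \<Longrightarrow> M i *\<^sub>v v = c i \<cdot>\<^sub>v v" using UD(1) by auto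
  then have "M i *\<^sub>v (a \<cdot>\<^sub>v v) = c i \<cdot>\<^sub>v (a \<cdot>\<^sub>v v)" if "i \<in> I" for i
    using mult_mat_vec[OF M[OF that] v(2)] that by (simp add: smult_smult_assoc mult.commute)
  then show "a \<cdot>\<^sub>v v \<in> {u \<in> U. \<forall>i\<in>I. M i *\<^sub>v u = c i \<cdot>\<^sub>v u}" using UD(4) v by auto
qed

text \<open>The assumption \<open>inv_regular\<close> asks for a polynomial formula for inversion on
  \<open>G\<close>, so that commutator maps are Zariski continuous.\<close>

locale matrix_group = group G for G :: "'a::alg_closed_field mat monoid" (structure) +
  fixes m :: nat
  assumes carrier_subset: "carrier G \<subseteq> carrier_mat m m"
    and mult_eq: "x \<otimes> y = x * y"
    and one_eq: "\<one> = 1\<^sub>m m"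
    and inv_regular: "\<exists>I. regular_map m m I \<and> (\<forall>x\<in>carrier G. inv x = I x)"

context matrix_group
begin

lemma connectedin_image_regular:
  assumes "connectedin (zariski m) S" "regular_map m m F" "\<And>x. x \<in> S \<Longrightarrow> f x = F x"
  shows "connectedin (zariski m) (f ` S)"
proof -
  have "f ` S = F ` S" using assms(3) by auto
  then show ?thesis
    using connectedin_continuous_map_image[OF continuous_map_regular[OF assms(2)] assms(1)] by simp
qed

lemma connectedin_translate:
  assumes "g \<in> carrier G" "connectedin (zariski m) S"
  shows "connectedin (zariski m) ((\<lambda>x. g \<otimes> x) ` S)"
proof (rule connectedin_image_regular[OF assms(2)])
  show "regular_map m m (\<lambda>x. g * x)"
    using assms carrier_subset by (auto intro!: regular_map_mult regular_map_const regular_map_id)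
qed (simp add: mult_eq)

text \<open>Every element of the derived group is joined to \<open>\<one>\<close> by translates of the connected sets
  \<open>{[x, h] | x \<in> H}\<close>, all of which contain \<open>\<one>\<close>.\<close>

lemma connectedin_derived:
  assumes H: "subgroup H G" and con: "connectedin (zariski m) H"
  shows "connectedin (zariski m) (derived G H)"
proof -
  let ?N = "derived G H"
  have HG: "H \<subseteq> carrier G" by (rule subgroup.subset[OF H])
  have N: "subgroup ?N G" by (rule derived_is_subgroup[OF HG])
  have inN: "a \<otimes> b \<otimes> inv a \<otimes> inv b \<in> ?N" if "a \<in> H" "b \<in> H" for a b
    unfolding derived_def using that by (auto intro!: generate.incl)
  have comm: "\<exists>S. connectedin (zariski m) S \<and> S \<subseteq> ?N \<and> \<one> \<in> S \<and> a \<otimes> b \<otimes> inv a \<otimes> inv b \<in> S"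
    if ab: "a \<in> H" "b \<in> H" for a b
  proof -
    let ?f = "\<lambda>x. x \<otimes> b \<otimes> inv x \<otimes> inv b"
    obtain I where I: "regular_map m m I" "\<forall>x\<in>carrier G. inv x = I x" using inv_regular by blast
    have b: "b \<in> carrier_mat m m" "inv b \<in> carrier_mat m m" using ab HG carrier_subset by auto
    have "connectedin (zariski m) (?f ` H)"
    proof (rule connectedin_image_regular[OF con])
      show "regular_map m m (\<lambda>x. x * b * I x * inv b)"
        by (intro regular_map_mult regular_map_const regular_map_id I(1) b)
      show "?f x = x * b * I x * inv b" if "x \<in> H" for x using that I(2) HG by (auto simp: mult_eq)
    qed
    moreover have "?f \<one> = \<one>" using ab HG by auto
    then have "\<one> \<in> ?f ` H" using subgroup.one_closed[OF H] by force
    moreover have "?f ` H \<subseteq> ?N" using inN ab by auto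
    ultimately show ?thesis using ab(1) by blast
  qed
  have "\<exists>S. connectedin (zariski m) S \<and> S \<subseteq> ?N \<and> \<one> \<in> S \<and> x \<in> S" if "x \<in> ?N" for x
    using that unfolding derived_def
  proof (induction rule: generate.induct)
    case one
    have "connectedin (zariski m) {\<one>}" using carrier_subset one_closed by (simp add: subset_iff)
    then show ?case using subgroup.one_closed[OF N] unfolding derived_def by blast
  next
    case (incl h)
    then show ?case using comm unfolding derived_def by fastforce
  next
    case (inv h)
    then obtain a b where ab: "a \<in> H" "b \<in> H" "h = a \<otimes> b \<otimes> inv a \<otimes> inv b" by auto
    have "inv h = b \<otimes> a \<otimes> inv b \<otimes> inv a"
      using ab HG by (auto simp: inv_mult_group m_assoc subset_iff)
    then show ?case using comm[OF ab(2,1)] unfolding derived_def by simp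
  next
    case (eng h1 h2)
    then obtain S1 S2 where S: "connectedin (zariski m) S1" "S1 \<subseteq> ?N" "\<one> \<in> S1" "h1 \<in> S1"
      "connectedin (zariski m) S2" "S2 \<subseteq> ?N" "\<one> \<in> S2" "h2 \<in> S2"
      unfolding derived_def by auto
    have h1: "h1 \<in> carrier G" using S(2,4) subgroup.subset[OF N] by auto
    let ?S = "S1 \<union> (\<lambda>x. h1 \<otimes> x) ` S2"
    have "h1 \<in> (\<lambda>x. h1 \<otimes> x) ` S2" using S(7) h1 by force
    then have "connectedin (zariski m) ?S"
      using S(1,4) connectedin_translate[OF h1 S(5)] by (intro connectedin_Un) auto
    moreover have "?S \<subseteq> ?N" using S subgroup.m_closed[OF N] by auto
    ultimately show ?case using S(3,8) unfolding derived_def by blast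
  qed
  then obtain S where S: "\<And>x. x \<in> ?N \<Longrightarrow> connectedin (zariski m) (S x) \<and> S x \<subseteq> ?N \<and> \<one> \<in> S x \<and> x \<in> S x"
    by metis
  have eq: "?N = \<Union>(S ` ?N)" using S by blast
  have "connectedin (zariski m) (\<Union>(S ` ?N))"
    by (rule connectedin_Union) (use S subgroup.one_closed[OF N] in auto)
  then show ?thesis using eq by simp
qed

text \<open>Multiplicativity is confined to \<open>H\<close> because the quotient action needed for
  the flag is multiplicative only on matrices that fix the line.\<close>

definition rep_on :: "'a mat set \<Rightarrow> nat \<Rightarrow> ('a mat \<Rightarrow> 'a mat) \<Rightarrow> bool" where
  "rep_on H d \<rho> \<longleftrightarrow> regular_map m d \<rho> \<and> (\<forall>x\<in>H. \<forall>y\<in>H. \<rho> (x \<otimes> y) = \<rho> x * \<rho> y) \<and> \<rho> \<one> = 1\<^sub>m d"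

lemma rep_on_mono: "rep_on H d \<rho> \<Longrightarrow> K \<subseteq> H \<Longrightarrow> rep_on K d \<rho>"
  unfolding rep_on_def by blast

section \<open>Eigenvectors along the orbit of a connected group\<close>

context
  fixes H d \<rho>
  assumes H: "subgroup H G" and rep: "rep_on H d \<rho>"
begin

lemma rep_carrier: "x \<in> H \<Longrightarrow> \<rho> x \<in> carrier_mat d d"
  using rep subgroup.subset[OF H] carrier_subset unfolding rep_on_def
  by (meson regular_map_closed subsetD)

lemma rep_vec_carrier: "x \<in> H \<Longrightarrow> w \<in> carrier_vec d \<Longrightarrow> \<rho> x *\<^sub>v w \<in> carrier_vec d"
  using rep_carrier by (metis mult_mat_vec_carrier)

lemma rep_mult_vec:
  "x \<in> H \<Longrightarrow> y \<in> H \<Longrightarrow> w \<in> carrier_vec d \<Longrightarrow> \<rho> (x \<otimes> y) *\<^sub>v w = \<rho> x *\<^sub>v (\<rho> y *\<^sub>v w)"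
  using rep rep_carrier unfolding rep_on_def by (metis assoc_mult_mat_vec)

lemma rep_one_vec: "w \<in> carrier_vec d \<Longrightarrow> \<rho> \<one> *\<^sub>v w = w"
  using rep unfolding rep_on_def by simp

lemma rep_nonzero:
  assumes x: "x \<in> H" and w: "w \<in> carrier_vec d" "w \<noteq> 0\<^sub>v d"
  shows "\<rho> x *\<^sub>v w \<noteq> 0\<^sub>v d"
proof
  assume 0: "\<rho> x *\<^sub>v w = 0\<^sub>v d"
  have ix: "inv x \<in> H" using x subgroup.m_inv_closed[OF H] by simp
  have "inv x \<otimes> x = \<one>" using x subgroup.subset[OF H] by auto
  then have "w = \<rho> (inv x \<otimes> x) *\<^sub>v w" using w rep_one_vec by simp
  also have "\<dots> = \<rho> (inv x) *\<^sub>v 0\<^sub>v d" using rep_mult_vec[OF ix x w(1)] 0 by simp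
  also have "\<dots> = 0\<^sub>v d" using mult_mat_zero_vec[OF rep_carrier[OF ix]] .
  finally show False using w by simp
qed

text \<open>The eigenvalue at \<open>\<rho> x *\<^sub>v w\<close> is a root of the characteristic
  polynomial of \<open>M\<close>, so it takes finitely many values; its fibres are closed in
  \<open>H\<close>, and connectedness makes it constant.\<close>

lemma eigenvalue_constant:
  assumes con: "connectedin (zariski m) H"
    and M: "M \<in> carrier_mat d d" and w: "w \<in> carrier_vec d" "w \<noteq> 0\<^sub>v d"
    and eig: "\<And>x. x \<in> H \<Longrightarrow> \<exists>c. M *\<^sub>v (\<rho> x *\<^sub>v w) = c \<cdot>\<^sub>v (\<rho> x *\<^sub>v w)"
    and one: "M *\<^sub>v w = a \<cdot>\<^sub>v w" and x: "x \<in> H"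
  shows "M *\<^sub>v (\<rho> x *\<^sub>v w) = a \<cdot>\<^sub>v (\<rho> x *\<^sub>v w)"
proof -
  obtain f where f: "\<And>x. x \<in> H \<Longrightarrow> M *\<^sub>v (\<rho> x *\<^sub>v w) = f x \<cdot>\<^sub>v (\<rho> x *\<^sub>v w)" using eig by metis
  have uniq: "f x = c" if "x \<in> H" "M *\<^sub>v (\<rho> x *\<^sub>v w) = c \<cdot>\<^sub>v (\<rho> x *\<^sub>v w)" for x c
  proof -
    let ?v = "\<rho> x *\<^sub>v w"
    have v: "?v \<in> carrier_vec d" "?v \<noteq> 0\<^sub>v d" using rep_vec_carrier rep_nonzero that w by auto
    have "f x \<cdot>\<^sub>v ?v = c \<cdot>\<^sub>v ?v" using f[OF that(1)] that(2) by simp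
    then show ?thesis by (rule smult_vec_right_cancel[OF v])
  qed
  have one': "\<rho> \<one> *\<^sub>v w = w" by (rule rep_one_vec[OF w(1)])
  have "f x = f \<one>"
  proof (rule connected_finite_values[OF con])
    have "f ` H \<subseteq> {c. poly (char_poly M) c = 0}"
    proof clarify
      fix x assume x: "x \<in> H"
      then have "eigenvector M (\<rho> x *\<^sub>v w) (f x)"
        unfolding eigenvector_def using M f[OF x] rep_vec_carrier[OF x w(1)] rep_nonzero[OF x w] by auto
      then show "poly (char_poly M) (f x) = 0"
        using eigenvalue_root_char_poly[OF M] unfolding eigenvalue_def by auto
    qed
    moreover have "char_poly M \<noteq> 0" using degree_monic_char_poly[OF M] by auto
    ultimately show "finite (f ` H)" using poly_roots_finite finite_subset by blast
  next
    fix c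
    \<comment> \<open>For a fixed \<open>c\<close> the fibre is cut out by one polynomial equation
      per coordinate.\<close>
    let ?F = "\<lambda>A i. ((M * \<rho> A) *\<^sub>v w) $ i - c * (\<rho> A *\<^sub>v w) $ i"
    let ?C = "{A \<in> carrier_mat m m. \<forall>g\<in>(\<lambda>i A. ?F A i) ` {..<d}. g A = 0}"
    have reg: "regular_map m d \<rho>" using rep unfolding rep_on_def by simp
    have cl: "closedin (zariski m) ?C"
    proof (rule closedin_regular)
      fix g assume "g \<in> (\<lambda>i A. ?F A i) ` {..<d}"
      then obtain i where "i < d" "g = (\<lambda>A. ?F A i)" by auto
      then show "regular_fun m g"
        by (auto intro!: regular_fun_diff regular_fun_mult regular_fun_const
            regular_fun_mult_mat_vec[OF _ w(1)] regular_map_mult regular_map_const M reg)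
    qed
    have iff: "x \<in> ?C \<longleftrightarrow> f x = c" if x: "x \<in> H" for x
    proof -
      have car: "\<rho> x *\<^sub>v w \<in> carrier_vec d" by (rule rep_vec_carrier[OF x w(1)])
      have M': "M *\<^sub>v (\<rho> x *\<^sub>v w) \<in> carrier_vec d" by (rule mult_mat_vec_carrier[OF M car])
      have assoc: "(M * \<rho> x) *\<^sub>v w = M *\<^sub>v (\<rho> x *\<^sub>v w)"
        by (rule assoc_mult_mat_vec[OF M rep_carrier[OF x] w(1)])
      have "x \<in> carrier_mat m m" using x subgroup.subset[OF H] carrier_subset by auto
      then have "x \<in> ?C \<longleftrightarrow> (\<forall>i<d. (M *\<^sub>v (\<rho> x *\<^sub>v w)) $ i = c * (\<rho> x *\<^sub>v w) $ i)"
        unfolding assoc[symmetric] by auto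
      also have "\<dots> \<longleftrightarrow> M *\<^sub>v (\<rho> x *\<^sub>v w) = c \<cdot>\<^sub>v (\<rho> x *\<^sub>v w)"
      proof
        assume e: "\<forall>i<d. (M *\<^sub>v (\<rho> x *\<^sub>v w)) $ i = c * (\<rho> x *\<^sub>v w) $ i"
        show "M *\<^sub>v (\<rho> x *\<^sub>v w) = c \<cdot>\<^sub>v (\<rho> x *\<^sub>v w)"
          by (rule eq_vecI) (use e car M' in \<open>simp_all del: index_mult_mat_vec dim_mult_mat_vec add: carrier_vecD\<close>)
      next
        assume e: "M *\<^sub>v (\<rho> x *\<^sub>v w) = c \<cdot>\<^sub>v (\<rho> x *\<^sub>v w)"
        show "\<forall>i<d. (M *\<^sub>v (\<rho> x *\<^sub>v w)) $ i = c * (\<rho> x *\<^sub>v w) $ i"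
          unfolding e using car by (simp del: index_mult_mat_vec dim_mult_mat_vec add: carrier_vecD)
      qed
      also have "\<dots> \<longleftrightarrow> f x = c" using f[OF x] uniq[OF x] by metis
      finally show ?thesis .
    qed
    show "\<exists>C. closedin (zariski m) C \<and> (\<forall>x\<in>H. x \<in> C \<longleftrightarrow> f x = c)"
      by (rule exI[of _ ?C], rule conjI, rule cl, rule ballI, rule iff)
  qed (use x subgroup.one_closed[OF H] in auto)
  moreover have "f \<one> = a" using uniq[OF subgroup.one_closed[OF H], of a] one one' by simp
  ultimately show ?thesis using f[OF x] by simp
qed

end

text \<open>Induction on the derived length inside a minimal stable subspace \<open>U\<close>. The
  derived subgroup has a weight vector in \<open>U\<close>; by \<open>eigenvalue_constant\<close>
  its weight space is stable under \<open>H\<close>, so it is all of \<open>U\<close>. Then the same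
  argument applies to an eigenspace of each single \<open>\<rho> y\<close>, since moving
  \<open>y\<close> past another element costs only a scalar on \<open>U\<close>. Thus
  \<open>H\<close> acts on \<open>U\<close> by scalars. The freedom in \<open>W\<close> is used
  later to find the second flag vector in a prescribed subspace.\<close>

theorem lie_kolchin:
  assumes "(derived G ^^ k) H = {\<one>}" "subgroup H G" "connectedin (zariski m) H" "rep_on H d \<rho>"
    "vec_subspace d W" "W \<noteq> {0\<^sub>v d}" "stable_under (\<rho> ` H) W"
  shows "\<exists>w\<in>W. w \<noteq> 0\<^sub>v d \<and> (\<forall>x\<in>H. \<exists>c. \<rho> x *\<^sub>v w = c \<cdot>\<^sub>v w)"
  using assms
proof (induction k arbitrary: H W)
  case 0
  obtain w where w: "w \<in> W" "w \<noteq> 0\<^sub>v d" using "0.prems"(5,6) vec_subspaceD(2) by blast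
  then have "w \<in> carrier_vec d" using "0.prems"(5) vec_subspaceD(1) by blast
  then have "\<rho> \<one> *\<^sub>v w = 1 \<cdot>\<^sub>v w" using rep_one_vec[OF "0.prems"(2,4)] by simp
  then show ?case using w "0.prems"(1) by (intro bexI[of _ w] conjI ballI exI[of _ 1]) auto
next
  case (Suc k)
  note H = Suc.prems(2) and rep = Suc.prems(4)
  let ?N = "derived G H"
  obtain U where U: "U \<subseteq> W" "vec_subspace d U" "U \<noteq> {0\<^sub>v d}" "stable_under (\<rho> ` H) U"
    and min: "\<And>U'. U' \<subseteq> U \<Longrightarrow> vec_subspace d U' \<Longrightarrow> U' \<noteq> {0\<^sub>v d} \<Longrightarrow> stable_under (\<rho> ` H) U' \<Longrightarrow> U' = U"
    using minimal_stable_subspace[OF Suc.prems(5-7)] by metis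
  have Uc: "u \<in> carrier_vec d" if "u \<in> U" for u using that vec_subspaceD(1)[OF U(2)] by auto
  have HU: "\<rho> x *\<^sub>v u \<in> U" if "x \<in> H" "u \<in> U" for x u using U(4) that by (auto simp: stable_under_def)
  have HG: "H \<subseteq> carrier G" by (rule subgroup.subset[OF H])
  have N: "subgroup ?N G" by (rule derived_is_subgroup[OF HG])
  have NH: "?N \<subseteq> H" by (rule derived_incl[OF order_refl H])
  have comm: "a \<otimes> b \<otimes> inv a \<otimes> inv b \<in> ?N" if "a \<in> H" "b \<in> H" for a b
    unfolding derived_def using that by (auto intro!: generate.incl)
  have dN: "(derived G ^^ k) ?N = {\<one>}" using Suc.prems(1) by (simp add: funpow_swap1)
  have "stable_under (\<rho> ` ?N) U" using U(4) NH unfolding stable_under_def by auto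
  then obtain w0 where w0: "w0 \<in> U" "w0 \<noteq> 0\<^sub>v d" "\<forall>x\<in>?N. \<exists>c. \<rho> x *\<^sub>v w0 = c \<cdot>\<^sub>v w0"
    using Suc.IH[OF dN N connectedin_derived[OF H Suc.prems(3)] rep_on_mono[OF rep NH] U(2,3)] by blast
  then obtain \<chi> where \<chi>: "\<And>x. x \<in> ?N \<Longrightarrow> \<rho> x *\<^sub>v w0 = \<chi> x \<cdot>\<^sub>v w0" by metis
  let ?U1 = "{u \<in> U. \<forall>x\<in>?N. \<rho> x *\<^sub>v u = \<chi> x \<cdot>\<^sub>v u}"
  have "?U1 = U"
  proof (rule min)
    show "vec_subspace d ?U1"
      by (rule vec_subspace_eigenspaces[OF U(2)]) (use rep_carrier[OF H rep] NH in auto)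
    show "?U1 \<noteq> {0\<^sub>v d}" using w0 \<chi> by blast
    have "\<rho> n *\<^sub>v (\<rho> x *\<^sub>v u) = \<chi> n \<cdot>\<^sub>v (\<rho> x *\<^sub>v u)"
      if u: "u \<in> U" "\<forall>x\<in>?N. \<rho> x *\<^sub>v u = \<chi> x \<cdot>\<^sub>v u" and x: "x \<in> H" and n: "n \<in> ?N" for x u n
    proof (cases "u = 0\<^sub>v d")
      case True
      have "\<rho> x *\<^sub>v u = 0\<^sub>v d" "\<rho> n *\<^sub>v 0\<^sub>v d = 0\<^sub>v d"
        unfolding True using mult_mat_zero_vec[OF rep_carrier[OF H rep]] x n NH by auto
      then show ?thesis by auto
    next
      case False
      have nH: "n \<in> H" using n NH by auto
      show ?thesis
      proof (rule eigenvalue_constant[OF H rep Suc.prems(3) rep_carrier[OF H rep nH] Uc[OF u(1)] False _ _ x])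
        show "\<rho> n *\<^sub>v u = \<chi> n \<cdot>\<^sub>v u" using u n by auto
        fix y assume y: "y \<in> H"
        let ?n' = "inv y \<otimes> n \<otimes> y"
        have yG: "y \<in> carrier G" "n \<in> carrier G" using y nH HG by auto
        have inv_in: "inv y \<in> H" "inv n \<in> H" using y nH subgroup.m_inv_closed[OF H] by auto
        \<comment> \<open>Conjugation by \<open>y\<close> changes \<open>n\<close> only by a
          commutator, so \<open>?n'\<close> stays in the derived subgroup.\<close>
        have "?n' = n \<otimes> (inv n \<otimes> inv y \<otimes> inv (inv n) \<otimes> inv (inv y))"
          using yG by (simp add: m_assoc[symmetric])
        then have n': "?n' \<in> ?N" using comm[OF inv_in(2,1)] n subgroup.m_closed[OF N] by simp
        then have n'H: "?n' \<in> H" using NH by auto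
        have "y \<otimes> ?n' = n \<otimes> y" using yG by (simp add: m_assoc[symmetric])
        then have "\<rho> n *\<^sub>v (\<rho> y *\<^sub>v u) = \<rho> y *\<^sub>v (\<rho> ?n' *\<^sub>v u)"
          using rep_mult_vec[OF H rep] y nH n'H Uc[OF u(1)] by metis
        also have "\<dots> = \<chi> ?n' \<cdot>\<^sub>v (\<rho> y *\<^sub>v u)"
          using u(2) n' mult_mat_vec[OF rep_carrier[OF H rep y] Uc[OF u(1)]] by auto
        finally show "\<exists>c. \<rho> n *\<^sub>v (\<rho> y *\<^sub>v u) = c \<cdot>\<^sub>v (\<rho> y *\<^sub>v u)" by blast
      qed
    qed
    then show "stable_under (\<rho> ` H) ?U1" using HU unfolding stable_under_def by blast
  qed blast
  then have U1: "\<rho> x *\<^sub>v u = \<chi> x \<cdot>\<^sub>v u" if "u \<in> U" "x \<in> ?N" for x u using that by blast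
  have "\<exists>c. \<rho> y *\<^sub>v w0 = c \<cdot>\<^sub>v w0" if y: "y \<in> H" for y
  proof -
    have "stable_under {\<rho> y} U" using HU y unfolding stable_under_def by auto
    then obtain u1 c where u1: "u1 \<in> U" "u1 \<noteq> 0\<^sub>v d" "\<rho> y *\<^sub>v u1 = c \<cdot>\<^sub>v u1"
      using eigenvector_in_stable_subspace[OF rep_carrier[OF H rep y] U(2,3)] by metis
    let ?U2 = "{u \<in> U. \<forall>i\<in>{()}. \<rho> y *\<^sub>v u = c \<cdot>\<^sub>v u}"
    have "?U2 = U"
    proof (rule min)
      show "vec_subspace d ?U2"
        by (rule vec_subspace_eigenspaces[OF U(2)]) (rule rep_carrier[OF H rep y])
      show "?U2 \<noteq> {0\<^sub>v d}" using u1 by blast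
      have "\<rho> y *\<^sub>v (\<rho> x *\<^sub>v u) = c \<cdot>\<^sub>v (\<rho> x *\<^sub>v u)"
        if u: "u \<in> U" "\<rho> y *\<^sub>v u = c \<cdot>\<^sub>v u" and x: "x \<in> H" for x u
      proof (cases "u = 0\<^sub>v d")
        case True
        have "\<rho> x *\<^sub>v u = 0\<^sub>v d" "\<rho> y *\<^sub>v 0\<^sub>v d = 0\<^sub>v d"
          unfolding True using mult_mat_zero_vec[OF rep_carrier[OF H rep]] x y by auto
        then show ?thesis by auto
      next
        case False
        show ?thesis
        proof (rule eigenvalue_constant[OF H rep Suc.prems(3) rep_carrier[OF H rep y] Uc[OF u(1)] False _ u(2) x])
          fix x assume x: "x \<in> H"
          have G: "x \<in> carrier G" "y \<in> carrier G" using x y HG by auto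
          \<comment> \<open>The price of exchanging \<open>y\<close> and \<open>x\<close>; it acts
            on \<open>U\<close> by the scalar \<open>\<chi> ?n\<close>, so
            \<open>\<rho> x *\<^sub>v u\<close> remains an eigenvector of
            \<open>\<rho> y\<close>.\<close>
          let ?n = "y \<otimes> x \<otimes> inv y \<otimes> inv x"
          have n: "?n \<in> ?N" by (rule comm[OF y x])
          have "inv x \<otimes> (x \<otimes> y) = y" using G by (simp add: m_assoc[symmetric])
          then have "y \<otimes> x = ?n \<otimes> (x \<otimes> y)" using G by (simp add: m_assoc)
          moreover have "?n \<in> H" "x \<otimes> y \<in> H" using n NH x y subgroup.m_closed[OF H] by auto
          ultimately have "\<rho> y *\<^sub>v (\<rho> x *\<^sub>v u) = \<rho> ?n *\<^sub>v (\<rho> x *\<^sub>v (\<rho> y *\<^sub>v u))"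
            using rep_mult_vec[OF H rep] x y Uc[OF u(1)] by metis
          also have "\<rho> x *\<^sub>v (\<rho> y *\<^sub>v u) = c \<cdot>\<^sub>v (\<rho> x *\<^sub>v u)"
            using u(2) mult_mat_vec[OF rep_carrier[OF H rep x] Uc[OF u(1)]] by simp
          also have "\<rho> ?n *\<^sub>v (c \<cdot>\<^sub>v (\<rho> x *\<^sub>v u)) = \<chi> ?n \<cdot>\<^sub>v (c \<cdot>\<^sub>v (\<rho> x *\<^sub>v u))"
            by (rule U1[OF vec_subspaceD(4)[OF U(2) HU[OF x u(1)]] n])
          also have "\<dots> = (\<chi> ?n * c) \<cdot>\<^sub>v (\<rho> x *\<^sub>v u)" by (simp add: smult_smult_assoc)
          finally show "\<exists>c. \<rho> y *\<^sub>v (\<rho> x *\<^sub>v u) = c \<cdot>\<^sub>v (\<rho> x *\<^sub>v u)" by blast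
        qed
      qed
      then show "stable_under (\<rho> ` H) ?U2" using HU unfolding stable_under_def by blast
    qed blast
    then have "w0 \<in> ?U2" using w0(1) by simp
    then show ?thesis by blast
  qed
  then show ?case using w0 U(1) by blast
qed

end

section \<open>The symplectic form\<close>

definition omega :: "nat \<Rightarrow> 'a::field vec \<Rightarrow> 'a vec \<Rightarrow> 'a" where
  "omega n v w = v \<bullet> (symplectic_form n *\<^sub>v w)"

lemma symplectic_form_mult_vec:
  fixes w :: "'a::field vec"
  assumes w: "w \<in> carrier_vec (2 * n)" and k: "k < 2 * n"
  shows "(symplectic_form n *\<^sub>v w) $ k = (if k < n then w $ (n + k) else - w $ (k - n))"
proof -
  let ?J = "symplectic_form n :: 'a mat"
  have entry: "?J $$ (k, l) =
      (if k < n then (if l = n + k then 1 else 0) else (if l = k - n then - 1 else 0))"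
    if "l < 2 * n" for l
    using k that by (auto simp: symplectic_form_def)
  have "(?J *\<^sub>v w) $ k = (\<Sum>l\<in>{0..<2 * n}. ?J $$ (k, l) * w $ l)"
    using w k carrier_matD[OF symplectic_form_carrier[of n, where 'a = 'a]]
    by (auto simp: scalar_prod_def intro!: sum.cong)
  also have "\<dots> = (\<Sum>l\<in>{0..<2 * n}. if l = (if k < n then n + k else k - n)
      then (if k < n then w $ l else - w $ l) else 0)"
    by (intro sum.cong) (auto simp: entry)
  also have "\<dots> = (if k < n then w $ (n + k) else - w $ (k - n))"
    using k by (subst sum.delta) auto
  finally show ?thesis .
qed

lemma omega_sum:
  fixes v w :: "'a::field vec"
  assumes v: "v \<in> carrier_vec (2 * n)" and w: "w \<in> carrier_vec (2 * n)"
  shows "omega n v w = (\<Sum>i<n. v $ i * w $ (n + i) - v $ (n + i) * w $ i)"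
proof -
  let ?f = "\<lambda>k. v $ k * (symplectic_form n *\<^sub>v w) $ k"
  have "omega n v w = (\<Sum>k\<in>{0..<2 * n}. ?f k)"
    using carrier_matD[OF symplectic_form_carrier[of n, where 'a = 'a]]
    by (simp add: omega_def scalar_prod_def)
  also have "\<dots> = (\<Sum>k\<in>{0..<n}. ?f k) + (\<Sum>k\<in>{n..<2 * n}. ?f k)"
    by (rule sum.atLeastLessThan_concat[symmetric]) auto
  also have "(\<Sum>k\<in>{n..<2 * n}. ?f k) = (\<Sum>k\<in>{0..<n}. ?f (k + n))"
    using sum.shift_bounds_nat_ivl[of ?f 0 n n] by (simp add: mult_2)
  also have "(\<Sum>k\<in>{0..<n}. ?f k) + (\<Sum>k\<in>{0..<n}. ?f (k + n)) =
      (\<Sum>i<n. v $ i * w $ (n + i) - v $ (n + i) * w $ i)"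
    unfolding sum.distrib[symmetric] lessThan_atLeast0
    by (intro sum.cong) (auto simp: symplectic_form_mult_vec[OF w] add.commute simp del: index_mult_mat_vec)
  finally show ?thesis .
qed

section \<open>Bilinearity, nondegeneracy and invariance of the form\<close>

context
  fixes n :: nat
begin

lemma omega_self: "v \<in> carrier_vec (2 * n) \<Longrightarrow> omega n v v = 0"
  by (simp add: omega_sum mult.commute)

lemma omega_skew: "v \<in> carrier_vec (2 * n) \<Longrightarrow> w \<in> carrier_vec (2 * n) \<Longrightarrow> omega n w v = - omega n v w"
  by (simp add: omega_sum sum_negf[symmetric] mult.commute)

lemma omega_add_left:
  "u \<in> carrier_vec (2 * n) \<Longrightarrow> v \<in> carrier_vec (2 * n) \<Longrightarrow> w \<in> carrier_vec (2 * n) \<Longrightarrow>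
    omega n (u + v) w = omega n u w + omega n v w"
  by (simp add: omega_sum sum.distrib[symmetric] algebra_simps)

lemma omega_add_right:
  "u \<in> carrier_vec (2 * n) \<Longrightarrow> v \<in> carrier_vec (2 * n) \<Longrightarrow> w \<in> carrier_vec (2 * n) \<Longrightarrow>
    omega n w (u + v) = omega n w u + omega n w v"
  by (simp add: omega_sum sum.distrib[symmetric] algebra_simps)

lemma omega_smult_left:
  "v \<in> carrier_vec (2 * n) \<Longrightarrow> w \<in> carrier_vec (2 * n) \<Longrightarrow> omega n (c \<cdot>\<^sub>v v) w = c * omega n v w"
  by (simp add: omega_sum sum_distrib_left algebra_simps)

lemma omega_smult_right:
  "v \<in> carrier_vec (2 * n) \<Longrightarrow> w \<in> carrier_vec (2 * n) \<Longrightarrow> omega n v (c \<cdot>\<^sub>v w) = c * omega n v w"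
  by (simp add: omega_sum sum_distrib_left algebra_simps)

lemma omega_zero_left: "w \<in> carrier_vec (2 * n) \<Longrightarrow> omega n (0\<^sub>v (2 * n)) w = 0"
  by (simp add: omega_sum)

lemma omega_zero_right: "w \<in> carrier_vec (2 * n) \<Longrightarrow> omega n w (0\<^sub>v (2 * n)) = 0"
  by (simp add: omega_sum)

lemmas omega_linear = omega_add_left omega_add_right omega_smult_left omega_smult_right
  omega_zero_left omega_zero_right

lemma omega_nondegenerate:
  assumes v: "v \<in> carrier_vec (2 * n)" and 0: "\<And>w. w \<in> carrier_vec (2 * n) \<Longrightarrow> omega n v w = 0"
  shows "v = 0\<^sub>v (2 * n)"
proof (rule eq_vecI)
  fix k assume "k < dim_vec (0\<^sub>v (2 * n) :: 'a vec)"
  then have k: "k < 2 * n" by simp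
  \<comment> \<open>The partner index of \<open>k\<close>: pairing with the unit vector at
    \<open>j\<close> reads off coordinate \<open>k\<close> up to sign.\<close>
  define j where "j = (if k < n then n + k else k - n)"
  have j: "j < 2 * n" using k by (auto simp: j_def)
  have "0 = omega n (unit_vec (2 * n) j) v"
    using 0[of "unit_vec (2 * n) j"] omega_skew[OF v, of "unit_vec (2 * n) j"] by simp
  also have "\<dots> = (symplectic_form n *\<^sub>v v) $ j"
    unfolding omega_def
    by (rule scalar_prod_left_unit) (use j v in \<open>auto intro!: mult_mat_vec_carrier[of _ _ "2 * n"]\<close>)
  also have "\<dots> = (if j < n then v $ (n + j) else - v $ (j - n))"
    by (rule symplectic_form_mult_vec[OF v j])
  finally show "v $ k = 0\<^sub>v (2 * n) $ k" using k by (auto simp: j_def split: if_splits)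
qed (use v in simp)

lemma Sp_carrier_mat: "A \<in> carrier (Sp n) \<Longrightarrow> A \<in> carrier_mat (2 * n) (2 * n)"
  by (simp add: Sp_def)

lemma Sp_vec: "A \<in> carrier (Sp n) \<Longrightarrow> v \<in> carrier_vec (2 * n) \<Longrightarrow> A *\<^sub>v v \<in> carrier_vec (2 * n)"
  using Sp_carrier_mat mult_mat_vec_carrier by blast

lemma omega_mult_mat_vec:
  fixes A :: "'a::field mat"
  assumes A: "A \<in> carrier_mat (2 * n) (2 * n)" and v: "v \<in> carrier_vec (2 * n)" "w \<in> carrier_vec (2 * n)"
  shows "omega n (A *\<^sub>v v) (A *\<^sub>v w) = v \<bullet> ((A\<^sup>T * symplectic_form n * A) *\<^sub>v w)"
proof -
  let ?J = "symplectic_form n :: 'a mat"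
  note J = symplectic_form_carrier[of n, where 'a = 'a]
  have Aw: "A *\<^sub>v w \<in> carrier_vec (2 * n)" by (rule mult_mat_vec_carrier[OF A v(2)])
  have JAw: "?J *\<^sub>v (A *\<^sub>v w) \<in> carrier_vec (2 * n)" by (rule mult_mat_vec_carrier[OF J Aw])
  have AT: "A\<^sup>T \<in> carrier_mat (2 * n) (2 * n)" using A by simp
  have "(A\<^sup>T * ?J * A) *\<^sub>v w = A\<^sup>T *\<^sub>v (?J *\<^sub>v (A *\<^sub>v w))"
    using assoc_mult_mat_vec[OF mult_carrier_mat[OF AT J] A v(2)] assoc_mult_mat_vec[OF AT J Aw] by simp
  moreover have "v \<bullet> (A\<^sup>T *\<^sub>v (?J *\<^sub>v (A *\<^sub>v w))) = (A\<^sup>T *\<^sub>v (?J *\<^sub>v (A *\<^sub>v w))) \<bullet> v"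
    by (rule comm_scalar_prod[OF v(1)]) (rule mult_mat_vec_carrier[OF AT JAw])
  moreover have "\<dots> = (?J *\<^sub>v (A *\<^sub>v w)) \<bullet> (A *\<^sub>v v)"
    by (rule transpose_vec_mult_scalar[OF A v(1) JAw])
  moreover have "\<dots> = omega n (A *\<^sub>v v) (A *\<^sub>v w)"
    unfolding omega_def by (rule comm_scalar_prod[OF JAw]) (rule mult_mat_vec_carrier[OF A v(1)])
  ultimately show ?thesis by simp
qed

lemma omega_Sp:
  "A \<in> carrier (Sp n) \<Longrightarrow> v \<in> carrier_vec (2 * n) \<Longrightarrow> w \<in> carrier_vec (2 * n) \<Longrightarrow>
    omega n (A *\<^sub>v v) (A *\<^sub>v w) = omega n v w"
  using omega_mult_mat_vec[of A v w] by (simp add: Sp_def omega_def)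

lemma Sp_I:
  fixes A :: "'a::field mat"
  assumes A: "A \<in> carrier_mat (2 * n) (2 * n)"
    and eq: "\<And>v w. v \<in> carrier_vec (2 * n) \<Longrightarrow> w \<in> carrier_vec (2 * n) \<Longrightarrow>
      omega n (A *\<^sub>v v) (A *\<^sub>v w) = omega n v w"
  shows "A \<in> carrier (Sp n)"
proof -
  let ?J = "symplectic_form n :: 'a mat" and ?e = "unit_vec (2 * n) :: nat \<Rightarrow> 'a vec"
  note J = symplectic_form_carrier[of n, where 'a = 'a]
  have M: "A\<^sup>T * ?J * A \<in> carrier_mat (2 * n) (2 * n)"
    using A J by (metis mult_carrier_mat transpose_carrier_mat)
  have entry: "X $$ (i, j) = ?e i \<bullet> (X *\<^sub>v ?e j)"
    if X: "X \<in> carrier_mat (2 * n) (2 * n)" and ij: "i < 2 * n" "j < 2 * n" for X i j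
  proof -
    have "?e i \<bullet> (X *\<^sub>v ?e j) = (X *\<^sub>v ?e j) $ i"
      by (rule scalar_prod_left_unit[OF mult_mat_vec_carrier[OF X]]) (use ij in auto)
    also have "\<dots> = X $$ (i, j)" using X ij by simp
    finally show ?thesis by simp
  qed
  have "A\<^sup>T * ?J * A = ?J"
  proof (rule eq_matI)
    fix i j assume "i < dim_row ?J" "j < dim_col ?J"
    then have ij: "i < 2 * n" "j < 2 * n" using J by auto
    show "(A\<^sup>T * ?J * A) $$ (i, j) = ?J $$ (i, j)"
      using eq[of "?e i" "?e j"] omega_mult_mat_vec[OF A, of "?e i" "?e j"]
      unfolding entry[OF M ij] entry[OF J ij] omega_def by simp
  qed (use A carrier_matD[OF J] in auto)
  then show ?thesis using A by (simp add: Sp_def)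
qed

section \<open>Transvections and transitivity of the symplectic group\<close>

definition transvection :: "'a::field \<Rightarrow> 'a vec \<Rightarrow> 'a mat" where
  "transvection a u = mat (2 * n) (2 * n)
     (\<lambda>(i, j). (if i = j then 1 else 0) + a * u $ i * (symplectic_form n *\<^sub>v u) $ j)"

lemma transvection_vec:
  fixes u :: "'a::field vec"
  assumes u: "u \<in> carrier_vec (2 * n)" and v: "v \<in> carrier_vec (2 * n)"
  shows "transvection a u *\<^sub>v v = v + (a * omega n v u) \<cdot>\<^sub>v u"
proof (rule eq_vecI)
  fix i assume "i < dim_vec (v + (a * omega n v u) \<cdot>\<^sub>v u)"
  then have i: "i < 2 * n" using u by simp
  let ?w = "symplectic_form n *\<^sub>v u"
  have w: "?w \<in> carrier_vec (2 * n)" using u by (auto intro!: mult_mat_vec_carrier[of _ _ "2 * n"])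
  have "(transvection a u *\<^sub>v v) $ i =
      (\<Sum>j\<in>{0..<2 * n}. ((if i = j then 1 else 0) + a * u $ i * ?w $ j) * v $ j)"
    using i v by (auto simp: transvection_def scalar_prod_def simp del: index_mult_mat_vec intro!: sum.cong
        simp: index_mult_mat_vec[of i "mat _ _ _"])
  also have "\<dots> = (\<Sum>j\<in>{0..<2 * n}. (if j = i then v $ j else 0)) + (\<Sum>j\<in>{0..<2 * n}. a * u $ i * (v $ j * ?w $ j))"
    unfolding sum.distrib[symmetric] by (intro sum.cong) (auto simp: algebra_simps simp del: index_mult_mat_vec)
  also have "\<dots> = v $ i + a * u $ i * omega n v u"
    using i unfolding omega_def scalar_prod_def carrier_vecD[OF w] sum_distrib_left[symmetric]
    by (simp del: index_mult_mat_vec)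
  finally show "(transvection a u *\<^sub>v v) $ i = (v + (a * omega n v u) \<cdot>\<^sub>v u) $ i"
    using i u v by (simp add: algebra_simps del: index_mult_mat_vec)
qed (use u v in \<open>simp add: transvection_def\<close>)

lemma transvection_Sp:
  fixes u :: "'a::field vec"
  assumes u: "u \<in> carrier_vec (2 * n)"
  shows "transvection a u \<in> carrier (Sp n)"
proof (rule Sp_I)
  fix v w :: "'a vec" assume v: "v \<in> carrier_vec (2 * n)" "w \<in> carrier_vec (2 * n)"
  show "omega n (transvection a u *\<^sub>v v) (transvection a u *\<^sub>v w) = omega n v w"
    using u v omega_skew[OF u v(2)]
    by (simp add: transvection_vec omega_linear omega_self algebra_simps)
qed (simp add: transvection_def)

text \<open>If \<open>omega n v\<close> vanished on the kernel of \<open>omega n c\<close>, it would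
  be a multiple of \<open>omega n c\<close>, and nondegeneracy would make \<open>v\<close> a
  multiple of \<open>c\<close>. For \<open>c\<close> zero, \<open>ind\<close> just says that
  \<open>v\<close> is nonzero, which gives transitivity on nonzero vectors later.\<close>

lemma exists_orthogonal:
  fixes c v :: "'a::field vec"
  assumes c: "c \<in> carrier_vec (2 * n)" and v: "v \<in> carrier_vec (2 * n)" and ind: "\<And>k. v \<noteq> k \<cdot>\<^sub>v c"
  shows "\<exists>z\<in>carrier_vec (2 * n). omega n c z = 0 \<and> omega n v z = 1"
proof -
  have "\<exists>z\<in>carrier_vec (2 * n). omega n c z = 0 \<and> omega n v z \<noteq> 0"
  proof (rule ccontr)
    assume neg: "\<not> ?thesis"
    show False
    proof (cases "c = 0\<^sub>v (2 * n)")
      case True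
      then have "v = 0\<^sub>v (2 * n)" using neg by (intro omega_nondegenerate[OF v]) (auto simp: omega_zero_left)
      moreover have "(0 :: 'a) \<cdot>\<^sub>v c = 0\<^sub>v (2 * n)" using True by auto
      ultimately show False using ind[of 0] by simp
    next
      case False
      then obtain x where x: "x \<in> carrier_vec (2 * n)" "omega n c x \<noteq> 0"
        using omega_nondegenerate[OF c] by blast
      let ?u = "omega n c x \<cdot>\<^sub>v v + (- omega n v x) \<cdot>\<^sub>v c"
      have "omega n ?u y = 0" if y: "y \<in> carrier_vec (2 * n)" for y
      proof -
        \<comment> \<open>\<open>y\<close> scaled and pushed along \<open>x\<close> into the kernel
          of \<open>omega n c\<close>; expanding shows
          \<open>omega n v ?z = omega n ?u y\<close>.\<close>
        let ?z = "omega n c x \<cdot>\<^sub>v y + (- omega n c y) \<cdot>\<^sub>v x"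
        have "omega n c ?z = 0" using c x y by (simp add: omega_linear algebra_simps)
        moreover have "?z \<in> carrier_vec (2 * n)" using x y by simp
        ultimately have "omega n v ?z = 0" using neg by blast
        then show ?thesis using c v x y by (simp add: omega_linear algebra_simps)
      qed
      then have "?u = 0\<^sub>v (2 * n)" by (rule omega_nondegenerate[rotated]) (use c v in auto)
      then have e: "\<forall>i<2 * n. ?u $ i = 0" by simp
      have "v = (omega n v x / omega n c x) \<cdot>\<^sub>v c"
        by (rule eq_vecI) (use e c v x in \<open>auto simp: field_simps\<close>)
      then show False using ind by blast
    qed
  qed
  then obtain z where z: "z \<in> carrier_vec (2 * n)" "omega n c z = 0" "omega n v z \<noteq> 0" by blast
  then show ?thesis
    using c v by (intro bexI[of _ "(1 / omega n v z) \<cdot>\<^sub>v z"]) (auto simp: omega_linear)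
qed

text \<open>For nonzero \<open>c\<close> independence is symmetric, so
  \<open>exists_orthogonal\<close> applies in both orders and yields a pair dual to \<open>c\<close>
  and \<open>v\<close>.\<close>

lemma exists_omega_values:
  fixes c v :: "'a::field vec"
  assumes c: "c \<in> carrier_vec (2 * n)" "c \<noteq> 0\<^sub>v (2 * n)" and v: "v \<in> carrier_vec (2 * n)"
    and ind: "\<And>k. v \<noteq> k \<cdot>\<^sub>v c"
  shows "\<exists>z\<in>carrier_vec (2 * n). omega n c z = a \<and> omega n v z = b"
proof -
  obtain x where x: "x \<in> carrier_vec (2 * n)" "omega n c x = 0" "omega n v x = 1"
    using exists_orthogonal[OF c(1) v ind] by blast
  have "c \<noteq> k \<cdot>\<^sub>v v" for k
  proof
    assume k: "c = k \<cdot>\<^sub>v v"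
    have "k \<noteq> 0" using c v k by auto
    then have "v = (1 / k) \<cdot>\<^sub>v c" unfolding k by (simp add: smult_smult_assoc)
    then show False using ind by blast
  qed
  then obtain y where y: "y \<in> carrier_vec (2 * n)" "omega n v y = 0" "omega n c y = 1"
    using exists_orthogonal[OF v c(1)] by blast
  show ?thesis
    using x y c v by (intro bexI[of _ "a \<cdot>\<^sub>v y + b \<cdot>\<^sub>v x"]) (auto simp: omega_linear)
qed

text \<open>A transvection along the difference of \<open>w\<close> and \<open>v\<close> shifts
  \<open>v\<close> by a multiple of that difference; the scalar \<open>?a\<close> normalises the
  multiple to 1. It fixes \<open>c\<close> because the difference is orthogonal to
  \<open>c\<close>.\<close>

lemma transvection_moves:
  fixes c v w :: "'a::field vec"
  assumes c: "c \<in> carrier_vec (2 * n)" and v: "v \<in> carrier_vec (2 * n)" and w: "w \<in> carrier_vec (2 * n)"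
    and orth: "omega n c v = 0" "omega n c w = 0" and vw: "omega n v w \<noteq> 0"
  shows "\<exists>A\<in>carrier (Sp n). A *\<^sub>v v = w \<and> A *\<^sub>v c = c"
proof -
  let ?u = "w + (- 1) \<cdot>\<^sub>v v" and ?a = "1 / omega n v w"
  have u: "?u \<in> carrier_vec (2 * n)" using v w by simp
  have "omega n v ?u = omega n v w" using v w by (simp add: omega_linear omega_self)
  then have "transvection ?a ?u *\<^sub>v v = v + 1 \<cdot>\<^sub>v ?u" using transvection_vec[OF u v] vw by simp
  also have "\<dots> = w" using v w by (intro eq_vecI) auto
  finally have 1: "transvection ?a ?u *\<^sub>v v = w" .
  have "omega n c ?u = 0" using c v w orth by (simp add: omega_linear)
  then have "transvection ?a ?u *\<^sub>v c = c + 0 \<cdot>\<^sub>v ?u" using transvection_vec[OF u c] by simp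
  also have "\<dots> = c" using c v w by (intro eq_vecI) auto
  finally show ?thesis using 1 transvection_Sp[OF u] by blast
qed

lemma Sp_mult_vec:
  assumes "A \<in> carrier (Sp n)" "B \<in> carrier (Sp n)" "v \<in> carrier_vec (2 * n)"
  shows "(A \<otimes>\<^bsub>Sp n\<^esub> B) *\<^sub>v v = A *\<^sub>v (B *\<^sub>v v)"
  using assoc_mult_mat_vec[OF Sp_carrier_mat Sp_carrier_mat] assms by (simp add: Sp_def)

text \<open>One transvection fails when \<open>v\<close> and \<open>w\<close> are orthogonal, so the
  path goes through a \<open>z\<close> orthogonal to neither but orthogonal to \<open>c\<close>.
  With \<open>c\<close> zero this is transitivity on nonzero vectors; with \<open>c\<close> the
  first vector of an isotropic pair it moves the second one while keeping the first.\<close>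

lemma Sp_transitive:
  fixes c v w :: "'a::field vec"
  assumes c: "c \<in> carrier_vec (2 * n)" and v: "v \<in> carrier_vec (2 * n)" and w: "w \<in> carrier_vec (2 * n)"
    and orth: "omega n c v = 0" "omega n c w = 0"
    and ind: "\<And>k. v \<noteq> k \<cdot>\<^sub>v c" "\<And>k. w \<noteq> k \<cdot>\<^sub>v c"
  shows "\<exists>A\<in>carrier (Sp n). A *\<^sub>v v = w \<and> A *\<^sub>v c = c"
proof -
  obtain x where x: "x \<in> carrier_vec (2 * n)" "omega n c x = 0" "omega n v x = 1"
    using exists_orthogonal[OF c v ind(1)] by blast
  obtain y where y: "y \<in> carrier_vec (2 * n)" "omega n c y = 0" "omega n w y = 1"
    using exists_orthogonal[OF c w ind(2)] by blast
  have "\<exists>z\<in>carrier_vec (2 * n). omega n c z = 0 \<and> omega n v z \<noteq> 0 \<and> omega n w z \<noteq> 0"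
  \<comment> \<open>If neither \<open>x\<close> nor \<open>y\<close> pairs nontrivially with both
    vectors, their sum does.\<close>
  proof (cases "omega n w x = 0 \<and> omega n v y = 0")
    case True
    then show ?thesis using x y c v w by (intro bexI[of _ "x + y"]) (auto simp: omega_linear)
  next
    case False
    then show ?thesis using x y by force
  qed
  then obtain z where z: "z \<in> carrier_vec (2 * n)" "omega n c z = 0" "omega n v z \<noteq> 0" "omega n w z \<noteq> 0"
    by blast
  obtain A where A: "A \<in> carrier (Sp n)" "A *\<^sub>v v = z" "A *\<^sub>v c = c"
    using transvection_moves[OF c v z(1) orth(1) z(2,3)] by blast
  have "omega n z w \<noteq> 0" using z(4) omega_skew[OF w z(1)] by simp
  then obtain B where B: "B \<in> carrier (Sp n)" "B *\<^sub>v z = w" "B *\<^sub>v c = c"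
    using transvection_moves[OF c z(1) w z(2) orth(2)] by blast
  show ?thesis
    by (rule bexI[of _ "B \<otimes>\<^bsub>Sp n\<^esub> A"])
      (use A B c v Sp_mult_vec in \<open>auto intro!: monoid.m_closed group.is_monoid group_Sp\<close>)
qed

end

section \<open>Isotropic flags fixed by solvable groups\<close>

text \<open>The form matrix squares to -1, so the defining identity of the group displays a left
  inverse of \<open>A\<close>. Its entries are polynomial in those of \<open>A\<close>, as
  \<open>inv_regular\<close> demands.\<close>

lemma inv_Sp:
  fixes A :: "'a::field mat"
  assumes A: "A \<in> carrier (Sp n)"
  shows "inv\<^bsub>Sp n\<^esub> A = (- symplectic_form n) * (A\<^sup>T * symplectic_form n)"
proof -
  let ?J = "symplectic_form n :: 'a mat" and ?B = "inv\<^bsub>Sp n\<^esub> A"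
  interpret group "Sp n :: 'a mat monoid" by (rule group_Sp)
  note J = symplectic_form_carrier[of n, where 'a = 'a]
  have Ac: "A \<in> carrier_mat (2 * n) (2 * n)" "A\<^sup>T * ?J * A = ?J" using A by (auto simp: Sp_def)
  have B: "?B \<in> carrier_mat (2 * n) (2 * n)" using A by (intro Sp_carrier_mat inv_closed)
  have AB: "A * ?B = 1\<^sub>m (2 * n)" using r_inv[OF A] by (simp add: Sp_def)
  have AT: "A\<^sup>T \<in> carrier_mat (2 * n) (2 * n)" using Ac by simp
  have AJ: "A\<^sup>T * ?J \<in> carrier_mat (2 * n) (2 * n)" by (rule mult_carrier_mat[OF AT J])
  have J': "- ?J \<in> carrier_mat (2 * n) (2 * n)" using J by simp
  have Y: "(- ?J) * (A\<^sup>T * ?J) \<in> carrier_mat (2 * n) (2 * n)" by (rule mult_carrier_mat[OF J' AJ])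
  have "(- ?J) * (A\<^sup>T * ?J) * A = (- ?J) * ?J" unfolding assoc_mult_mat[OF J' AJ Ac(1)] Ac(2) ..
  also have "\<dots> = - (?J * ?J)" by (rule uminus_mult_left_mat) (simp add: carrier_matD[OF J])
  finally have YA: "(- ?J) * (A\<^sup>T * ?J) * A = 1\<^sub>m (2 * n)" unfolding symplectic_form_square by simp
  have "(- ?J) * (A\<^sup>T * ?J) = (- ?J) * (A\<^sup>T * ?J) * (A * ?B)"
    unfolding AB by (rule right_mult_one_mat[OF Y, symmetric])
  also have "\<dots> = (- ?J) * (A\<^sup>T * ?J) * A * ?B" by (rule assoc_mult_mat[OF Y Ac(1) B, symmetric])
  finally show ?thesis using YA B by simp
qed

lemma matrix_group_Sp: "matrix_group (Sp n :: 'a::alg_closed_field mat monoid) (2 * n)"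
proof (intro matrix_group.intro matrix_group_axioms.intro group_Sp)
  let ?J = "symplectic_form n :: 'a mat"
  note J = symplectic_form_carrier[of n, where 'a = 'a]
  have "regular_map (2 * n) (2 * n) (\<lambda>A. (- ?J) * (A\<^sup>T * ?J))"
    by (intro regular_map_mult regular_map_transpose regular_map_id regular_map_const) (use J in auto)
  then show "\<exists>I. regular_map (2 * n) (2 * n) I \<and> (\<forall>x\<in>carrier (Sp n :: 'a mat monoid). inv\<^bsub>Sp n\<^esub> x = I x)"
    using inv_Sp by blast
qed (auto simp: Sp_def)

text \<open>Solvability of a Borel subgroup refers to the series formed inside it, while
  \<open>lie_kolchin\<close> takes derived subgroups in the ambient group; the commutators are the
  same.\<close>

lemma (in group) derived_series_consistent:
  assumes "subgroup H G"
  shows "(derived (G\<lparr>carrier := H\<rparr>) ^^ k) H = (derived G ^^ k) H \<and> (derived G ^^ k) H \<subseteq> H"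
proof (induction k)
  case (Suc k)
  then show ?case using derived_consistent[OF _ assms] derived_incl[OF _ assms] by simp
qed simp

section \<open>The quotient by the first basis vector\<close>

context
  fixes d :: nat
begin

text \<open>Picks, in a class modulo the first basis vector, the representative whose first
  coordinate is 0.\<close>

definition shift_vec :: "'a::field vec \<Rightarrow> 'a vec" where
  "shift_vec w = vec (Suc d) (\<lambda>i. if i = 0 then 0 else w $ (i - 1))"

definition shift_mat :: "'a::field mat \<Rightarrow> 'a mat" where
  "shift_mat M = mat d d (\<lambda>(i, j). M $$ (Suc i, Suc j))"

lemma shift_vec_carrier: "shift_vec w \<in> carrier_vec (Suc d)"
  by (simp add: shift_vec_def)

lemma shift_vec_add:
  "v \<in> carrier_vec d \<Longrightarrow> w \<in> carrier_vec d \<Longrightarrow> shift_vec (v + w) = shift_vec v + shift_vec w"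
  by (intro eq_vecI) (auto simp: shift_vec_def)

lemma shift_vec_smult: "w \<in> carrier_vec d \<Longrightarrow> shift_vec (c \<cdot>\<^sub>v w) = c \<cdot>\<^sub>v shift_vec w"
  by (intro eq_vecI) (auto simp: shift_vec_def)

lemma shift_vec_zero: "shift_vec (0\<^sub>v d) = 0\<^sub>v (Suc d)"
  by (intro eq_vecI) (auto simp: shift_vec_def)

lemma mult_shift_vec:
  assumes M: "M \<in> carrier_mat (Suc d) (Suc d)" and w: "w \<in> carrier_vec d"
  shows "M *\<^sub>v shift_vec w = (M *\<^sub>v shift_vec w) $ 0 \<cdot>\<^sub>v unit_vec (Suc d) 0 + shift_vec (shift_mat M *\<^sub>v w)"
proof (rule eq_vecI)
  fix i assume "i < dim_vec ((M *\<^sub>v shift_vec w) $ 0 \<cdot>\<^sub>v unit_vec (Suc d) 0 + shift_vec (shift_mat M *\<^sub>v w))"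
  then have i: "i < Suc d" by (simp add: shift_vec_def)
  show "(M *\<^sub>v shift_vec w) $ i =
      ((M *\<^sub>v shift_vec w) $ 0 \<cdot>\<^sub>v unit_vec (Suc d) 0 + shift_vec (shift_mat M *\<^sub>v w)) $ i"
  proof (cases i)
    case 0
    then show ?thesis by (simp add: shift_vec_def del: index_mult_mat_vec)
  next
    case (Suc k)
    have "(M *\<^sub>v shift_vec w) $ i = (\<Sum>l<Suc d. M $$ (i, l) * shift_vec w $ l)"
      using M i by (simp add: scalar_prod_def shift_vec_def lessThan_atLeast0 del: sum.lessThan_Suc)
    also have "\<dots> = (\<Sum>l<d. M $$ (i, Suc l) * w $ l)"
      unfolding sum.lessThan_Suc_shift by (simp add: shift_vec_def)
    also have "\<dots> = (shift_mat M *\<^sub>v w) $ k"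
      using i Suc w by (simp add: scalar_prod_def shift_mat_def lessThan_atLeast0)
    finally show ?thesis using i Suc by (simp add: shift_vec_def del: index_mult_mat_vec)
  qed
qed (use M in \<open>simp add: shift_vec_def\<close>)

text \<open>By \<open>e\<close> the matrix \<open>M\<close> is block triangular, so the first row of
  \<open>N\<close> does not reach the lower right block of the product.\<close>

lemma shift_mat_mult:
  assumes M: "M \<in> carrier_mat (Suc d) (Suc d)" and N: "N \<in> carrier_mat (Suc d) (Suc d)"
    and e: "M *\<^sub>v unit_vec (Suc d) 0 = c \<cdot>\<^sub>v unit_vec (Suc d) 0"
  shows "shift_mat (M * N) = shift_mat M * shift_mat N"
proof (rule eq_matI)
  fix i j assume "i < dim_row (shift_mat M * shift_mat N)" "j < dim_col (shift_mat M * shift_mat N)"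
  then have ij: "i < d" "j < d" by (auto simp: shift_mat_def)
  have "M $$ (Suc i, 0) = (M *\<^sub>v unit_vec (Suc d) 0) $ Suc i" using M ij by simp
  also have "\<dots> = 0" unfolding e using ij by simp
  finally have 0: "M $$ (Suc i, 0) = 0" .
  have "(M * N) $$ (Suc i, Suc j) = (\<Sum>l<Suc d. M $$ (Suc i, l) * N $$ (l, Suc j))"
    using M N ij by (simp add: scalar_prod_def lessThan_atLeast0 del: sum.lessThan_Suc)
  also have "\<dots> = (\<Sum>l<d. M $$ (Suc i, Suc l) * N $$ (Suc l, Suc j))"
    unfolding sum.lessThan_Suc_shift using 0 by simp
  also have "\<dots> = (shift_mat M * shift_mat N) $$ (i, j)"
    using ij by (simp add: scalar_prod_def shift_mat_def lessThan_atLeast0)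
  finally show "shift_mat (M * N) $$ (i, j) = (shift_mat M * shift_mat N) $$ (i, j)"
    using ij by (simp add: shift_mat_def)
qed (auto simp: shift_mat_def)

end

text \<open>The second vector comes from the action on \<open>v\<^sub>1\<^sup>\<bottom> / \<langle>v\<^sub>1\<rangle>\<close>: after moving \<open>v\<^sub>1\<close> to the first
  basis vector, the action on the quotient by \<open>v\<^sub>1\<close> is given by deleting the first row and column.\<close>

lemma Sp_isotropic_flag:
  fixes H :: "'a::alg_closed_field mat set"
  assumes n: "n \<ge> 2" and H: "subgroup H (Sp n)" and con: "connectedin (zariski (2 * n)) H"
    and sol: "solvable (Sp n\<lparr>carrier := H\<rparr>)"
  obtains v1 v2 where "v1 \<in> carrier_vec (2 * n)" "v2 \<in> carrier_vec (2 * n)" "v1 \<noteq> 0\<^sub>v (2 * n)"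
    "\<And>k. v2 \<noteq> k \<cdot>\<^sub>v v1" "omega n v1 v2 = 0"
    "\<And>b. b \<in> H \<Longrightarrow> \<exists>c. b *\<^sub>v v1 = c \<cdot>\<^sub>v v1"
    "\<And>b. b \<in> H \<Longrightarrow> \<exists>k c. b *\<^sub>v v2 = k \<cdot>\<^sub>v v1 + c \<cdot>\<^sub>v v2"
proof -
  define G where "G = (Sp n :: 'a mat monoid)"
  interpret matrix_group G "2 * n" unfolding G_def by (rule matrix_group_Sp)
  have HG: "subgroup H G" and HsG: "H \<subseteq> carrier G"
    using H subgroup.subset[OF H] by (simp_all add: G_def)
  have "group (G\<lparr>carrier := H\<rparr>)" by (rule subgroup_imp_group[OF HG])
  then obtain k where k: "(derived G ^^ k) H = {\<one>\<^bsub>G\<^esub>}"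
    using group.solvable_iff_trivial_derived_seq[of "G\<lparr>carrier := H\<rparr>"] sol
      derived_series_consistent[OF HG] by (auto simp: G_def)
  define d where "d = 2 * n - 1"
  have d: "2 * n = Suc d" "d > 0" using n by (auto simp: d_def)
  let ?V = "carrier_vec (2 * n) :: 'a vec set"
  have V: "vec_subspace (2 * n) ?V" by (simp add: vec_subspace_def)
  have e_nz: "unit_vec (2 * n) i \<noteq> (0\<^sub>v (2 * n) :: 'a vec)" if "i < 2 * n" for i
    using that by simp
  have "unit_vec (2 * n) 0 \<in> ?V" "unit_vec (2 * n) 0 \<noteq> (0\<^sub>v (2 * n) :: 'a vec)"
    using e_nz[of 0] n by auto
  then have Vnz: "?V \<noteq> {0\<^sub>v (2 * n)}" by (metis singletonD)
  have rep1: "rep_on H (2 * n) (\<lambda>x. x)"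
    unfolding rep_on_def by (simp add: regular_map_id mult_eq one_eq)
  have mat: "b \<in> carrier_mat (2 * n) (2 * n)" if "b \<in> carrier G" for b using that carrier_subset by auto
  have "stable_under ((\<lambda>x. x) ` H) ?V"
    unfolding stable_under_def using HsG mat by (auto intro: mult_mat_vec_carrier)
  from lie_kolchin[OF k HG con rep1 V Vnz this]
  obtain v1 where v1: "v1 \<in> ?V" "v1 \<noteq> 0\<^sub>v (2 * n)" "\<forall>b\<in>H. \<exists>c. b *\<^sub>v v1 = c \<cdot>\<^sub>v v1" by blast
  let ?e = "unit_vec (2 * n) 0 :: 'a vec"
  have zero: "0\<^sub>v (2 * n) \<in> ?V" by simp
  have "v1 \<noteq> l \<cdot>\<^sub>v 0\<^sub>v (2 * n)" "?e \<noteq> l \<cdot>\<^sub>v 0\<^sub>v (2 * n)" for l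
  proof -
    have 0: "l \<cdot>\<^sub>v 0\<^sub>v (2 * n) = (0\<^sub>v (2 * n) :: 'a vec)" by auto
    show "v1 \<noteq> l \<cdot>\<^sub>v 0\<^sub>v (2 * n)" "?e \<noteq> l \<cdot>\<^sub>v 0\<^sub>v (2 * n)"
      unfolding 0 using v1(2) e_nz[of 0] n by auto
  qed
  \<comment> \<open>Transitivity relative to the zero vector, that is, on nonzero vectors.\<close>
  then obtain C where C: "C \<in> carrier G" "C *\<^sub>v ?e = v1"
    using Sp_transitive[OF zero, of ?e v1] v1(1) unfolding G_def by (auto simp: omega_zero_left)
  define A where "A = inv\<^bsub>G\<^esub> C"
  have A: "A \<in> carrier G" using C by (simp add: A_def)
  have mv: "(X \<otimes>\<^bsub>G\<^esub> Y) *\<^sub>v v = X *\<^sub>v (Y *\<^sub>v v)"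
    if "X \<in> carrier G" "Y \<in> carrier G" "v \<in> ?V" for X Y v
    using Sp_mult_vec that unfolding G_def by blast
  have vc: "X *\<^sub>v v \<in> ?V" if "X \<in> carrier G" "v \<in> ?V" for X v
    using Sp_vec that unfolding G_def by blast
  have CA: "C *\<^sub>v (A *\<^sub>v v) = v" if "v \<in> ?V" for v
    using mv[OF C(1) A that] C(1) that by (simp add: A_def one_eq)
  have AC: "A *\<^sub>v (C *\<^sub>v v) = v" if "v \<in> ?V" for v
    using mv[OF A C(1) that] C(1) that by (simp add: A_def one_eq)
  define f where "f b = A * b * C" for b
  have fG: "f b = A \<otimes>\<^bsub>G\<^esub> b \<otimes>\<^bsub>G\<^esub> C" for b by (simp add: f_def mult_eq)
  have fc: "f b \<in> carrier G" if "b \<in> H" for b using that HsG A C unfolding fG by auto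
  have fm: "f b \<in> carrier_mat (Suc d) (Suc d)" if "b \<in> H" for b using mat[OF fc[OF that]] d by simp
  have fv: "f b *\<^sub>v v = A *\<^sub>v (b *\<^sub>v (C *\<^sub>v v))" if b: "b \<in> H" and v: "v \<in> ?V" for b v
  proof -
    have bG: "b \<in> carrier G" using b HsG by auto
    show ?thesis
      unfolding fG mv[OF m_closed[OF A bG] C(1) v] mv[OF A bG vc[OF C(1) v]] ..
  qed
  have fe: "\<exists>c. f b *\<^sub>v ?e = c \<cdot>\<^sub>v ?e" if b: "b \<in> H" for b
  proof -
    obtain c where c: "b *\<^sub>v v1 = c \<cdot>\<^sub>v v1" using v1(3) b by blast
    have "A *\<^sub>v (c \<cdot>\<^sub>v v1) = c \<cdot>\<^sub>v (A *\<^sub>v v1)" by (rule mult_mat_vec[OF mat[OF A] v1(1)])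
    also have "A *\<^sub>v v1 = ?e" using AC[of ?e] C(2) by simp
    finally show ?thesis using fv[OF b, of ?e] C(2) c by auto
  qed
  define \<rho> where "\<rho> b = shift_mat d (f b)" for b
  have rep: "rep_on H d \<rho>"
    unfolding rep_on_def
  proof (intro conjI ballI)
    have reg: "regular_map (2 * n) (2 * n) f"
      unfolding f_def by (intro regular_map_mult regular_map_const regular_map_id mat A C)
    have "regular_fun (2 * n) (\<lambda>b. \<rho> b $$ (i, j))" if "i < d" "j < d" for i j
      using regular_map_entry[OF reg, of "Suc i" "Suc j"] that d by (simp add: \<rho>_def shift_mat_def)
    then show "regular_map (2 * n) d \<rho>" by (simp add: regular_map_def \<rho>_def shift_mat_def)
  next
    fix x y assume xy: "x \<in> H" "y \<in> H"
    then have xyG: "x \<in> carrier G" "y \<in> carrier G" using HsG by auto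
    have "C \<otimes>\<^bsub>G\<^esub> (A \<otimes>\<^bsub>G\<^esub> (y \<otimes>\<^bsub>G\<^esub> C)) = y \<otimes>\<^bsub>G\<^esub> C" using C xyG by (simp add: A_def m_assoc[symmetric])
    then have "f (x \<otimes>\<^bsub>G\<^esub> y) = f x \<otimes>\<^bsub>G\<^esub> f y" unfolding fG using A C xyG by (simp add: m_assoc)
    moreover obtain c where "f x *\<^sub>v ?e = c \<cdot>\<^sub>v ?e" using fe[OF xy(1)] by blast
    ultimately show "\<rho> (x \<otimes>\<^bsub>G\<^esub> y) = \<rho> x * \<rho> y"
      using shift_mat_mult[OF fm[OF xy(1)] fm[OF xy(2)]] d(1) by (simp add: \<rho>_def mult_eq)
  next
    have "f \<one>\<^bsub>G\<^esub> = \<one>\<^bsub>G\<^esub>" unfolding fG using C by (simp add: A_def)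
    then show "\<rho> \<one>\<^bsub>G\<^esub> = 1\<^sub>m d" by (auto simp: \<rho>_def shift_mat_def one_eq d(1))
  qed
  let ?s = "shift_vec d :: 'a vec \<Rightarrow> 'a vec"
  have sc: "?s w \<in> ?V" for w using shift_vec_carrier[of d w] d(1) by simp
  have ec: "?e \<in> ?V" by simp
  \<comment> \<open>The orthogonal complement of \<open>?e\<close> seen in the quotient; taking the
    second vector here makes the plane isotropic.\<close>
  let ?W = "{w \<in> carrier_vec d. omega n ?e (?s w) = 0}"
  have act: "\<exists>k. f b *\<^sub>v ?s w = k \<cdot>\<^sub>v ?e + ?s (\<rho> b *\<^sub>v w)" if "b \<in> H" "w \<in> carrier_vec d" for b w
    using mult_shift_vec[OF fm[OF that(1)] that(2)] unfolding \<rho>_def d(1) by blast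
  have \<rho>c: "\<rho> b *\<^sub>v w \<in> carrier_vec d" if "w \<in> carrier_vec d" for b w
    by (rule mult_mat_vec_carrier[OF _ that]) (simp add: \<rho>_def shift_mat_def)
  have "vec_subspace d ?W"
    unfolding vec_subspace_def using sc ec d(1)
    by (auto simp: shift_vec_add shift_vec_smult shift_vec_zero omega_add_right omega_smult_right
        omega_zero_right[of _ n, unfolded d(1)])
  \<comment> \<open>For \<open>n \<ge> 2\<close> index 1 differs from \<open>n\<close>, the partner
    of index 0, so the second basis vector is orthogonal to the first.\<close>
  moreover have "?W \<noteq> {0\<^sub>v d}"
  proof -
    let ?w = "unit_vec d 0 :: 'a vec"
    have "?s ?w = unit_vec (2 * n) 1"
      using d by (intro eq_vecI) (auto simp: shift_vec_def)
    moreover have "omega n ?e (unit_vec (2 * n) 1) = 0"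
      using n by (subst omega_sum) (auto intro!: sum.neutral)
    ultimately have "?w \<in> ?W" by simp
    moreover have "?w \<noteq> 0\<^sub>v d" using d(2) by simp
    ultimately show ?thesis by (metis singletonD)
  qed
  moreover have "stable_under (\<rho> ` H) ?W"
    unfolding stable_under_def
  proof clarify
    fix b w assume b: "b \<in> H" and w: "w \<in> carrier_vec d" "omega n ?e (?s w) = 0"
    obtain k where k: "f b *\<^sub>v ?s w = k \<cdot>\<^sub>v ?e + ?s (\<rho> b *\<^sub>v w)" using act[OF b w(1)] by blast
    obtain c where c: "f b *\<^sub>v ?e = c \<cdot>\<^sub>v ?e" using fe[OF b] by blast
    have "f b *\<^sub>v ?e \<noteq> 0\<^sub>v (2 * n)"
    proof
      assume "f b *\<^sub>v ?e = 0\<^sub>v (2 * n)"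
      then have "omega n ?e v = 0" if "v \<in> ?V" for v
        using omega_Sp[OF fc[OF b, unfolded G_def] ec that] omega_zero_left[of "f b *\<^sub>v v" n]
          vc[OF fc[OF b] that] by simp
      then show False using omega_nondegenerate[OF ec] e_nz[of 0] n by auto
    qed
    then have "c \<noteq> 0" using c by auto
    moreover have "c * omega n ?e (?s (\<rho> b *\<^sub>v w)) = omega n (f b *\<^sub>v ?e) (f b *\<^sub>v ?s w)"
      unfolding c k using sc ec by (simp add: omega_linear omega_self)
    moreover have "\<dots> = 0" using omega_Sp[OF fc[OF b, unfolded G_def] ec sc] w by simp
    ultimately show "\<rho> b *\<^sub>v w \<in> carrier_vec d \<and> omega n ?e (?s (\<rho> b *\<^sub>v w)) = 0"
      using \<rho>c[OF w(1)] by simp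
  qed
  ultimately obtain w where w: "w \<in> carrier_vec d" "omega n ?e (?s w) = 0" "w \<noteq> 0\<^sub>v d"
    "\<forall>b\<in>H. \<exists>c. \<rho> b *\<^sub>v w = c \<cdot>\<^sub>v w"
    using lie_kolchin[OF k HG con rep, of ?W] by blast
  let ?v2 = "C *\<^sub>v ?s w"
  show ?thesis
  proof (rule that[of v1 ?v2])
    show "v1 \<in> ?V" "v1 \<noteq> 0\<^sub>v (2 * n)" by fact+
    show "?v2 \<in> ?V" by (rule vc[OF C(1) sc])
    show "omega n v1 ?v2 = 0"
      using omega_Sp[OF C(1)[unfolded G_def] ec sc] C(2) w(2) by simp
    show "?v2 \<noteq> l \<cdot>\<^sub>v v1" for l
    proof
      assume "?v2 = l \<cdot>\<^sub>v v1"
      then have "?s w = A *\<^sub>v (l \<cdot>\<^sub>v v1)" using AC[OF sc, of w] by simp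
      also have "\<dots> = l \<cdot>\<^sub>v (A *\<^sub>v v1)" by (rule mult_mat_vec[OF mat[OF A] v1(1)])
      also have "A *\<^sub>v v1 = ?e" using AC[of ?e] C(2) by simp
      finally have eq: "?s w = l \<cdot>\<^sub>v ?e" .
      have "w = 0\<^sub>v d"
      proof (rule eq_vecI)
        fix i assume "i < dim_vec (0\<^sub>v d :: 'a vec)"
        then have i: "i < d" by simp
        have "w $ i = ?s w $ Suc i" using i by (simp add: shift_vec_def)
        also have "\<dots> = 0" unfolding eq using i d by simp
        finally show "w $ i = 0\<^sub>v d $ i" using i by simp
      qed (use w in simp)
      then show False using w by simp
    qed
    show "\<exists>c. b *\<^sub>v v1 = c \<cdot>\<^sub>v v1" if "b \<in> H" for b using v1(3) that by blast
    show "\<exists>k c. b *\<^sub>v ?v2 = k \<cdot>\<^sub>v v1 + c \<cdot>\<^sub>v ?v2" if b: "b \<in> H" for b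
    proof -
      obtain c where c: "\<rho> b *\<^sub>v w = c \<cdot>\<^sub>v w" using w(4) b by blast
      obtain k where k: "f b *\<^sub>v ?s w = k \<cdot>\<^sub>v ?e + ?s (\<rho> b *\<^sub>v w)" using act[OF b w(1)] by blast
      have bG: "b \<in> carrier G" using b HsG by auto
      have "b *\<^sub>v ?v2 = C *\<^sub>v (f b *\<^sub>v ?s w)"
        using fv[OF b sc] CA[OF vc[OF bG vc[OF C(1) sc]]] by simp
      also have "\<dots> = C *\<^sub>v (k \<cdot>\<^sub>v ?e + c \<cdot>\<^sub>v ?s w)" unfolding k c using shift_vec_smult[OF w(1)] by simp
      also have "\<dots> = C *\<^sub>v (k \<cdot>\<^sub>v ?e) + C *\<^sub>v (c \<cdot>\<^sub>v ?s w)"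
        by (rule mult_add_distrib_mat_vec[OF mat[OF C(1)]]) (use ec sc in auto)
      also have "\<dots> = k \<cdot>\<^sub>v v1 + c \<cdot>\<^sub>v ?v2"
        using mult_mat_vec[OF mat[OF C(1)] ec] mult_mat_vec[OF mat[OF C(1)] sc] C(2) by simp
      finally show ?thesis by blast
    qed
  qed
qed

section \<open>Mixed elements in characteristic 2\<close>

lemma mat_eq_one_of_fixes_basis:
  fixes X P Q :: "'a::field mat"
  assumes X: "X \<in> carrier_mat m m" and P: "P \<in> carrier_mat m m" and Q: "Q \<in> carrier_mat m m"
    and PQ: "P * Q = 1\<^sub>m m" and fixed: "\<And>i. i < m \<Longrightarrow> X *\<^sub>v col P i = col P i"
  shows "X = 1\<^sub>m m"
proof -
  have "X * P = P"
  proof (rule mat_col_eqI)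
    fix i assume "i < dim_col P"
    then have i: "i < m" using P by simp
    show "col (X * P) i = col P i" using col_mult2[OF X P i] fixed[OF i] by simp
  qed (use X P in auto)
  then have "X * (P * Q) = P * Q" using assoc_mult_mat[OF X P Q] by simp
  then show ?thesis using PQ X by simp
qed

lemma nilpotent_chain:
  fixes N :: "'a::field mat"
  assumes N: "N \<in> carrier_mat m m" and nil: "N ^\<^sub>m k = 0\<^sub>m m m"
    and v: "v \<in> carrier_vec m" "v \<noteq> 0\<^sub>v m"
  shows "\<exists>j. ((*\<^sub>v) N ^^ j) v \<noteq> 0\<^sub>v m \<and> ((*\<^sub>v) N ^^ Suc j) v = 0\<^sub>v m"
proof -
  have pow: "N ^\<^sub>m i \<in> carrier_mat m m" for i using N by (rule pow_carrier_mat)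
  have "w \<in> carrier_vec m \<Longrightarrow> ((*\<^sub>v) N ^^ i) w = (N ^\<^sub>m i) *\<^sub>v w" for i w
  proof (induction i arbitrary: w)
    case 0
    then show ?case using N by simp
  next
    case (Suc i)
    have "((*\<^sub>v) N ^^ Suc i) w = ((*\<^sub>v) N ^^ i) (N *\<^sub>v w)" by (simp add: funpow_swap1)
    also have "\<dots> = (N ^\<^sub>m i) *\<^sub>v (N *\<^sub>v w)" by (rule Suc.IH) (rule mult_mat_vec_carrier[OF N Suc.prems])
    also have "\<dots> = (N ^\<^sub>m Suc i) *\<^sub>v w" using assoc_mult_mat_vec[OF pow N Suc.prems] by simp
    finally show ?case .
  qed
  moreover have "0\<^sub>m m m *\<^sub>v v = 0\<^sub>v m" using v by (intro eq_vecI) auto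
  ultimately have "((*\<^sub>v) N ^^ k) v = 0\<^sub>v m" using v nil by simp
  then show ?thesis
    using ex_least_nat_less[of "\<lambda>j. ((*\<^sub>v) N ^^ j) v = 0\<^sub>v m" k] v(2) by auto
qed

text \<open>A Jordan chain of length two comes from \<open>u \<noteq> 1\<close> and an eigenvector from \<open>s \<noteq> 1\<close>, both by
  iterating \<open>u - 1\<close> inside an eigenspace of \<open>s\<close>.\<close>

lemma mixed_vectors:
  fixes g :: "'a::alg_closed_field mat"
  assumes "mixed (Sp n) g"
  obtains p l z y c where
    "p \<in> carrier_vec (2 * n)" "z \<in> carrier_vec (2 * n)" "y \<in> carrier_vec (2 * n)"
    "p \<noteq> 0\<^sub>v (2 * n)" "y \<noteq> 0\<^sub>v (2 * n)" "l \<noteq> 1"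
    "g *\<^sub>v p = l \<cdot>\<^sub>v p" "g *\<^sub>v z = c \<cdot>\<^sub>v (z + y)" "g *\<^sub>v y = c \<cdot>\<^sub>v y"
proof -
  let ?m = "2 * n"
  interpret group "Sp n :: 'a mat monoid" by (rule group_Sp)
  obtain s u where su: "s \<in> carrier (Sp n)" "u \<in> carrier (Sp n)" "semisimple_mat s" "unipotent_mat u"
    "g = s * u" "s * u = u * s" "s \<notin> group_center (Sp n)" "u \<noteq> 1\<^sub>m ?m"
    using assms unfolding mixed_def jordan_decomposition_def by (auto simp: Sp_def)
  have s: "s \<in> carrier_mat ?m ?m" and u: "u \<in> carrier_mat ?m ?m" using su Sp_carrier_mat by auto
  have "\<one>\<^bsub>Sp n\<^esub> \<in> group_center (Sp n :: 'a mat monoid)" by (auto simp: group_center_def)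
  then have s1: "s \<noteq> 1\<^sub>m ?m" using su(7) by (auto simp: Sp_def)
  obtain D P Q where "similar_mat_wit s D P Q" and diag: "diagonal_mat D"
    using su(3) unfolding semisimple_mat_def similar_mat_def by blast
  then have D: "D \<in> carrier_mat ?m ?m" and P: "P \<in> carrier_mat ?m ?m" and Q: "Q \<in> carrier_mat ?m ?m"
    and PQ: "P * Q = 1\<^sub>m ?m" "Q * P = 1\<^sub>m ?m" and sPDQ: "s = P * D * Q"
    using similar_mat_witD2[OF s] by auto
  have Pc: "col P i \<in> carrier_vec ?m" for i using P by (metis col_dim carrier_matD(1))
  have eig: "s *\<^sub>v col P i = D $$ (i, i) \<cdot>\<^sub>v col P i" if i: "i < ?m" for i
  proof -
    have "s * P = P * D * (Q * P)" unfolding sPDQ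
      by (rule assoc_mult_mat[OF mult_carrier_mat[OF P D] Q P])
    also have "\<dots> = P * D" unfolding PQ by (rule right_mult_one_mat[OF mult_carrier_mat[OF P D]])
    finally have "s *\<^sub>v col P i = P *\<^sub>v col D i" using col_mult2[OF s P i] col_mult2[OF P D i] by simp
    also have "col D i = D $$ (i, i) \<cdot>\<^sub>v unit_vec ?m i"
      using diag D i unfolding diagonal_mat_def by (intro eq_vecI) auto
    also have "P *\<^sub>v (D $$ (i, i) \<cdot>\<^sub>v unit_vec ?m i) = D $$ (i, i) \<cdot>\<^sub>v (P *\<^sub>v unit_vec ?m i)"
      by (rule mult_mat_vec[OF P]) simp
    also have "P *\<^sub>v unit_vec ?m i = col P i" using P i by (intro eq_vecI) auto
    finally show ?thesis .
  qed
  have Pnz: "col P i \<noteq> 0\<^sub>v ?m" if i: "i < ?m" for i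
  proof
    assume 0: "col P i = 0\<^sub>v ?m"
    have "unit_vec ?m i = Q *\<^sub>v col P i" using col_mult2[OF Q P i] PQ i by simp
    also have "\<dots> = 0\<^sub>v ?m" unfolding 0 by (rule mult_mat_zero_vec[OF Q])
    finally show False using i by simp
  qed
  define N where "N = u - 1\<^sub>m ?m"
  have N: "N \<in> carrier_mat ?m ?m" using u by (simp add: N_def minus_carrier_mat)
  obtain k where nil: "N ^\<^sub>m k = 0\<^sub>m ?m ?m"
    using su(4) u unfolding unipotent_mat_def N_def by auto
  have uN: "u *\<^sub>v x = x + N *\<^sub>v x" if x: "x \<in> carrier_vec ?m" for x
  proof -
    have "u = 1\<^sub>m ?m + N" using u by (intro eq_matI) (auto simp: N_def)
    then have "u *\<^sub>v x = (1\<^sub>m ?m + N) *\<^sub>v x" by simp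
    also have "\<dots> = 1\<^sub>m ?m *\<^sub>v x + N *\<^sub>v x" by (rule add_mult_distrib_mat_vec[OF one_carrier_mat N x])
    finally show ?thesis using x by simp
  qed
  have sN: "s * N = N * s"
    unfolding N_def using su(6) mult_minus_distrib_mat[OF s u one_carrier_mat]
      minus_mult_distrib_mat[OF u one_carrier_mat s] s by simp
  have chain: "((*\<^sub>v) N ^^ j) x \<in> carrier_vec ?m \<and> s *\<^sub>v ((*\<^sub>v) N ^^ j) x = c \<cdot>\<^sub>v ((*\<^sub>v) N ^^ j) x"
    if x: "x \<in> carrier_vec ?m" "s *\<^sub>v x = c \<cdot>\<^sub>v x" for j x c
  proof (induction j)
    case (Suc j)
    let ?w = "((*\<^sub>v) N ^^ j) x"
    have w: "?w \<in> carrier_vec ?m" using Suc by simp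
    have "s *\<^sub>v (N *\<^sub>v ?w) = (s * N) *\<^sub>v ?w" by (rule assoc_mult_mat_vec[OF s N w, symmetric])
    also have "\<dots> = N *\<^sub>v (s *\<^sub>v ?w)" unfolding sN by (rule assoc_mult_mat_vec[OF N s w])
    also have "\<dots> = c \<cdot>\<^sub>v (N *\<^sub>v ?w)" using Suc mult_mat_vec[OF N w] by simp
    finally show ?case using mult_mat_vec_carrier[OF N w] by simp
  qed (use x in simp)
  have gv: "g *\<^sub>v x = s *\<^sub>v (u *\<^sub>v x)" if "x \<in> carrier_vec ?m" for x
    unfolding su(5) by (rule assoc_mult_mat_vec[OF s u that])
  \<comment> \<open>Otherwise \<open>s\<close> would fix its eigenbasis and be the identity, which
    is central.\<close>
  obtain i where i: "i < ?m" "D $$ (i, i) \<noteq> 1"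
  proof -
    have "\<not> (\<forall>i<?m. D $$ (i, i) = 1)"
      using mat_eq_one_of_fixes_basis[OF s P Q PQ(1)] s1 eig by auto
    then show ?thesis using that by blast
  qed
  obtain a where a: "((*\<^sub>v) N ^^ a) (col P i) \<noteq> 0\<^sub>v ?m" "((*\<^sub>v) N ^^ Suc a) (col P i) = 0\<^sub>v ?m"
    using nilpotent_chain[OF N nil Pc Pnz[OF i(1)]] by blast
  let ?p = "((*\<^sub>v) N ^^ a) (col P i)"
  have p: "?p \<in> carrier_vec ?m" "s *\<^sub>v ?p = D $$ (i, i) \<cdot>\<^sub>v ?p" using chain[OF Pc eig[OF i(1)]] by auto
  have "u *\<^sub>v ?p = ?p" using uN[OF p(1)] a(2) p(1) by simp
  then have gp: "g *\<^sub>v ?p = D $$ (i, i) \<cdot>\<^sub>v ?p" using gv p by simp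
  obtain j where j: "j < ?m" "u *\<^sub>v col P j \<noteq> col P j"
    using mat_eq_one_of_fixes_basis[OF u P Q PQ(1)] su(8) by blast
  have "N *\<^sub>v col P j \<noteq> 0\<^sub>v ?m" using uN[OF Pc, of j] j(2) Pc[of j] by auto
  \<comment> \<open>Starting at \<open>N *\<^sub>v col P j\<close> instead of \<open>col P j\<close>
    ensures that the last nonzero iterate \<open>?y\<close> is itself an image
    \<open>N *\<^sub>v ?z\<close>.\<close>
  then obtain b where b: "((*\<^sub>v) N ^^ b) (N *\<^sub>v col P j) \<noteq> 0\<^sub>v ?m" "((*\<^sub>v) N ^^ Suc b) (N *\<^sub>v col P j) = 0\<^sub>v ?m"
    using nilpotent_chain[OF N nil mult_mat_vec_carrier[OF N Pc]] by blast
  let ?z = "((*\<^sub>v) N ^^ b) (col P j)" and ?y = "((*\<^sub>v) N ^^ Suc b) (col P j)" and ?c = "D $$ (j, j)"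
  have z: "?z \<in> carrier_vec ?m" "s *\<^sub>v ?z = ?c \<cdot>\<^sub>v ?z" using chain[OF Pc eig[OF j(1)]] by auto
  have y: "?y \<in> carrier_vec ?m" "s *\<^sub>v ?y = ?c \<cdot>\<^sub>v ?y" using chain[OF Pc eig[OF j(1)], of "Suc b"] by auto
  have y0: "?y \<noteq> 0\<^sub>v ?m" using b(1) by (simp add: funpow_swap1)
  have "N *\<^sub>v ?y = 0\<^sub>v ?m" using b(2) by (simp add: funpow_swap1)
  then have "u *\<^sub>v ?y = ?y" using uN[OF y(1)] y(1) by simp
  then have gy: "g *\<^sub>v ?y = ?c \<cdot>\<^sub>v ?y" using gv[OF y(1)] y by simp
  have "u *\<^sub>v ?z = ?z + ?y" using uN[OF z(1)] by simp
  then have "g *\<^sub>v ?z = s *\<^sub>v (?z + ?y)" using gv[OF z(1)] by simp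
  also have "\<dots> = ?c \<cdot>\<^sub>v ?z + ?c \<cdot>\<^sub>v ?y" using mult_add_distrib_mat_vec[OF s z(1) y(1)] z y by simp
  also have "\<dots> = ?c \<cdot>\<^sub>v (?z + ?y)" by (rule smult_add_distrib_vec[OF z(1) y(1), symmetric])
  finally have gz: "g *\<^sub>v ?z = ?c \<cdot>\<^sub>v (?z + ?y)" .
  show ?thesis by (rule that[OF p(1) z(1) y(1) a(1) y0 i(2) gp gz gy])
qed

lemma omega_Sp_adjoint:
  fixes A :: "'a::field mat"
  assumes A: "A \<in> carrier (Sp n)" and v: "v \<in> carrier_vec (2 * n)" and w: "w \<in> carrier_vec (2 * n)"
  shows "omega n v (A *\<^sub>v w) = omega n (inv\<^bsub>Sp n\<^esub> A *\<^sub>v v) w"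
proof -
  interpret group "Sp n :: 'a mat monoid" by (rule group_Sp)
  have "A *\<^sub>v (inv\<^bsub>Sp n\<^esub> A *\<^sub>v v) = (A \<otimes>\<^bsub>Sp n\<^esub> inv\<^bsub>Sp n\<^esub> A) *\<^sub>v v"
    using Sp_mult_vec[OF A inv_closed[OF A] v] by simp
  also have "\<dots> = v" using r_inv[OF A] v by (simp add: Sp_def)
  finally show ?thesis using omega_Sp[OF A Sp_vec[OF inv_closed[OF A] v] w] by simp
qed

section \<open>Arithmetic in characteristic 2\<close>

context
  assumes char2: "CHAR('a::alg_closed_field) = 2"
begin

lemma double_char2: "x + x = (0 :: 'a)"
proof -
  have "of_nat 2 = (0 :: 'a)" using of_nat_CHAR[where 'a = 'a] char2 by simp
  then have "(2 :: 'a) = 0" by simp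
  then show ?thesis by (metis mult_2 mult_zero_left)
qed

lemma minus_char2: "- x = (x :: 'a)"
  using double_char2[of x] by (simp add: minus_unique)

lemma diff_char2: "x - y = x + (y :: 'a)"
  using minus_char2[of y] by (simp add: diff_conv_add_uminus del: add_uminus_conv_diff)

lemma eq_iff_char2: "x = y \<longleftrightarrow> x + y = (0 :: 'a)"
  using diff_char2[of x y] by (metis eq_iff_diff_eq_0)

lemma square_add_char2: "(x + y) * (x + y) = x * x + y * (y :: 'a)"
proof -
  have "(x + y) * (x + y) = x * x + y * y + (x * y + x * y)" by (simp add: algebra_simps)
  then show ?thesis by (simp add: double_char2)
qed

text \<open>In characteristic 2 the sum is \<open>(c + 1)^2 / c\<close>.\<close>

lemma add_inverse_nonzero_char2:
  assumes "c \<noteq> 0" "c \<noteq> (1 :: 'a)"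
  shows "c + 1 / c \<noteq> 0"
proof
  assume "c + 1 / c = 0"
  then have "(c + 1) * (c + 1) = 0" using assms(1) by (simp add: square_add_char2 field_simps)
  then have "c + 1 = 0" by simp
  then show False using assms(2) eq_iff_char2[of c 1] by simp
qed

lemma omega_sym_char2:
  "v \<in> carrier_vec (2 * n) \<Longrightarrow> w \<in> carrier_vec (2 * n) \<Longrightarrow> omega n w v = omega n v (w :: 'a vec)"
  using omega_skew minus_char2 by metis

section \<open>An eigenvector and a Jordan chain against the two ratios\<close>

context
  fixes n :: nat and g :: "'a mat" and p z y :: "'a vec" and l c :: 'a
  assumes g: "g \<in> carrier (Sp n)"
    and car: "p \<in> carrier_vec (2 * n)" "z \<in> carrier_vec (2 * n)" "y \<in> carrier_vec (2 * n)"
    and nz: "p \<noteq> 0\<^sub>v (2 * n)" "y \<noteq> 0\<^sub>v (2 * n)" and l1: "l \<noteq> 1"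
    and gp: "g *\<^sub>v p = l \<cdot>\<^sub>v p" and gz: "g *\<^sub>v z = c \<cdot>\<^sub>v (z + y)" and gy: "g *\<^sub>v y = c \<cdot>\<^sub>v y"
begin

lemma exists_omega_one:
  assumes "v \<in> carrier_vec (2 * n)" "v \<noteq> (0\<^sub>v (2 * n) :: 'a vec)"
  shows "\<exists>x\<in>carrier_vec (2 * n). omega n v x = 1"
proof -
  have "v \<noteq> k \<cdot>\<^sub>v 0\<^sub>v (2 * n)" for k using assms(2) by auto
  then show ?thesis using exists_orthogonal[OF zero_carrier_vec assms(1)] by blast
qed

lemma eigenvalue_Sp_nonzero:
  assumes v: "v \<in> carrier_vec (2 * n)" "v \<noteq> 0\<^sub>v (2 * n)" and e: "g *\<^sub>v v = k \<cdot>\<^sub>v v"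
  shows "k \<noteq> 0"
proof
  assume k: "k = 0"
  obtain x where x: "x \<in> carrier_vec (2 * n)" "omega n v x = 1" using exists_omega_one[OF v] by blast
  have "omega n v x = omega n (k \<cdot>\<^sub>v v) (g *\<^sub>v x)" using omega_Sp[OF g v(1) x(1)] e by simp
  also have "\<dots> = 0" using v Sp_vec[OF g x(1)] k by (simp add: omega_linear)
  finally show False using x by simp
qed

lemma l_nonzero: "l \<noteq> 0" by (rule eigenvalue_Sp_nonzero[OF car(1) nz(1) gp])

lemma c_nonzero: "c \<noteq> 0" by (rule eigenvalue_Sp_nonzero[OF car(3) nz(2) gy])

lemma e_nonzero: "l + 1 / l \<noteq> 0" by (rule add_inverse_nonzero_char2[OF l_nonzero l1])

text \<open>The adjoint of \<open>g\<close> is its inverse, which multiplies \<open>p\<close> by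
  \<open>1 / l\<close>. The next two rules do the same for the chain.\<close>

lemma omega_p_g:
  assumes x: "x \<in> carrier_vec (2 * n)"
  shows "omega n p (g *\<^sub>v x) = omega n p x / l"
proof -
  have "omega n p x = omega n (l \<cdot>\<^sub>v p) (g *\<^sub>v x)" using omega_Sp[OF g car(1) x] gp by simp
  also have "\<dots> = l * omega n p (g *\<^sub>v x)" using car Sp_vec[OF g x] by (simp add: omega_linear)
  finally show ?thesis using l_nonzero by (simp add: field_simps)
qed

lemma omega_y_g:
  assumes x: "x \<in> carrier_vec (2 * n)"
  shows "omega n y (g *\<^sub>v x) = omega n y x / c"
proof -
  have "omega n y x = omega n (c \<cdot>\<^sub>v y) (g *\<^sub>v x)" using omega_Sp[OF g car(3) x] gy by simp
  also have "\<dots> = c * omega n y (g *\<^sub>v x)" using car Sp_vec[OF g x] by (simp add: omega_linear)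
  finally show ?thesis using c_nonzero by (simp add: field_simps)
qed

text \<open>In characteristic 2 \<open>g\<close> sends \<open>z + y\<close> to
  \<open>c \<cdot>\<^sub>v z\<close>, so the inverse has the same shape on the chain with
  \<open>1 / c\<close> in place of \<open>c\<close>.\<close>

lemma omega_z_g:
  assumes x: "x \<in> carrier_vec (2 * n)"
  shows "omega n z (g *\<^sub>v x) = (omega n z x + omega n y x) / c"
proof -
  have "omega n z x = omega n (c \<cdot>\<^sub>v (z + y)) (g *\<^sub>v x)" using omega_Sp[OF g car(2) x] gz by simp
  also have "\<dots> = c * omega n z (g *\<^sub>v x) + omega n y x"
    using car Sp_vec[OF g x] c_nonzero by (simp add: omega_linear omega_y_g[OF x] field_simps)
  finally have "c * omega n z (g *\<^sub>v x) = omega n z x + omega n y x"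
    using diff_char2[of "omega n z x" "omega n y x"] by (simp add: algebra_simps)
  then show ?thesis using c_nonzero by (simp add: field_simps)
qed

lemma z_not_multiple: "z \<noteq> k \<cdot>\<^sub>v y"
proof
  assume k: "z = k \<cdot>\<^sub>v y"
  obtain x where x: "x \<in> carrier_vec (2 * n)" "omega n y x = 1" using exists_omega_one[OF car(3) nz(2)] by blast
  have "omega n z (g *\<^sub>v x) = k * omega n y (g *\<^sub>v x)" unfolding k using car Sp_vec[OF g x(1)] by (simp add: omega_linear)
  then have "omega n z x + omega n y x = k * omega n y x"
    using x c_nonzero by (simp add: omega_z_g omega_y_g)
  moreover have "omega n z x = k * omega n y x" unfolding k using car x by (simp add: omega_linear)
  ultimately show False using x by simp
qed

text \<open>The vector \<open>p\<close> shows that \<open>k\<close> is nonzero. On the chain the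
  second-order terms of the polarised identity come doubled, hence vanish, leaving
  \<open>k * (c + 1 / c) = 0\<close>. Once \<open>c = 1\<close>, \<open>g\<close> squared fixes
  \<open>z\<close>, and the identity at \<open>z\<close> itself, before polarisation, gives
  \<open>k * omega n z y = 0\<close>.\<close>

lemma first_ratio_consequences:
  assumes ratio: "(\<forall>w\<in>carrier_vec (2 * n). omega n w (g *\<^sub>v w) = 0) \<or>
    (\<exists>k. \<forall>w\<in>carrier_vec (2 * n). omega n w (g *\<^sub>v (g *\<^sub>v w)) = k * omega n w (g *\<^sub>v w))"
  shows "c = 1" "omega n z y = 0"
proof -
  let ?V = "carrier_vec (2 * n) :: 'a vec set"
  have gv: "g *\<^sub>v v \<in> ?V" if "v \<in> ?V" for v using Sp_vec[OF g that] .
  have gadd: "g *\<^sub>v (v + w) = g *\<^sub>v v + g *\<^sub>v w" if "v \<in> ?V" "w \<in> ?V" for v w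
    by (rule mult_add_distrib_mat_vec[OF Sp_carrier_mat[OF g] that])
  have gsm: "g *\<^sub>v (k \<cdot>\<^sub>v v) = k \<cdot>\<^sub>v (g *\<^sub>v v)" if "v \<in> ?V" for k v
    by (rule mult_mat_vec[OF Sp_carrier_mat[OF g] that])
  have polar: "omega n (v + w) (g *\<^sub>v (v + w)) =
      omega n v (g *\<^sub>v v) + omega n w (g *\<^sub>v w) + (omega n v (g *\<^sub>v w) + omega n w (g *\<^sub>v v))"
    if "v \<in> ?V" "w \<in> ?V" for v w
    using that by (simp add: gadd gv omega_linear)
  have polar2: "omega n (v + w) (g *\<^sub>v (g *\<^sub>v (v + w))) =
      omega n v (g *\<^sub>v (g *\<^sub>v v)) + omega n w (g *\<^sub>v (g *\<^sub>v w)) +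
      (omega n v (g *\<^sub>v (g *\<^sub>v w)) + omega n w (g *\<^sub>v (g *\<^sub>v v)))"
    if "v \<in> ?V" "w \<in> ?V" for v w
    using that by (simp add: gadd gv omega_linear)
  obtain x where x: "x \<in> ?V" "omega n p x = 1" using exists_omega_one[OF car(1) nz(1)] by blast
  have xp: "omega n x p = 1" using omega_sym_char2[OF car(1) x(1)] x(2) by simp
  have 1: "omega n x (g *\<^sub>v p) + omega n p (g *\<^sub>v x) = l + 1 / l"
    using x xp car by (simp add: gp omega_p_g omega_linear)
  have "\<not> (\<forall>w\<in>?V. omega n w (g *\<^sub>v w) = 0)"
  proof
    assume "\<forall>w\<in>?V. omega n w (g *\<^sub>v w) = 0"
    then have "omega n x (g *\<^sub>v p) + omega n p (g *\<^sub>v x) = 0" using polar[OF x(1) car(1)] x(1) car(1) by simp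
    then show False using 1 e_nonzero by simp
  qed
  then obtain k where k: "\<forall>w\<in>?V. omega n w (g *\<^sub>v (g *\<^sub>v w)) = k * omega n w (g *\<^sub>v w)"
    using ratio by blast
  have pol: "omega n v (g *\<^sub>v (g *\<^sub>v w)) + omega n w (g *\<^sub>v (g *\<^sub>v v)) =
      k * (omega n v (g *\<^sub>v w) + omega n w (g *\<^sub>v v))" if vw: "v \<in> ?V" "w \<in> ?V" for v w
  proof -
    have "v + w \<in> ?V" using vw by simp
    then have "omega n (v + w) (g *\<^sub>v (g *\<^sub>v (v + w))) = k * omega n (v + w) (g *\<^sub>v (v + w))"
      using k by blast
    then show ?thesis
      unfolding polar[OF vw] polar2[OF vw] using k vw by (simp add: algebra_simps)
  qed
  have "omega n x (g *\<^sub>v (g *\<^sub>v p)) + omega n p (g *\<^sub>v (g *\<^sub>v x)) = l * l + (1 / l) * (1 / l)"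
    using x xp car by (simp add: gp gsm omega_p_g gv omega_linear)
  then have "k * (l + 1 / l) = (l + 1 / l) * (l + 1 / l)"
    using pol[OF x(1) car(1)] 1 by (simp add: square_add_char2)
  then have k0: "k \<noteq> 0" using e_nonzero by auto
  \<comment> \<open>This \<open>v\<close> pairs to 0 with \<open>z\<close> and to 1 with
    \<open>y\<close>, so pairing with it reads off the \<open>y\<close>-coefficient on the
    chain.\<close>
  obtain v where v: "v \<in> ?V" "omega n y v = 1" "omega n z v = 0"
    using exists_omega_values[OF car(3) nz(2) car(2) z_not_multiple] by blast
  have v': "omega n v y = 1" "omega n v z = 0"
    using omega_sym_char2[OF car(3) v(1)] omega_sym_char2[OF car(2) v(1)] v by simp_all
  have "omega n v (g *\<^sub>v z) + omega n z (g *\<^sub>v v) = c + 1 / c"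
    using v v' car by (simp add: gz omega_z_g omega_linear)
  moreover have "omega n v (g *\<^sub>v (g *\<^sub>v z)) = c * c + c * c"
    using v v' car by (simp add: gz gy gsm gadd omega_linear)
  moreover have "omega n z (g *\<^sub>v (g *\<^sub>v v)) = (1 / c) * (1 / c) + (1 / c) * (1 / c)"
    using v v' car c_nonzero by (simp add: omega_z_g omega_y_g gv add_divide_distrib)
  ultimately have "k * (c + 1 / c) = 0" using pol[OF v(1) car(2)] by (simp add: double_char2)
  then show c1: "c = 1" using k0 add_inverse_nonzero_char2[OF c_nonzero] by auto
  have "g *\<^sub>v z = z + y" using gz c1 car by simp
  moreover have "g *\<^sub>v y = y" using gy c1 car by simp
  ultimately have "g *\<^sub>v (g *\<^sub>v z) = z + y + y" using gadd[OF car(2,3)] by simp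
  then have "omega n z (g *\<^sub>v (g *\<^sub>v z)) = omega n z y + omega n z y"
    using car by (simp add: omega_linear omega_self)
  then have "k * omega n z (g *\<^sub>v z) = 0" using k car by (simp add: double_char2)
  then show "omega n z y = 0"
    using k0 \<open>g *\<^sub>v z = z + y\<close> car by (simp add: omega_linear omega_self)
qed

text \<open>Take \<open>w1 = p + z\<close> and a \<open>w2\<close> pairing to 1, 1 and
  \<open>b\<close> with \<open>p\<close>, \<open>z\<close> and \<open>y\<close>. The pair is
  isotropic because 1 + 1 = 0, and \<open>b\<close> enters both mixed values equally, so their
  difference does not see it.\<close>

lemma isotropic_pair:
  assumes c1: "c = 1" and zy: "omega n z y = 0"
  shows "\<exists>w1\<in>carrier_vec (2 * n). \<exists>w2\<in>carrier_vec (2 * n). w1 \<noteq> 0\<^sub>v (2 * n) \<and> (\<forall>k. w2 \<noteq> k \<cdot>\<^sub>v w1) \<and>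
    omega n w1 w2 = 0 \<and> omega n w1 (g *\<^sub>v w1) = 0 \<and>
    omega n w1 (g *\<^sub>v w2) = 1 / l + 1 + b \<and> omega n w2 (g *\<^sub>v w1) = l + 1 + b"
proof -
  let ?V = "carrier_vec (2 * n) :: 'a vec set"
  have gv: "g *\<^sub>v v \<in> ?V" if "v \<in> ?V" for v using Sp_vec[OF g that] .
  have gadd: "g *\<^sub>v (v + w) = g *\<^sub>v v + g *\<^sub>v w" if "v \<in> ?V" "w \<in> ?V" for v w
    by (rule mult_add_distrib_mat_vec[OF Sp_carrier_mat[OF g] that])
  have gz': "g *\<^sub>v z = z + y" and gy': "g *\<^sub>v y = y" using gz gy c1 car by simp_all
  obtain t0 where t0: "t0 \<in> ?V" "omega n y t0 = b" "omega n z t0 = 1"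
    using exists_omega_values[OF car(3) nz(2) car(2) z_not_multiple] by blast
  obtain x where x: "x \<in> ?V" "omega n p x = 1" using exists_omega_one[OF car(1) nz(1)] by blast
  \<comment> \<open>Since g^2 + 1 = (g + 1)^2 kills the chain but not \<open>p\<close>, this vector
    is orthogonal to \<open>z\<close> and \<open>y\<close> and pairs nontrivially with
    \<open>p\<close>. It corrects the pairing of \<open>t0\<close> with \<open>p\<close> without
    disturbing the other two.\<close>
  define t1 where "t1 = g *\<^sub>v (g *\<^sub>v x) + x"
  have t1: "t1 \<in> ?V" unfolding t1_def using x gv by simp
  have yt1: "omega n y t1 = 0"
    unfolding t1_def using x car by (simp add: omega_linear gv omega_y_g c1 double_char2)
  have "omega n z t1 = (omega n z x + omega n y x + omega n y x) + omega n z x"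
    unfolding t1_def using x car by (simp add: omega_linear gv omega_y_g omega_z_g c1)
  also have "\<dots> = (omega n z x + omega n z x) + (omega n y x + omega n y x)" by (simp only: ac_simps)
  finally have zt1: "omega n z t1 = 0" by (simp only: double_char2 add_0)
  let ?e = "omega n p t1"
  have "?e = 1 / l / l + 1"
    unfolding t1_def using x car by (simp add: omega_linear gv omega_p_g)
  also have "\<dots> = (1 / l) * (l + 1 / l)" using l_nonzero by (simp add: field_simps)
  finally have "?e = (1 / l) * (l + 1 / l)" .
  then have e0: "?e \<noteq> 0" using e_nonzero l_nonzero by simp
  let ?w1 = "p + z" and ?w2 = "t0 + ((1 - omega n p t0) / ?e) \<cdot>\<^sub>v t1"
  have w: "?w1 \<in> ?V" "?w2 \<in> ?V" using car t0 t1 by simp_all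
  have pw2: "omega n p ?w2 = 1" using car t0 t1 e0 by (simp add: omega_linear)
  have zw2: "omega n z ?w2 = 1" using car t0 t1 zt1 by (simp add: omega_linear)
  have yw2: "omega n y ?w2 = b" using car t0 t1 yt1 by (simp add: omega_linear)
  \<comment> \<open>Invariance makes eigenvectors orthogonal unless their eigenvalues are inverse to
    each other; here they are \<open>l\<close> and 1. The same reasoning then reaches
    \<open>z\<close>.\<close>
  have "omega n p y = omega n p y / l" using omega_p_g[OF car(3)] gy' by simp
  then have py: "omega n p y = 0" using l1 l_nonzero by (simp add: field_simps)
  then have "omega n p z = omega n p z / l" using omega_p_g[OF car(2)] gz' car by (simp add: omega_linear)
  then have pz: "omega n p z = 0" using l1 l_nonzero by (simp add: field_simps)
  have rev: "omega n z p = 0" "omega n y p = 0" "omega n y z = 0"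
    using omega_sym_char2[OF car(1,2)] omega_sym_char2[OF car(1,3)] omega_sym_char2[OF car(2,3)] pz py zy
    by simp_all
  have iso: "omega n ?w1 ?w2 = 0"
    using car w pw2 zw2 double_char2[of 1] by (simp add: omega_add_left)
  have q1: "omega n ?w1 (g *\<^sub>v ?w1) = 0"
    using car w pz rev by (simp add: omega_add_left gv omega_p_g omega_z_g omega_add_right omega_self c1)
  have q12: "omega n ?w1 (g *\<^sub>v ?w2) = 1 / l + 1 + b"
    using car w pw2 zw2 yw2 by (simp add: omega_add_left gv omega_p_g omega_z_g c1 add.assoc)
  have q21: "omega n ?w2 (g *\<^sub>v ?w1) = l + 1 + b"
    using omega_sym_char2[OF car(1) w(2)] omega_sym_char2[OF car(2) w(2)] omega_sym_char2[OF car(3) w(2)]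
      pw2 zw2 yw2 car w(2) by (simp add: gadd gp gz' omega_add_right omega_smult_right add.assoc)
  have "?w1 \<noteq> 0\<^sub>v (2 * n)"
  proof
    assume 0: "?w1 = 0\<^sub>v (2 * n)"
    \<comment> \<open>Here \<open>p\<close> equals \<open>z\<close>, and applying \<open>g\<close>
      gives \<open>l \<cdot>\<^sub>v z = z + y\<close>, which would make \<open>z\<close> a multiple
      of \<open>y\<close>.\<close>
    have "z = (1 / (l + 1)) \<cdot>\<^sub>v y"
    proof (rule eq_vecI)
      fix i assume "i < dim_vec ((1 / (l + 1)) \<cdot>\<^sub>v y)"
      then have i: "i < 2 * n" using car by simp
      have "(p + z) $ i = 0" using 0 i by simp
      then have "p $ i + z $ i = 0" using i car by simp
      then have pi: "p $ i = z $ i" using eq_iff_char2 by blast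
      have "g *\<^sub>v (p + z) = 0\<^sub>v (2 * n)" unfolding 0 by (rule mult_mat_zero_vec[OF Sp_carrier_mat[OF g]])
      then have "(l \<cdot>\<^sub>v p + (z + y)) $ i = 0" using gadd[OF car(1,2)] gp gz' i by simp
      then have "(l + 1) * z $ i + y $ i = 0" using i car pi by (simp add: algebra_simps)
      then have "(l + 1) * z $ i = y $ i" using eq_iff_char2 by blast
      moreover have "l + 1 \<noteq> 0" using l1 eq_iff_char2[of l 1] by simp
      ultimately show "z $ i = ((1 / (l + 1)) \<cdot>\<^sub>v y) $ i" using i car by (simp add: field_simps)
    qed (use car in simp)
    then show False using z_not_multiple by blast
  qed
  moreover have "?w2 \<noteq> k \<cdot>\<^sub>v ?w1" for k
  proof
    assume "?w2 = k \<cdot>\<^sub>v ?w1"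
    then have "omega n p ?w2 = omega n p (k \<cdot>\<^sub>v ?w1)" by simp
    also have "\<dots> = 0" using car w pz by (simp add: omega_smult_right omega_add_right omega_self)
    finally show False using pw2 by simp
  qed
  ultimately show ?thesis using w iso q1 q12 q21 by blast
qed

text \<open>On the pairs of \<open>isotropic_pair\<close> the squared difference is the constant
  \<open>(l + 1 / l)^2\<close>, while the determinant is, up to sign,
  \<open>(1 / l + 1 + b) * (l + 1 + b)\<close>, which varies with \<open>b\<close>.\<close>

lemma second_ratio_not_constant:
  assumes c1: "c = 1" and zy: "omega n z y = 0"
    and ratio: "(\<forall>w1\<in>carrier_vec (2 * n). \<forall>w2\<in>carrier_vec (2 * n). w1 \<noteq> 0\<^sub>v (2 * n) \<longrightarrow>
        (\<forall>k. w2 \<noteq> k \<cdot>\<^sub>v w1) \<longrightarrow> omega n w1 w2 = 0 \<longrightarrow>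
        (omega n w1 (g *\<^sub>v w2) - omega n w2 (g *\<^sub>v w1))\<^sup>2 = 0) \<or>
      (\<exists>r. \<forall>w1\<in>carrier_vec (2 * n). \<forall>w2\<in>carrier_vec (2 * n). w1 \<noteq> 0\<^sub>v (2 * n) \<longrightarrow>
        (\<forall>k. w2 \<noteq> k \<cdot>\<^sub>v w1) \<longrightarrow> omega n w1 w2 = 0 \<longrightarrow>
        omega n w1 (g *\<^sub>v w1) * omega n w2 (g *\<^sub>v w2) - omega n w1 (g *\<^sub>v w2) * omega n w2 (g *\<^sub>v w1) =
        r * (omega n w1 (g *\<^sub>v w2) - omega n w2 (g *\<^sub>v w1))\<^sup>2)"
  shows False
proof -
  have diff: "(1 / l + 1 + b) - (l + 1 + b) = l + 1 / l" for b
    using double_char2[of l] by (simp add: algebra_simps)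
  have const: "(l + 1 / l)\<^sup>2 = 0 \<or> (\<exists>r. \<forall>b. (1 / l + 1 + b) * (l + 1 + b) = r * (l + 1 / l)\<^sup>2)"
    using ratio
  proof
    assume *: "\<forall>w1\<in>carrier_vec (2 * n). \<forall>w2\<in>carrier_vec (2 * n). w1 \<noteq> 0\<^sub>v (2 * n) \<longrightarrow>
        (\<forall>k. w2 \<noteq> k \<cdot>\<^sub>v w1) \<longrightarrow> omega n w1 w2 = 0 \<longrightarrow>
        (omega n w1 (g *\<^sub>v w2) - omega n w2 (g *\<^sub>v w1))\<^sup>2 = 0"
    obtain w1 w2 where "w1 \<in> carrier_vec (2 * n)" "w2 \<in> carrier_vec (2 * n)" "w1 \<noteq> 0\<^sub>v (2 * n)"
      "\<forall>k. w2 \<noteq> k \<cdot>\<^sub>v w1" "omega n w1 w2 = 0"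
      "omega n w1 (g *\<^sub>v w2) = 1 / l + 1 + 0" "omega n w2 (g *\<^sub>v w1) = l + 1 + 0"
      using isotropic_pair[OF c1 zy, of 0] by blast
    then have "((1 / l + 1 + 0) - (l + 1 + 0))\<^sup>2 = 0" using * by metis
    then show ?thesis unfolding diff by blast
  next
    assume "\<exists>r. \<forall>w1\<in>carrier_vec (2 * n). \<forall>w2\<in>carrier_vec (2 * n). w1 \<noteq> 0\<^sub>v (2 * n) \<longrightarrow>
        (\<forall>k. w2 \<noteq> k \<cdot>\<^sub>v w1) \<longrightarrow> omega n w1 w2 = 0 \<longrightarrow>
        omega n w1 (g *\<^sub>v w1) * omega n w2 (g *\<^sub>v w2) - omega n w1 (g *\<^sub>v w2) * omega n w2 (g *\<^sub>v w1) =
        r * (omega n w1 (g *\<^sub>v w2) - omega n w2 (g *\<^sub>v w1))\<^sup>2"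
    then obtain r where r: "\<And>w1 w2. w1 \<in> carrier_vec (2 * n) \<Longrightarrow> w2 \<in> carrier_vec (2 * n) \<Longrightarrow>
        w1 \<noteq> 0\<^sub>v (2 * n) \<Longrightarrow> \<forall>k. w2 \<noteq> k \<cdot>\<^sub>v w1 \<Longrightarrow> omega n w1 w2 = 0 \<Longrightarrow>
        omega n w1 (g *\<^sub>v w1) * omega n w2 (g *\<^sub>v w2) - omega n w1 (g *\<^sub>v w2) * omega n w2 (g *\<^sub>v w1) =
        r * (omega n w1 (g *\<^sub>v w2) - omega n w2 (g *\<^sub>v w1))\<^sup>2" by blast
    have "(1 / l + 1 + b) * (l + 1 + b) = r * (l + 1 / l)\<^sup>2" for b
    proof -
      obtain w1 w2 where w: "w1 \<in> carrier_vec (2 * n)" "w2 \<in> carrier_vec (2 * n)" "w1 \<noteq> 0\<^sub>v (2 * n)"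
        "\<forall>k. w2 \<noteq> k \<cdot>\<^sub>v w1" "omega n w1 w2 = 0" "omega n w1 (g *\<^sub>v w1) = 0"
        "omega n w1 (g *\<^sub>v w2) = 1 / l + 1 + b" "omega n w2 (g *\<^sub>v w1) = l + 1 + b"
        using isotropic_pair[OF c1 zy, of b] by blast
      have "- ((1 / l + 1 + b) * (l + 1 + b)) = r * ((1 / l + 1 + b) - (l + 1 + b))\<^sup>2"
        using r[OF w(1-5)] unfolding w(6-8) by simp
      then show ?thesis unfolding diff minus_char2 .
    qed
    then show ?thesis by blast
  qed
  then obtain r where r: "\<And>b. (1 / l + 1 + b) * (l + 1 + b) = r * (l + 1 / l)\<^sup>2"
    using e_nonzero by auto
  \<comment> \<open>The choice \<open>b = 1 / l + 1\<close> kills the first factor and forces the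
    constant to be 0, whereas \<open>b = 0\<close> leaves \<open>(l + 1)^2 / l\<close>.\<close>
  have "(1 / l + 1 + (1 / l + 1)) * (l + 1 + (1 / l + 1)) = 0"
    by (simp only: double_char2[of "1 / l + 1"] mult_zero_left)
  with r[of "1 / l + 1"] have "r * (l + 1 / l)\<^sup>2 = 0" by (rule trans[OF sym])
  then have "(1 / l + 1) * (l + 1) = 0" using r[of 0] by simp
  moreover have "l + 1 \<noteq> 0" using l1 eq_iff_char2[of l 1] by simp
  moreover have "1 / l + 1 = (l + 1) / l" using l_nonzero by (simp add: field_simps)
  ultimately show False using l_nonzero by simp
qed

end

end

section \<open>Semi-invariants on a conjugacy class with a dense orbit\<close>

lemma regular_fun_omega:
  fixes v w :: "'a::field vec"
  assumes F: "regular_map m (2 * n) F" and v: "v \<in> carrier_vec (2 * n)" and w: "w \<in> carrier_vec (2 * n)"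
  shows "regular_fun m (\<lambda>A. omega n v (F A *\<^sub>v w))"
proof (rule regular_fun_cong)
  show "omega n v (F A *\<^sub>v w) =
      (\<Sum>i<n. v $ i * (F A *\<^sub>v w) $ (n + i) - v $ (n + i) * (F A *\<^sub>v w) $ i)"
    if "A \<in> carrier_mat m m" for A
    by (rule omega_sum[OF v mult_mat_vec_carrier[OF regular_map_closed[OF F that] w]])
  show "regular_fun m (\<lambda>A. \<Sum>i<n. v $ i * (F A *\<^sub>v w) $ (n + i) - v $ (n + i) * (F A *\<^sub>v w) $ i)"
    by (intro regular_fun_sum regular_fun_diff regular_fun_mult regular_fun_const
        regular_fun_mult_mat_vec[OF F w]) auto
qed

lemma regular_vanishes_on_closure:
  fixes C :: "'a::idom mat set"
  assumes dense: "(subtopology (zariski m) C) closure_of S = C" and C: "C \<subseteq> carrier_mat m m"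
    and S: "S \<subseteq> C" and f: "regular_fun m f" and 0: "\<And>x. x \<in> S \<Longrightarrow> f x = 0" and x: "x \<in> C"
  shows "f x = 0"
proof -
  let ?Z = "{A \<in> carrier_mat m m. \<forall>h\<in>{f}. h A = 0}"
  have "closedin (zariski m) ?Z" by (rule closedin_regular) (use f in simp)
  then have "closedin (subtopology (zariski m) C) (?Z \<inter> C)"
    unfolding closedin_subtopology by (intro exI[of _ ?Z]) auto
  moreover have "S \<subseteq> ?Z \<inter> C" using S C 0 by auto
  ultimately have "(subtopology (zariski m) C) closure_of S \<subseteq> ?Z \<inter> C" by (intro closure_of_minimal)
  then show ?thesis using dense x by auto
qed

text \<open>The scalar \<open>t\<close> is the value of the common character. If \<open>f\<close>
  does not vanish at \<open>x0\<close>, then \<open>h - (h x0 / f x0) f\<close> vanishes on the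
  orbit, hence on its closure; the disjunction takes care of a denominator that is identically
  zero.\<close>

lemma semi_invariant_ratio_constant:
  fixes C :: "'a::field mat set"
  assumes dense: "(subtopology (zariski m) C) closure_of S = C" and C: "C \<subseteq> carrier_mat m m"
    and S: "S \<subseteq> C" and f: "regular_fun m f" and h: "regular_fun m h"
    and semi: "\<And>x. x \<in> S \<Longrightarrow> \<exists>t. f x = t * f x0 \<and> h x = t * h x0"
  shows "(\<forall>x\<in>C. f x = 0) \<or> (\<exists>r. \<forall>x\<in>C. h x = r * f x)"
proof (cases "f x0 = 0")
  case True
  then have "f x = 0" if "x \<in> S" for x using semi[OF that] by auto
  then show ?thesis using regular_vanishes_on_closure[OF dense C S f] by blast
next
  case False
  let ?r = "h x0 / f x0"
  have "h x - ?r * f x = 0" if "x \<in> S" for x using semi[OF that] False by auto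
  moreover have "regular_fun m (\<lambda>x. h x - ?r * f x)"
    by (intro regular_fun_diff regular_fun_mult regular_fun_const f h)
  ultimately have "h x - ?r * f x = 0" if "x \<in> C" for x
    using regular_vanishes_on_closure[OF dense C S _ _ that, of "\<lambda>x. h x - ?r * f x"] by blast
  then have "\<forall>x\<in>C. h x = ?r * f x" by simp
  then show ?thesis by blast
qed

section \<open>Moving a conjugation from the matrix to the vectors\<close>

context
  fixes n :: nat and b :: "'a::field mat"
  assumes b: "b \<in> carrier (Sp n)"
begin

lemma inv_Sp_carrier: "inv\<^bsub>Sp n\<^esub> b \<in> carrier (Sp n)"
  by (rule group.inv_closed[OF group_Sp b])

lemma inv_Sp_vec:
  assumes v: "v \<in> carrier_vec (2 * n)"
  shows "inv\<^bsub>Sp n\<^esub> b *\<^sub>v (b *\<^sub>v v) = v"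
proof -
  have "inv\<^bsub>Sp n\<^esub> b *\<^sub>v (b *\<^sub>v v) = 1\<^sub>m (2 * n) *\<^sub>v v"
    using Sp_mult_vec[OF inv_Sp_carrier b v] group.l_inv[OF group_Sp b] by (simp add: Sp_def)
  then show ?thesis using v by simp
qed

context
  fixes x :: "'a mat"
  assumes x: "x \<in> carrier (Sp n)"
begin

lemma conj_action_vec:
  assumes v: "v \<in> carrier_vec (2 * n)"
  shows "conj_action (Sp n) b x *\<^sub>v v = b *\<^sub>v (x *\<^sub>v (inv\<^bsub>Sp n\<^esub> b *\<^sub>v v))"
proof -
  have bx: "b \<otimes>\<^bsub>Sp n\<^esub> x \<in> carrier (Sp n)"
    by (rule monoid.m_closed[OF group.is_monoid[OF group_Sp] b x])
  show ?thesis
    unfolding conj_action_def Sp_mult_vec[OF bx inv_Sp_carrier v]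
    by (rule Sp_mult_vec[OF b x Sp_vec[OF inv_Sp_carrier v]])
qed

text \<open>Serves twice: with \<open>b\<close> in the Borel subgroup it gives semi-invariance, and
  with general \<open>b\<close> it trades the flag vectors for arbitrary ones while fixing
  \<open>g\<close>.\<close>

lemma omega_conj_action:
  assumes v: "v \<in> carrier_vec (2 * n)" and w: "w \<in> carrier_vec (2 * n)"
  shows "omega n v (conj_action (Sp n) b x *\<^sub>v w) =
    omega n (inv\<^bsub>Sp n\<^esub> b *\<^sub>v v) (x *\<^sub>v (inv\<^bsub>Sp n\<^esub> b *\<^sub>v w))"
  unfolding conj_action_vec[OF w]
  by (rule omega_Sp_adjoint[OF b v Sp_vec[OF x Sp_vec[OF inv_Sp_carrier w]]])

lemma omega_conj_action_square:
  assumes v: "v \<in> carrier_vec (2 * n)" and w: "w \<in> carrier_vec (2 * n)"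
  shows "omega n v (conj_action (Sp n) b x *\<^sub>v (conj_action (Sp n) b x *\<^sub>v w)) =
    omega n (inv\<^bsub>Sp n\<^esub> b *\<^sub>v v) (x *\<^sub>v (x *\<^sub>v (inv\<^bsub>Sp n\<^esub> b *\<^sub>v w)))"
proof -
  have xw: "x *\<^sub>v (inv\<^bsub>Sp n\<^esub> b *\<^sub>v w) \<in> carrier_vec (2 * n)"
    by (rule Sp_vec[OF x Sp_vec[OF inv_Sp_carrier w]])
  show ?thesis
    using omega_conj_action[OF v Sp_vec[OF b xw]] inv_Sp_vec[OF xw] conj_action_vec[OF w] by simp
qed

end

end

theorem proposition3p20:
  fixes n :: nat and g :: "'k::alg_closed_field mat"
  assumes "CHAR('k) = 2"
    and "n \<ge> 2"
    and "g \<in> carrier (Sp n)"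
    and "mixed (Sp n) g"
  shows "\<not> spherical (zariski (2 * n)) (Sp n) (conjugacy_class (Sp n) g)"
proof
  let ?V = "carrier_vec (2 * n) :: 'k vec set" and ?C = "conjugacy_class (Sp n) g"
  assume "spherical (zariski (2 * n)) (Sp n) ?C"
  then obtain B x0 where "borel_subgroup (zariski (2 * n)) (Sp n) B" and x0: "x0 \<in> ?C"
    and dense: "(subtopology (zariski (2 * n)) ?C) closure_of
      (orbit (Sp n\<lparr>carrier := B\<rparr>) (conj_action (Sp n)) x0) = ?C"
    unfolding spherical_def by blast
  then have B: "subgroup B (Sp n)" "connectedin (zariski (2 * n)) B" "solvable (Sp n\<lparr>carrier := B\<rparr>)"
    unfolding borel_subgroup_def closed_connected_solvable_def by auto
  obtain v1 v2 where v: "v1 \<in> ?V" "v2 \<in> ?V" "v1 \<noteq> 0\<^sub>v (2 * n)" "\<And>k. v2 \<noteq> k \<cdot>\<^sub>v v1" "omega n v1 v2 = 0"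
    and flag1: "\<And>b. b \<in> B \<Longrightarrow> \<exists>c. b *\<^sub>v v1 = c \<cdot>\<^sub>v v1"
    and flag2: "\<And>b. b \<in> B \<Longrightarrow> \<exists>k c. b *\<^sub>v v2 = k \<cdot>\<^sub>v v1 + c \<cdot>\<^sub>v v2"
    using Sp_isotropic_flag[OF assms(2) B] by metis
  let ?S = "orbit (Sp n\<lparr>carrier := B\<rparr>) (conj_action (Sp n)) x0"
  interpret group "Sp n :: 'k mat monoid" by (rule group_Sp)
  have BG: "B \<subseteq> carrier (Sp n)" by (rule subgroup.subset[OF B(1)])
  have g: "g \<in> carrier (Sp n)" by fact
  have C_eq: "?C = {conj_action (Sp n) h g | h. h \<in> carrier (Sp n)}"
    by (simp add: conjugacy_class_def orbit_def)
  have CG: "?C \<subseteq> carrier (Sp n)" unfolding C_eq conj_action_def using g by auto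
  have C: "?C \<subseteq> carrier_mat (2 * n) (2 * n)" using CG Sp_carrier_mat by blast
  have x0G: "x0 \<in> carrier (Sp n)" using x0 CG by auto
  have S_eq: "?S = {conj_action (Sp n) b x0 | b. b \<in> B}" by (simp add: orbit_def)
  have S: "?S \<subseteq> ?C"
  proof
    fix y assume "y \<in> ?S"
    then obtain b where b: "b \<in> B" "y = conj_action (Sp n) b x0" unfolding S_eq by blast
    obtain h where h: "h \<in> carrier (Sp n)" "x0 = conj_action (Sp n) h g" using x0 unfolding C_eq by blast
    have bG: "b \<in> carrier (Sp n)" using b BG by auto
    have "y = conj_action (Sp n) (b \<otimes>\<^bsub>Sp n\<^esub> h) g"
      unfolding b h conj_action_def using bG h g by (simp add: inv_mult_group m_assoc)
    then show "y \<in> ?C" unfolding C_eq using bG h by blast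
  qed
  have inv1: "\<exists>c. inv\<^bsub>Sp n\<^esub> b *\<^sub>v v1 = c \<cdot>\<^sub>v v1" if "b \<in> B" for b
    by (rule flag1[OF subgroup.m_inv_closed[OF B(1) that]])
  have inv2: "\<exists>k c. inv\<^bsub>Sp n\<^esub> b *\<^sub>v v2 = k \<cdot>\<^sub>v v1 + c \<cdot>\<^sub>v v2" if "b \<in> B" for b
    by (rule flag2[OF subgroup.m_inv_closed[OF B(1) that]])
  have mv_smult: "A *\<^sub>v (c \<cdot>\<^sub>v w) = c \<cdot>\<^sub>v (A *\<^sub>v w)" if "A \<in> carrier (Sp n)" "w \<in> ?V" for A c w
    by (rule mult_mat_vec[OF Sp_carrier_mat[OF that(1)] that(2)])
  have mv_add: "A *\<^sub>v (u + w) = A *\<^sub>v u + A *\<^sub>v w" if "A \<in> carrier (Sp n)" "u \<in> ?V" "w \<in> ?V" for A u w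
    by (rule mult_add_distrib_mat_vec[OF Sp_carrier_mat[OF that(1)] that(2,3)])
  have xv: "x0 *\<^sub>v w \<in> ?V" if "w \<in> ?V" for w by (rule Sp_vec[OF x0G that])

  have "(\<forall>x\<in>?C. omega n v1 (x *\<^sub>v v1) = 0) \<or>
      (\<exists>r. \<forall>x\<in>?C. omega n v1 (x *\<^sub>v (x *\<^sub>v v1)) = r * omega n v1 (x *\<^sub>v v1))"
  proof (rule semi_invariant_ratio_constant[OF dense C S])
    show "regular_fun (2 * n) (\<lambda>x. omega n v1 (x *\<^sub>v v1))"
      by (rule regular_fun_omega[OF regular_map_id v(1,1)])
    show "regular_fun (2 * n) (\<lambda>x. omega n v1 (x *\<^sub>v (x *\<^sub>v v1)))"
    proof (rule regular_fun_cong)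
      show "regular_fun (2 * n) (\<lambda>x. omega n v1 ((x * x) *\<^sub>v v1))"
        by (rule regular_fun_omega[OF regular_map_mult[OF regular_map_id regular_map_id] v(1,1)])
      show "omega n v1 (A *\<^sub>v (A *\<^sub>v v1)) = omega n v1 ((A * A) *\<^sub>v v1)"
        if "A \<in> carrier_mat (2 * n) (2 * n)" for A
        using assoc_mult_mat_vec[OF that that v(1)] by simp
    qed
    fix y assume "y \<in> ?S"
    then obtain b where b: "b \<in> B" "y = conj_action (Sp n) b x0" unfolding S_eq by blast
    have bG: "b \<in> carrier (Sp n)" using b BG by auto
    obtain c where c: "inv\<^bsub>Sp n\<^esub> b *\<^sub>v v1 = c \<cdot>\<^sub>v v1" using inv1[OF b(1)] by blast
    have "omega n v1 (y *\<^sub>v v1) = (c * c) * omega n v1 (x0 *\<^sub>v v1)"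
      unfolding b omega_conj_action[OF bG x0G v(1,1)] c
      using v(1) x0G by (simp add: mv_smult xv omega_linear)
    moreover have "omega n v1 (y *\<^sub>v (y *\<^sub>v v1)) = (c * c) * omega n v1 (x0 *\<^sub>v (x0 *\<^sub>v v1))"
      unfolding b omega_conj_action_square[OF bG x0G v(1,1)] c
      using v(1) x0G by (simp add: mv_smult xv omega_linear)
    ultimately show "\<exists>t. omega n v1 (y *\<^sub>v v1) = t * omega n v1 (x0 *\<^sub>v v1) \<and>
        omega n v1 (y *\<^sub>v (y *\<^sub>v v1)) = t * omega n v1 (x0 *\<^sub>v (x0 *\<^sub>v v1))" by blast
  qed
  moreover have "\<exists>x\<in>?C. omega n w (g *\<^sub>v w) = omega n v1 (x *\<^sub>v v1) \<and>
      omega n w (g *\<^sub>v (g *\<^sub>v w)) = omega n v1 (x *\<^sub>v (x *\<^sub>v v1))" if w: "w \<in> ?V" "w \<noteq> 0\<^sub>v (2 * n)" for w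
  proof -
    have "w \<noteq> k \<cdot>\<^sub>v 0\<^sub>v (2 * n)" "v1 \<noteq> k \<cdot>\<^sub>v 0\<^sub>v (2 * n)" for k using w v(3) by auto
    then obtain h where h: "h \<in> carrier (Sp n)" "h *\<^sub>v w = v1"
      using Sp_transitive[OF zero_carrier_vec w(1) v(1)] omega_zero_left w(1) v(1) by blast
    have "inv\<^bsub>Sp n\<^esub> h *\<^sub>v v1 = w" using inv_Sp_vec[OF h(1) w(1)] h(2) by simp
    then show ?thesis
      using omega_conj_action[OF h(1) g v(1,1)] omega_conj_action_square[OF h(1) g v(1,1)] h(1)
      unfolding C_eq by (intro bexI[of _ "conj_action (Sp n) h g"]) auto
  qed
  ultimately have ratio1: "(\<forall>w\<in>?V. omega n w (g *\<^sub>v w) = 0) \<or>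
      (\<exists>k. \<forall>w\<in>?V. omega n w (g *\<^sub>v (g *\<^sub>v w)) = k * omega n w (g *\<^sub>v w))"
  proof -
    have zero: "omega n (0\<^sub>v (2 * n)) (g *\<^sub>v w) = 0" if "w \<in> ?V" for w
      by (rule omega_zero_left[OF Sp_vec[OF g that]])
    have z: "0\<^sub>v (2 * n) \<in> ?V" "g *\<^sub>v 0\<^sub>v (2 * n) \<in> ?V" using Sp_vec[OF g] by auto
    assume a: "(\<forall>x\<in>?C. omega n v1 (x *\<^sub>v v1) = 0) \<or>
      (\<exists>r. \<forall>x\<in>?C. omega n v1 (x *\<^sub>v (x *\<^sub>v v1)) = r * omega n v1 (x *\<^sub>v v1))"
    assume h: "\<And>w. w \<in> ?V \<Longrightarrow> w \<noteq> 0\<^sub>v (2 * n) \<Longrightarrow>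
      \<exists>x\<in>?C. omega n w (g *\<^sub>v w) = omega n v1 (x *\<^sub>v v1) \<and>
        omega n w (g *\<^sub>v (g *\<^sub>v w)) = omega n v1 (x *\<^sub>v (x *\<^sub>v v1))"
    show ?thesis
      using a
    proof
      assume "\<forall>x\<in>?C. omega n v1 (x *\<^sub>v v1) = 0"
      then have "omega n w (g *\<^sub>v w) = 0" if "w \<in> ?V" for w
        using h[OF that] zero[OF that] by (cases "w = 0\<^sub>v (2 * n)") auto
      then show ?thesis by blast
    next
      assume "\<exists>r. \<forall>x\<in>?C. omega n v1 (x *\<^sub>v (x *\<^sub>v v1)) = r * omega n v1 (x *\<^sub>v v1)"
      then obtain r where r: "\<forall>x\<in>?C. omega n v1 (x *\<^sub>v (x *\<^sub>v v1)) = r * omega n v1 (x *\<^sub>v v1)" ..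
      have "omega n w (g *\<^sub>v (g *\<^sub>v w)) = r * omega n w (g *\<^sub>v w)" if "w \<in> ?V" for w
      proof (cases "w = 0\<^sub>v (2 * n)")
        case True
        then show ?thesis using zero[OF z(1)] zero[OF z(2)] by simp
      next
        case False
        then show ?thesis using h[OF that] r by auto
      qed
      then show ?thesis by blast
    qed
  qed

  \<comment> \<open>On a plane, the Gram matrix changes by congruence: its antisymmetric part scales
    by the determinant of the base change, and its determinant by the square. Squaring the former
    equalises the characters.\<close>
  let ?E = "\<lambda>w1 w2 x. (omega n w1 (x *\<^sub>v w2) - omega n w2 (x *\<^sub>v w1))\<^sup>2 :: 'k"
  let ?D = "\<lambda>w1 w2 x. omega n w1 (x *\<^sub>v w1) * omega n w2 (x *\<^sub>v w2) -
      omega n w1 (x *\<^sub>v w2) * omega n w2 (x *\<^sub>v w1) :: 'k"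
  have reg: "regular_fun (2 * n) (\<lambda>x. omega n u (x *\<^sub>v w))" if "u \<in> ?V" "w \<in> ?V" for u w
    by (rule regular_fun_omega[OF regular_map_id that])
  have "(\<forall>x\<in>?C. ?E v1 v2 x = 0) \<or> (\<exists>r. \<forall>x\<in>?C. ?D v1 v2 x = r * ?E v1 v2 x)"
  proof (rule semi_invariant_ratio_constant[OF dense C S])
    show "regular_fun (2 * n) (?E v1 v2)"
      unfolding power2_eq_square by (intro regular_fun_mult regular_fun_diff reg v)
    show "regular_fun (2 * n) (?D v1 v2)"
      by (intro regular_fun_mult regular_fun_diff reg v)
    fix y assume "y \<in> ?S"
    then obtain b where b: "b \<in> B" "y = conj_action (Sp n) b x0" unfolding S_eq by blast
    have bG: "b \<in> carrier (Sp n)" using b BG by auto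
    obtain c where c: "inv\<^bsub>Sp n\<^esub> b *\<^sub>v v1 = c \<cdot>\<^sub>v v1" using inv1[OF b(1)] by blast
    obtain k e where ke: "inv\<^bsub>Sp n\<^esub> b *\<^sub>v v2 = k \<cdot>\<^sub>v v1 + e \<cdot>\<^sub>v v2" using inv2[OF b(1)] by blast
    let ?b = "\<lambda>u w. omega n u (x0 *\<^sub>v w)"
    have 11: "omega n v1 (y *\<^sub>v v1) = c * c * ?b v1 v1"
      unfolding b omega_conj_action[OF bG x0G v(1,1)] c
      using v(1,2) x0G by (simp add: mv_smult xv omega_linear)
    have 12: "omega n v1 (y *\<^sub>v v2) = c * k * ?b v1 v1 + c * e * ?b v1 v2"
      unfolding b omega_conj_action[OF bG x0G v(1,2)] c ke
      using v(1,2) x0G by (simp add: mv_smult mv_add xv omega_linear distrib_left mult.assoc)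
    have 21: "omega n v2 (y *\<^sub>v v1) = c * k * ?b v1 v1 + c * e * ?b v2 v1"
      unfolding b omega_conj_action[OF bG x0G v(2,1)] c ke
      using v(1,2) x0G by (simp add: mv_smult mv_add xv omega_linear distrib_left mult.assoc)
    have 22: "omega n v2 (y *\<^sub>v v2) = k * k * ?b v1 v1 + k * e * ?b v1 v2 + e * k * ?b v2 v1 + e * e * ?b v2 v2"
      unfolding b omega_conj_action[OF bG x0G v(2,2)] ke
      using v(1,2) x0G by (simp add: mv_smult mv_add xv omega_linear distrib_left mult.assoc add.assoc)
    \<comment> \<open>The term \<open>c * k * ?b v1 v1\<close>, common to \<open>12\<close> and
      \<open>21\<close>, cancels in the difference.\<close>
    have "?E v1 v2 y = (c * e)\<^sup>2 * ?E v1 v2 x0"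
      unfolding 12 21 by (simp add: power2_eq_square algebra_simps)
    moreover have "?D v1 v2 y = (c * e)\<^sup>2 * ?D v1 v2 x0"
      unfolding 11 12 21 22 by (simp add: power2_eq_square algebra_simps)
    ultimately show "\<exists>t. ?E v1 v2 y = t * ?E v1 v2 x0 \<and> ?D v1 v2 y = t * ?D v1 v2 x0" by blast
  qed
  \<comment> \<open>Two moves: \<open>h\<close> takes \<open>w1\<close> to \<open>v1\<close>, then
    \<open>h'\<close> fixes \<open>v1\<close> and takes the image of \<open>w2\<close> to
    \<open>v2\<close>; both are still orthogonal to \<open>v1\<close>.\<close>
  moreover have pair: "\<exists>x\<in>?C. ?E w1 w2 g = ?E v1 v2 x \<and> ?D w1 w2 g = ?D v1 v2 x"
    if w: "w1 \<in> ?V" "w2 \<in> ?V" "w1 \<noteq> 0\<^sub>v (2 * n)" "\<forall>k. w2 \<noteq> k \<cdot>\<^sub>v w1" "omega n w1 w2 = 0" for w1 w2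
  proof -
    have "w1 \<noteq> k \<cdot>\<^sub>v 0\<^sub>v (2 * n)" "v1 \<noteq> k \<cdot>\<^sub>v 0\<^sub>v (2 * n)" for k using w(3) v(3) by auto
    then obtain h where h: "h \<in> carrier (Sp n)" "h *\<^sub>v w1 = v1"
      using Sp_transitive[OF zero_carrier_vec w(1) v(1)] omega_zero_left w(1) v(1) by blast
    have hw2: "h *\<^sub>v w2 \<in> ?V" by (rule Sp_vec[OF h(1) w(2)])
    have "omega n v1 (h *\<^sub>v w2) = 0" using omega_Sp[OF h(1) w(1,2)] h(2) w(5) by simp
    moreover have "h *\<^sub>v w2 \<noteq> k \<cdot>\<^sub>v v1" for k
    proof
      assume "h *\<^sub>v w2 = k \<cdot>\<^sub>v v1"
      then have hk: "h *\<^sub>v w2 = h *\<^sub>v (k \<cdot>\<^sub>v w1)" using mv_smult[OF h(1) w(1)] h(2) by simp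
      have "w2 = inv\<^bsub>Sp n\<^esub> h *\<^sub>v (h *\<^sub>v w2)" by (rule inv_Sp_vec[OF h(1) w(2), symmetric])
      also have "\<dots> = k \<cdot>\<^sub>v w1" unfolding hk by (rule inv_Sp_vec[OF h(1)]) (use w(1) in simp)
      finally have "w2 = k \<cdot>\<^sub>v w1" .
      then show False using w(4) by blast
    qed
    ultimately obtain h' where h': "h' \<in> carrier (Sp n)" "h' *\<^sub>v (h *\<^sub>v w2) = v2" "h' *\<^sub>v v1 = v1"
      using Sp_transitive[OF v(1) hw2 v(2)] v(4,5) by blast
    let ?h = "h' \<otimes>\<^bsub>Sp n\<^esub> h"
    have hh: "?h \<in> carrier (Sp n)" using h h' by blast
    have "?h *\<^sub>v w1 = v1" "?h *\<^sub>v w2 = v2"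
      using Sp_mult_vec[OF h'(1) h(1)] w(1,2) h h' by auto
    then have "inv\<^bsub>Sp n\<^esub> ?h *\<^sub>v v1 = w1" "inv\<^bsub>Sp n\<^esub> ?h *\<^sub>v v2 = w2"
      using inv_Sp_vec[OF hh] w(1,2) by metis+
    then have "omega n v1 (conj_action (Sp n) ?h g *\<^sub>v v1) = omega n w1 (g *\<^sub>v w1)"
      "omega n v1 (conj_action (Sp n) ?h g *\<^sub>v v2) = omega n w1 (g *\<^sub>v w2)"
      "omega n v2 (conj_action (Sp n) ?h g *\<^sub>v v1) = omega n w2 (g *\<^sub>v w1)"
      "omega n v2 (conj_action (Sp n) ?h g *\<^sub>v v2) = omega n w2 (g *\<^sub>v w2)"
      using omega_conj_action[OF hh g] v(1,2) by simp_all
    moreover have "conj_action (Sp n) ?h g \<in> ?C" unfolding C_eq using hh by blast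
    ultimately show ?thesis by (intro bexI[of _ "conj_action (Sp n) ?h g"]) simp_all
  qed
  ultimately have ratio2: "(\<forall>w1\<in>?V. \<forall>w2\<in>?V. w1 \<noteq> 0\<^sub>v (2 * n) \<longrightarrow> (\<forall>k. w2 \<noteq> k \<cdot>\<^sub>v w1) \<longrightarrow>
        omega n w1 w2 = 0 \<longrightarrow> ?E w1 w2 g = 0) \<or>
      (\<exists>r. \<forall>w1\<in>?V. \<forall>w2\<in>?V. w1 \<noteq> 0\<^sub>v (2 * n) \<longrightarrow> (\<forall>k. w2 \<noteq> k \<cdot>\<^sub>v w1) \<longrightarrow>
        omega n w1 w2 = 0 \<longrightarrow> ?D w1 w2 g = r * ?E w1 w2 g)"
  proof (elim disjE exE)
    assume E: "\<forall>x\<in>?C. ?E v1 v2 x = 0"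
    have "?E w1 w2 g = 0"
      if w: "w1 \<in> ?V" "w2 \<in> ?V" "w1 \<noteq> 0\<^sub>v (2 * n)" "\<forall>k. w2 \<noteq> k \<cdot>\<^sub>v w1" "omega n w1 w2 = 0" for w1 w2
    proof -
      obtain x where x: "x \<in> ?C" "?E w1 w2 g = ?E v1 v2 x" using pair[OF w] by blast
      show ?thesis unfolding x(2) by (rule bspec[OF E x(1)])
    qed
    then show ?thesis by (intro disjI1 ballI impI)
  next
    fix r assume D: "\<forall>x\<in>?C. ?D v1 v2 x = r * ?E v1 v2 x"
    have "?D w1 w2 g = r * ?E w1 w2 g"
      if w: "w1 \<in> ?V" "w2 \<in> ?V" "w1 \<noteq> 0\<^sub>v (2 * n)" "\<forall>k. w2 \<noteq> k \<cdot>\<^sub>v w1" "omega n w1 w2 = 0" for w1 w2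
    proof -
      obtain x where x: "x \<in> ?C" "?E w1 w2 g = ?E v1 v2 x" "?D w1 w2 g = ?D v1 v2 x"
        using pair[OF w] by blast
      show ?thesis unfolding x(2,3) by (rule bspec[OF D x(1)])
    qed
    then show ?thesis by (intro disjI2 exI[of _ r] ballI impI)
  qed

  obtain p l z y c where vectors: "p \<in> ?V" "z \<in> ?V" "y \<in> ?V" "p \<noteq> 0\<^sub>v (2 * n)" "y \<noteq> 0\<^sub>v (2 * n)" "l \<noteq> 1"
    "g *\<^sub>v p = l \<cdot>\<^sub>v p" "g *\<^sub>v z = c \<cdot>\<^sub>v (z + y)" "g *\<^sub>v y = c \<cdot>\<^sub>v y"
    using mixed_vectors[OF assms(4)] by metis
  note first = first_ratio_consequences[OF assms(1) g vectors ratio1]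
  show False by (rule second_ratio_not_constant[OF assms(1) g vectors first ratio2])
qed

end
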